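(* Let $d\ge2$, $\kappa\in(0,1/(4d))$, $C,g>0$, $J>9d$, $\ell\in\mathbb S^{d-1}$, suppose the random environment satisfies $(\mathbf{SMG})_{C,g}$, and let $C',C''>3\sqrt d$ be the constants in the definition of $(EC)|\ell$, which depend only on $d,\kappa,C,g,r$. There is a constant $\bar N$ depending only on $d,\kappa,C,g,r,J$ such that if the polynomial condition $(P_J)|\ell$ is fulfilled for some admissible $N_0\ge\bar N$, then $(EC)|\ell$ holds.
   Context: Model. Let $\Lambda=\{e\in\mathbb Z^d:|e|_1=1\}$ and let $\mathcal P_\kappa=\{x\in\mathbb R^{2d}:\sum_{i=1}^{2d}x_i=1,\ x_i\ge 2\kappa\ \forall i\}$ (coordinates indexed by $\Lambda$). Let $\Omega=\mathcal P_\kappa^{\mathbb Z^d}$ with the product $\sigma$-algebra, and let $\mathbb P$ be a probability measure on $\Omega$, stationary and ergodic under spatial shifts, with expectation $\mathbb E$. For $\omega=(\omega(y,e))_{y\in\mathbb Z^d,e\in\Lambda}\in\Omega$ and $x\in\mathbb Z^d$, the quenched law $P_{x,\omega}$ is the law of the Markov chain $(X_n)_{n\ge0}$ on $\mathbb Z^d$ with $X_0=x$ and $P_{x,\omega}[X_{n+1}=X_n+e\mid X_n]=\omega(X_n,e)$, $e\in\Lambda$. The annealed law $P_x$ is the semidirect product $\mathbb P\otimes P_{x,\omega}$ (and also its marginal on paths). $|\cdot|_1$ is the $\ell_1$ norm, $d_1$ the $\ell_1$-distance, $\mathbb S^{d-1}$ the Euclidean unit sphere. For $V\subset\mathbb Z^d$,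 $\partial^rV=\{z\in V^c:d_1(z,V)\le r\}$, $\partial V=\partial^1V$, and $T_V=\inf\{n\ge0:X_n\notin V\}$. Mixing (standing assumption). With $\mathfrak F_A=\sigma(\omega_x:x\in A)$, $\mathbb P$ is $r$-Markovian ($r\ge1$) if for every finite $V\subset\mathbb Z^d$, $\mathbb P[(\omega_x)_{x\in V}\in\cdot\mid\mathfrak F_{V^c}]=\mathbb P[(\omega_x)_{x\in V}\in\cdot\mid\mathfrak F_{\partial^rV}]$ $\mathbb P$-a.s. An $r$-Markovian $\mathbb P$ satisfies $(\mathbf{SMG})_{C,g}$ if for all finite $\Delta\subset V\subset\mathbb Z^d$ with $d_1(\Delta,V^c)\ge r$ and all $A\subset V^c$, $$\frac{d\mathbb P[(\omega_x)_{x\in\Delta}\in\cdot\mid\eta]}{d\mathbb P[(\omega_x)_{x\in\Delta}\in\cdot\mid\eta']}\le\exp\Big(C\sum_{x\in\Delta,y\in A}e^{-g|x-y|_1}\Big)$$ for $\mathbb P$-a.s. all pairs $\eta,\eta'\in\mathcal P_\kappa^{V^c}$ agreeing on $V^c\setminus A$, where $\mathbb P[\cdot\mid\eta]$ is $\mathbb P[\cdot\mid\mathfrak F_{V^c}]$ evaluated at $(\omega_x)_{x\in V^c}=\eta$. Polynomial condition. Fix a rotation $R$ of $\mathbb R^d$ with $R(e_1)=\ell$. Put $\nu_1=\sqrt d$, $v=44$, and for $N_0\ge3\sqrt d$ let $N_{k+1}=\big(\lfloor\frac{15\nu_1N_0\ln(1/(2\kappa))}{2\ln N_0}\rfloor+1\big)v^{k+1}N_k$,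 $k\ge0$. $N_0$ is called admissible if $N_k/N_{k-1}\in110\,\mathbb N$ for every $k\ge1$. Let $\widetilde B_{1,0}(0)=R([0,N_0]\times[0,N_0^3]^{d-1})\cap\mathbb Z^d$, $B_{2,0}(0)=R\big((-\frac{N_0}{11},N_0+\frac{N_0}{11})\times(-\frac{N_0^3}{10},N_0^3+\frac{N_0^3}{10})^{d-1}\big)\cap\mathbb Z^d$, with frontal boundary $\partial^+B_{2,0}(0)=\{z\in\partial B_{2,0}(0):z\cdot\ell\ge\frac{12N_0}{11},\ -\frac{N_0^3}{10}<z\cdot R(e_j)<\frac{11N_0^3}{10}\ \forall j\in[2,d]\}$. $(P_J)|\ell$ is fulfilled for $N_0$ if $\sup_{x\in\widetilde B_{1,0}(0)}P_x[X_{T_{B_{2,0}(0)}}\notin\partial^+B_{2,0}(0)]<N_0^{-J}$. Effective criterion. For a rotation $R$ with $R(e_1)=\ell$ and reals $L,L',\widetilde L>3\sqrt d$, the box specification $\mathcal B=(R,L,L',\widetilde L)$ has box $B_{\mathcal B}=R((-L,L')\times(-\widetilde L,\widetilde L)^{d-1})\cap\mathbb Z^d$ and frontal boundary $\partial^+B_{\mathcal B}=\partial B_{\mathcal B}\cap\{z:z\cdot\ell\ge L',\ |z\cdot R(e_j)|<\widetilde L\ \forall j\in[2,d]\}$. Put $q_{\mathcal B}=P_{0,\omega}[X_{T_{B_{\mathcal B}}}\notin\partial^+B_{\mathcal B}]=1-p_{\mathcal B}$, $\rho_{\mathcal B}=q_{\mathcal B}/p_{\mathcal B}$. $(EC)|\ell$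 holds if $\inf_{\mathcal B,a}C'\widetilde L^{d-1}L^{4(d-1)+1}\mathbb E[\rho_{\mathcal B}^a]<1$, the infimum being over $a\in(0,1]$ and all box specifications $\mathcal B=(R,L-2,L+2,\widetilde L)$ with $R(e_1)=\ell$, $L^4>\widetilde L>L$, $L>C''$. *)

theory Defs
  imports "HOL-Probability.Probability"
begin

text \<open>
  The lattice is \<open>int ^ 'd\<close>, the ambient space \<open>real ^ 'd\<close>, and the dimension is \<open>CARD('d)\<close>.
  An abstract finite index type has no first element, so the index \<open>i1 :: 'd\<close> of the coordinate
  vector \<open>e_1\<close> is a parameter; the indices \<open>j\<close> in \<open>[2,d]\<close> are the \<open>j \<noteq> i1\<close>.
\<close>

section \<open>The lattice\<close>

definition rvec :: "int ^ 'd \<Rightarrow> real ^ 'd" where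
  "rvec z = (\<chi> i. real_of_int (z $ i))"

definition l1 :: "int ^ 'd \<Rightarrow> int" where
  "l1 z = (\<Sum>i\<in>UNIV. \<bar>z $ i\<bar>)"

definition d1 :: "(int ^ 'd) set \<Rightarrow> (int ^ 'd) set \<Rightarrow> ereal" where
  "d1 A B = (INF x\<in>A. INF y\<in>B. ereal (real_of_int (l1 (x - y))))"

definition bdry :: "real \<Rightarrow> (int ^ 'd) set \<Rightarrow> (int ^ 'd) set" where
  "bdry r V = {z. z \<notin> V \<and> d1 {z} V \<le> ereal r}"

definition dirs :: "(int ^ 'd) set" where
  "dirs = {e. l1 e = 1}"

section \<open>Random environments\<close>

type_synonym 'd site = "(int ^ 'd) \<Rightarrow> real"
type_synonym 'd env = "(int ^ 'd) \<Rightarrow> 'd site"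

definition site_simplex :: "real \<Rightarrow> 'd::finite site set" where
  "site_simplex \<kappa> = {p \<in> extensional dirs. (\<Sum>e\<in>dirs. p e) = 1 \<and> (\<forall>e\<in>dirs. p e \<ge> 2 * \<kappa>)}"

definition site_space :: "real \<Rightarrow> 'd::finite site measure" where
  "site_space \<kappa> = restrict_space (PiM dirs (\<lambda>_. borel)) (site_simplex \<kappa>)"

text \<open>Measures of the form \<open>PiM A (\<lambda>_. site_space \<kappa>)\<close> serve only as measurable spaces.\<close>

abbreviation conf_space :: "real \<Rightarrow> (int ^ 'd) set \<Rightarrow> 'd::finite env measure" where
  "conf_space \<kappa> A \<equiv> PiM A (\<lambda>_. site_space \<kappa>)"

definition shift :: "int ^ 'd \<Rightarrow> 'd::finite env \<Rightarrow> 'd::finite env" where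
  "shift z \<omega> = (\<lambda>x. \<omega> (x + z))"

definition random_environment :: "real \<Rightarrow> 'd::finite env measure \<Rightarrow> bool" where
  "random_environment \<kappa> \<P> \<longleftrightarrow>
     prob_space \<P> \<and> sets \<P> = sets (conf_space \<kappa> UNIV) \<and>
     (\<forall>z. distr \<P> \<P> (shift z) = \<P>) \<and>
     (\<forall>E\<in>sets \<P>. (\<forall>z. shift z -` E \<inter> space \<P> = E) \<longrightarrow>
        measure \<P> E = 0 \<or> measure \<P> E = 1)"

section \<open>Mixing\<close>

definition env_sigma :: "real \<Rightarrow> (int ^ 'd) set \<Rightarrow> 'd::finite env measure" where
  "env_sigma \<kappa> A = sigma (space (conf_space \<kappa> UNIV))
     {(\<lambda>\<omega>. \<omega> x) -` B \<inter> space (conf_space \<kappa> UNIV) | x B. x \<in> A \<and> B \<in> sets (site_space \<kappa>)}"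

definition cond_prob_conf ::
    "real \<Rightarrow> 'd::finite env measure \<Rightarrow> (int ^ 'd) set \<Rightarrow> 'd::finite env set \<Rightarrow> (int ^ 'd) set \<Rightarrow> 'd::finite env \<Rightarrow> real" where
  "cond_prob_conf \<kappa> \<P> W E A =
     real_cond_exp \<P> (env_sigma \<kappa> A) (\<lambda>\<omega>. indicator E (restrict \<omega> W))"

definition r_markovian :: "real \<Rightarrow> real \<Rightarrow> 'd::finite env measure \<Rightarrow> bool" where
  "r_markovian \<kappa> r \<P> \<longleftrightarrow>
     (\<forall>V. finite V \<longrightarrow> (\<forall>E\<in>sets (conf_space \<kappa> V).
        AE \<omega> in \<P>. cond_prob_conf \<kappa> \<P> V E (- V) \<omega> = cond_prob_conf \<kappa> \<P> V E (bdry r V) \<omega>))"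

text \<open>\<open>K \<eta>\<close> is a regular version of the conditional law of the configuration in \<open>D\<close>, given
  the configuration \<open>\<eta>\<close> outside \<open>V\<close>.\<close>

definition regular_cond_law ::
    "real \<Rightarrow> 'd::finite env measure \<Rightarrow> (int ^ 'd) set \<Rightarrow> (int ^ 'd) set \<Rightarrow> ('d::finite env \<Rightarrow> 'd::finite env measure) \<Rightarrow> bool" where
  "regular_cond_law \<kappa> \<P> D V K \<longleftrightarrow>
     K \<in> measurable (conf_space \<kappa> (- V)) (prob_algebra (conf_space \<kappa> D)) \<and>
     (\<forall>E\<in>sets (conf_space \<kappa> D).
        AE \<omega> in \<P>. measure (K (restrict \<omega> (- V))) E = cond_prob_conf \<kappa> \<P> D E (- V) \<omega>)"

text \<open>The almost-sure quantification over pairs is not with respect to \<open>\<P> \<otimes> \<P>\<close>, for which the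
  agreeing pairs typically form a null set: it means that the bound holds for all agreeing pairs
  taken from some set \<open>G\<close> of full measure. In this form the condition does not depend on
  the choice of the version \<open>K\<close>. As \<open>RN_deriv\<close> is unspecified when no density exists,
  absolute continuity is required explicitly.\<close>

definition SMG :: "real \<Rightarrow> real \<Rightarrow> real \<Rightarrow> real \<Rightarrow> 'd::finite env measure \<Rightarrow> bool" where
  "SMG \<kappa> r C g \<P> \<longleftrightarrow>
     r_markovian \<kappa> r \<P> \<and>
     (\<forall>D V A. finite V \<and> D \<subseteq> V \<and> ereal r \<le> d1 D (- V) \<and> A \<subseteq> - V \<longrightarrow>
       (\<exists>K G. regular_cond_law \<kappa> \<P> D V K \<and>
          G \<subseteq> space (conf_space \<kappa> (- V)) \<and> (AE \<omega> in \<P>. restrict \<omega> (- V) \<in> G) \<and>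
          (\<forall>\<eta>\<in>G. \<forall>\<eta>'\<in>G. (\<forall>x\<in>- V - A. \<eta> x = \<eta>' x) \<longrightarrow>
             absolutely_continuous (K \<eta>') (K \<eta>) \<and>
             (AE \<xi> in K \<eta>'. RN_deriv (K \<eta>') (K \<eta>) \<xi> \<le>
                ennreal (exp (C * (\<Sum>\<^sub>\<infinity>(x, y)\<in>D \<times> A. exp (- g * real_of_int (l1 (x - y))))))))))"

section \<open>The random walk\<close>

definition step_pmf :: "'d::finite env \<Rightarrow> int ^ 'd \<Rightarrow> (int ^ 'd) pmf" where
  "step_pmf \<omega> y = embed_pmf (\<lambda>z. if z - y \<in> dirs then \<omega> y (z - y) else 0)"

text \<open>The law of the coordinate at time \<open>n\<close>, given the path \<open>h\<close> up to time \<open>n - 1\<close>.\<close>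

primrec walk_kernel ::
    "'d::finite env \<Rightarrow> int ^ 'd \<Rightarrow> nat \<Rightarrow> (nat \<Rightarrow> int ^ 'd) \<Rightarrow> (int ^ 'd) measure" where
  "walk_kernel \<omega> x 0 h = return (count_space UNIV) x"
| "walk_kernel \<omega> x (Suc n) h = measure_pmf (step_pmf \<omega> (h n))"

lemma Ionescu_Tulcea_walk_kernel:
  "Ionescu_Tulcea (walk_kernel \<omega> x) (\<lambda>_. count_space (UNIV :: (int ^ 'd) set))"
proof (rule Ionescu_Tulcea.intro)
  show "walk_kernel \<omega> x i \<in> measurable (PiM {0..<i} (\<lambda>_. count_space UNIV))
          (subprob_algebra (count_space UNIV))" for i
  proof (cases i)
    case 0
    have "return (count_space UNIV) x \<in> space (subprob_algebra (count_space UNIV))"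
      by (simp add: space_subprob_algebra prob_space_imp_subprob_space prob_space_return)
    moreover have "walk_kernel \<omega> x 0 = (\<lambda>_. return (count_space UNIV) x)"
      by (rule ext) simp
    ultimately show ?thesis by (simp add: 0)
  next
    case (Suc n)
    have 1: "(\<lambda>h. h n) \<in> measurable (PiM {0..<Suc n} (\<lambda>_. count_space UNIV))
        (count_space (UNIV :: (int ^ 'd) set))"
      by (rule measurable_component_singleton) simp
    have 2: "(\<lambda>y. measure_pmf (step_pmf \<omega> y)) \<in>
        measurable (count_space UNIV) (subprob_algebra (count_space UNIV))"
      by (simp add: space_subprob_algebra measure_pmf.subprob_space_axioms)
    have 3: "walk_kernel \<omega> x (Suc n) = (\<lambda>h. measure_pmf (step_pmf \<omega> (h n)))"
      by (rule ext) simp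
    show ?thesis
      unfolding Suc 3 by (rule measurable_compose[OF 1 2])
  qed
  fix i and h :: "nat \<Rightarrow> int ^ 'd"
  show "prob_space (walk_kernel \<omega> x i h)"
    by (cases i) (simp_all add: prob_space_return measure_pmf.prob_space_axioms)
qed

text \<open>The Ionescu-Tulcea measure on \<open>PiM UNIV (\<lambda>_. count_space UNIV)\<close> with these kernels.\<close>

definition quenched :: "'d::finite env \<Rightarrow> int ^ 'd \<Rightarrow> (nat \<Rightarrow> int ^ 'd) measure" where
  "quenched \<omega> x = projective_family.lim UNIV
     (Ionescu_Tulcea.CI (walk_kernel \<omega> x) (\<lambda>_. count_space UNIV)) (\<lambda>_. count_space UNIV)"

text \<open>Only the marginal on paths of the semidirect product is needed.\<close>

definition annealed :: "'d::finite env measure \<Rightarrow> int ^ 'd \<Rightarrow> (nat \<Rightarrow> int ^ 'd) measure" where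
  "annealed \<P> x = \<P> \<bind> (\<lambda>\<omega>. quenched \<omega> x)"

definition exit_time :: "(int ^ 'd) set \<Rightarrow> (nat \<Rightarrow> int ^ 'd) \<Rightarrow> enat" where
  "exit_time V X = (INF n\<in>{n. X n \<notin> V}. enat n)"

text \<open>The complementary event contains the paths that never leave \<open>V\<close>. For
  finite \<open>V\<close> these form a null set by uniform ellipticity.\<close>

definition exits_via :: "(int ^ 'd) set \<Rightarrow> (int ^ 'd) set \<Rightarrow> (nat \<Rightarrow> int ^ 'd) \<Rightarrow> bool" where
  "exits_via V S X \<longleftrightarrow> exit_time V X \<noteq> \<infinity> \<and> X (the_enat (exit_time V X)) \<in> S"

section \<open>The polynomial condition\<close>

definition rotation_to :: "'d \<Rightarrow> real ^ 'd ^ 'd \<Rightarrow> real ^ 'd \<Rightarrow> bool" where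
  "rotation_to i1 R l \<longleftrightarrow> rotation_matrix R \<and> R *v axis i1 1 = l"

definition rotated_lattice_box ::
    "'d \<Rightarrow> real ^ 'd ^ 'd \<Rightarrow> real set \<Rightarrow> real set \<Rightarrow> (int ^ 'd) set" where
  "rotated_lattice_box i1 R S T =
     {z. rvec z \<in> (\<lambda>y. R *v y) ` {y. y $ i1 \<in> S \<and> (\<forall>j. j \<noteq> i1 \<longrightarrow> y $ j \<in> T)}}"

text \<open>In the following two definitions \<open>d\<close> is the dimension.\<close>

primrec scale :: "nat \<Rightarrow> real \<Rightarrow> real \<Rightarrow> nat \<Rightarrow> real" where
  "scale d \<kappa> N0 0 = N0"
| "scale d \<kappa> N0 (Suc k) =
     real_of_int (\<lfloor>15 * sqrt (real d) * N0 * ln (1 / (2 * \<kappa>)) / (2 * ln N0)\<rfloor> + 1)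
       * 44 ^ (k + 1) * scale d \<kappa> N0 k"

definition admissible :: "nat \<Rightarrow> real \<Rightarrow> real \<Rightarrow> bool" where
  "admissible d \<kappa> N0 \<longleftrightarrow> N0 \<ge> 3 * sqrt (real d) \<and>
     (\<forall>k\<ge>1. \<exists>m::nat. scale d \<kappa> N0 k / scale d \<kappa> N0 (k - 1) = 110 * real m)"

definition box1 :: "'d \<Rightarrow> real ^ 'd ^ 'd \<Rightarrow> real \<Rightarrow> (int ^ 'd) set" where
  "box1 i1 R N0 = rotated_lattice_box i1 R {0..N0} {0..N0 ^ 3}"

definition box2 :: "'d \<Rightarrow> real ^ 'd ^ 'd \<Rightarrow> real \<Rightarrow> (int ^ 'd) set" where
  "box2 i1 R N0 = rotated_lattice_box i1 R
     {- (N0 / 11)<..<N0 + N0 / 11} {- (N0 ^ 3 / 10)<..<N0 ^ 3 + N0 ^ 3 / 10}"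

definition box2_front :: "'d \<Rightarrow> real ^ 'd ^ 'd \<Rightarrow> real ^ 'd \<Rightarrow> real \<Rightarrow> (int ^ 'd) set" where
  "box2_front i1 R l N0 = {z \<in> bdry 1 (box2 i1 R N0).
     rvec z \<bullet> l \<ge> 12 * N0 / 11 \<and>
     (\<forall>j. j \<noteq> i1 \<longrightarrow> - (N0 ^ 3 / 10) < rvec z \<bullet> (R *v axis j 1) \<and>
                     rvec z \<bullet> (R *v axis j 1) < 11 * N0 ^ 3 / 10)}"

definition polynomial_condition ::
    "'d::finite env measure \<Rightarrow> 'd \<Rightarrow> real ^ 'd ^ 'd \<Rightarrow> real ^ 'd \<Rightarrow> real \<Rightarrow> real \<Rightarrow> bool" where
  "polynomial_condition \<P> i1 R l J N0 \<longleftrightarrow>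
     (SUP x\<in>box1 i1 R N0. measure (annealed \<P> x)
        {X. \<not> exits_via (box2 i1 R N0) (box2_front i1 R l N0) X}) < N0 powr (- J)"

section \<open>The effective criterion\<close>

definition box_specification ::
    "'d::finite \<Rightarrow> real ^ 'd \<Rightarrow> real ^ 'd ^ 'd \<Rightarrow> real \<Rightarrow> real \<Rightarrow> real \<Rightarrow> bool" where
  "box_specification i1 l R L L' Lt \<longleftrightarrow> rotation_to i1 R l \<and>
     L > 3 * sqrt CARD('d) \<and> L' > 3 * sqrt CARD('d) \<and> Lt > 3 * sqrt CARD('d)"

definition spec_box :: "'d \<Rightarrow> real ^ 'd ^ 'd \<Rightarrow> real \<Rightarrow> real \<Rightarrow> real \<Rightarrow> (int ^ 'd) set" where
  "spec_box i1 R L L' Lt = rotated_lattice_box i1 R {- L<..<L'} {- Lt<..<Lt}"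

definition spec_front ::
    "'d \<Rightarrow> real ^ 'd \<Rightarrow> real ^ 'd ^ 'd \<Rightarrow> real \<Rightarrow> real \<Rightarrow> real \<Rightarrow> (int ^ 'd) set" where
  "spec_front i1 l R L L' Lt = bdry 1 (spec_box i1 R L L' Lt) \<inter>
     {z. rvec z \<bullet> l \<ge> L' \<and> (\<forall>j. j \<noteq> i1 \<longrightarrow> \<bar>rvec z \<bullet> (R *v axis j 1)\<bar> < Lt)}"

definition q_box ::
    "'d::finite env \<Rightarrow> 'd \<Rightarrow> real ^ 'd \<Rightarrow> real ^ 'd ^ 'd \<Rightarrow> real \<Rightarrow> real \<Rightarrow> real \<Rightarrow> real" where
  "q_box \<omega> i1 l R L L' Lt = measure (quenched \<omega> 0)
     {X. \<not> exits_via (spec_box i1 R L L' Lt) (spec_front i1 l R L L' Lt) X}"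

definition p_box ::
    "'d::finite env \<Rightarrow> 'd \<Rightarrow> real ^ 'd \<Rightarrow> real ^ 'd ^ 'd \<Rightarrow> real \<Rightarrow> real \<Rightarrow> real \<Rightarrow> real" where
  "p_box \<omega> i1 l R L L' Lt = measure (quenched \<omega> 0)
     {X. exits_via (spec_box i1 R L L' Lt) (spec_front i1 l R L L' Lt) X}"

text \<open>The denominator is positive for every box specification and every environment in the
  uniformly elliptic space (if \<open>\<kappa> > 0\<close>), so division by zero does not occur.\<close>

definition \<rho>_box ::
    "'d::finite env \<Rightarrow> 'd \<Rightarrow> real ^ 'd \<Rightarrow> real ^ 'd ^ 'd \<Rightarrow> real \<Rightarrow> real \<Rightarrow> real \<Rightarrow> real" where
  "\<rho>_box \<omega> i1 l R L L' Lt = q_box \<omega> i1 l R L L' Lt / p_box \<omega> i1 l R L L' Lt"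

definition effective_criterion ::
    "real \<Rightarrow> real \<Rightarrow> 'd::finite env measure \<Rightarrow> 'd \<Rightarrow> real ^ 'd \<Rightarrow> bool" where
  "effective_criterion C' C'' \<P> i1 l \<longleftrightarrow>
     (INF (R, L, Lt, a) \<in> {(R, L, Lt, a).
          box_specification i1 l R (L - 2) (L + 2) Lt \<and>
          L ^ 4 > Lt \<and> Lt > L \<and> L > C'' \<and> 0 < a \<and> a \<le> 1}.
        ennreal (C' * Lt ^ (CARD('d) - 1) * L ^ (4 * (CARD('d) - 1) + 1)) *
        (\<integral>\<^sup>+\<omega>. ennreal (\<rho>_box \<omega> i1 l R (L - 2) (L + 2) Lt powr a) \<partial>\<P>)) < 1"

end

theory Submission
  imports Defs "HOL-Real_Asymp.Real_Asymp"
begin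

text \<open>
  A single change of scale, from \<open>N_0\<close> to \<open>N_0^3\<close>, suffices, because \<open>N_0\<close> may be taken large and
  the exponent \<open>a\<close> in the effective criterion may depend on it. Write \<open>N\<close> for \<open>N_0\<close> and \<open>d\<close> for the
  dimension. The criterion is verified for \<open>L = N^3\<close>, lateral width \<open>N^7\<close> and \<open>a = 40 d / N^2\<close>.

  Call a site bad if the walk started there leaves the block (the box \<open>B_2\<close> translated to this site)
  other than through its front with quenched probability above \<open>1 / N\<close>. By stationarity and the
  inequality of Markov, a site is bad with probability at most \<open>N^(1 - J)\<close> (\<open>bad_prob_le\<close>).
  Blocks at distance \<open>N\<close> are independent up to a constant factor by the mixing condition
  (\<open>SMG_decoupling\<close>), and the large box has at most \<open>O(N^(7 d))\<close> sites. Hence, as \<open>J > 9 d\<close>, the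
  probability that it contains \<open>K = \<lceil>N\<rceil>\<close> bad sites with mutually distant blocks is at most
  \<open>N^(-2 K)\<close> (\<open>rich_prob\<close>, \<open>moment_bound\<close>).

  Outside this rare event two things hold. At most \<open>4 K\<close> of the roughly \<open>2 N^2\<close> slabs of width \<open>N\<close>
  orthogonal to \<open>\<ell>\<close> contain a bad site (\<open>few_bad_slabs\<close>), and between the origin and each lateral face there is a
  strip of width \<open>N^6 / 4\<close> without any bad site (\<open>free_strip\<close>). The quenched failure probability is a
  harmonic function, so it lies below every strict supersolution with the right boundary values. The
  supersolution used here (\<open>barrier\<close>) is the sum of two parts. The first is the potential of a
  one-dimensional walk on the slabs: its increments shrink by the factor \<open>2 / N\<close> at each slab
  without bad sites and grow by a factor \<open>exp (O(N))\<close>, the price of uniform ellipticity, at each of the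
  few others. The second consists of exponentials that exceed \<open>1\<close> at the lateral faces and decay across
  the free strips to less than any increment of the first part. At a site that is not bad the strict
  inequality is checked by running the walk until it leaves the block (\<open>good_case\<close>), at a bad site by
  forcing it upwards for of the order of \<open>N\<close> steps (\<open>bad_case\<close>). The \<open>4 K\<close> bad slabs cost \<open>exp (O(N^2))\<close>
  altogether, the others gain \<open>(2 / N)^(N^2 - O(N))\<close>, so that \<open>q \<le> exp (- N^2 ln N / 2)\<close> (\<open>q_box_bound\<close>).

  Consequently \<open>\<rho>^a\<close> is at most \<open>2 N^(-20 d)\<close> outside the rare event. On the rare event ellipticity gives
  \<open>\<rho> \<le> exp (O(N^3))\<close> (\<open>p_box_lower\<close>), hence \<open>\<rho>^a \<le> exp (O(N))\<close>, while the event has probability at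
  most \<open>N^(-2 N)\<close>. Both contributions beat the polynomial prefactor, which is at most \<open>C' N^(19 d)\<close>.
\<close>

section \<open>Path measures\<close>

abbreviation path_space :: "(nat \<Rightarrow> int ^ 'd) measure" where
  "path_space \<equiv> PiM UNIV (\<lambda>_. count_space UNIV)"

definition cylinder :: "nat \<Rightarrow> (nat \<Rightarrow> 'a) \<Rightarrow> (nat \<Rightarrow> 'a) set" where
  "cylinder n p = {X. \<forall>i\<le>n. X i = p i}"

definition cylinders :: "(nat \<Rightarrow> 'a) set set" where
  "cylinders = insert {} (range (\<lambda>(n, p). cylinder n p))"

lemma Int_stable_cylinders: "Int_stable cylinders"
proof (rule Int_stableI)
  have *: "cylinder n p \<inter> cylinder m q \<in> cylinders" if "n \<le> m" for n m :: nat and p q :: "nat \<Rightarrow> 'a"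
  proof (cases "\<forall>i\<le>n. p i = q i")
    case True
    then have "cylinder n p \<inter> cylinder m q = cylinder m q"
      using that by (auto simp: cylinder_def)
    then show ?thesis by (auto simp: cylinders_def)
  next
    case False
    then have "cylinder n p \<inter> cylinder m q = {}"
      using that by (auto simp: cylinder_def)
    then show ?thesis by (auto simp: cylinders_def)
  qed
  fix A B :: "(nat \<Rightarrow> 'a) set" assume A: "A \<in> cylinders" and B: "B \<in> cylinders"
  show "A \<inter> B \<in> cylinders"
  proof (cases "A = {} \<or> B = {}")
    case True then show ?thesis by (auto simp: cylinders_def)
  next
    case False
    then obtain n p m q where "A = cylinder n p" "B = cylinder m q"
      using A B by (auto simp: cylinders_def)
    then show ?thesis
      using *[of n m p q] *[of m n q p] by (metis Int_commute nat_le_linear)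
  qed
qed

lemma space_path [simp]: "space path_space = UNIV"
  by (simp add: space_PiM)

lemma sets_cylinder [measurable]: "cylinder n p \<in> sets (path_space :: (nat \<Rightarrow> int ^ 'd::finite) measure)"
proof -
  have "cylinder n p = {X \<in> space path_space. \<forall>i\<in>{..n}. X i = p i}"
    by (auto simp: cylinder_def)
  also have "\<dots> \<in> sets path_space"
  proof (rule sets.sets_Collect_finite_All)
    fix i assume "i \<in> {..n}"
    have "(\<lambda>X. X i) -` {p i} \<inter> space path_space \<in> sets (path_space :: (nat \<Rightarrow> int ^ 'd) measure)"
      by (rule measurable_sets[OF measurable_component_singleton]) auto
    moreover have "(\<lambda>X. X i) -` {p i} \<inter> space path_space = {X \<in> space path_space. X i = p i}"
      by auto
    ultimately show "{X \<in> space path_space. X i = p i} \<in> sets (path_space :: (nat \<Rightarrow> int ^ 'd) measure)"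
      by metis
  qed simp
  finally show ?thesis .
qed

lemma sets_path_space:
  "sets (path_space :: (nat \<Rightarrow> int ^ 'd::finite) measure) = sigma_sets UNIV cylinders"
proof
  have "{X. X i \<in> A} \<in> sigma_sets UNIV cylinders" for i and A :: "(int ^ 'd) set"
  proof -
    have "{X. X i \<in> A} = (\<Union>xs\<in>{xs. xs ! i \<in> A}. cylinder i (\<lambda>k. xs ! k))"
    proof (intro set_eqI iffI)
      fix X assume "X \<in> {X. X i \<in> A}"
      then have "map X [0..<Suc i] ! i \<in> A" "X \<in> cylinder i (\<lambda>k. map X [0..<Suc i] ! k)"
        by (auto simp: cylinder_def less_Suc_eq_le simp del: upt_Suc)
      then show "X \<in> (\<Union>xs\<in>{xs. xs ! i \<in> A}. cylinder i (\<lambda>k. xs ! k))" by blast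
    qed (auto simp: cylinder_def)
    moreover have "(\<Union>xs\<in>{xs. xs ! i \<in> A}. cylinder i (\<lambda>k. xs ! k)) \<in> sigma_sets UNIV cylinders"
    proof -
      interpret sigma_algebra UNIV "sigma_sets UNIV (cylinders :: (nat \<Rightarrow> int ^ 'd) set set)"
        by (rule sigma_algebra_sigma_sets) simp
      show ?thesis
        by (rule countable_UN') (auto simp: cylinders_def)
    qed
    ultimately show ?thesis by simp
  qed
  then show "sets (path_space :: (nat \<Rightarrow> int ^ 'd) measure) \<subseteq> sigma_sets UNIV cylinders"
    unfolding sets_PiM_single space_count_space PiE_UNIV by (intro sigma_sets_mono) auto
next
  show "sigma_sets UNIV cylinders \<subseteq> sets (path_space :: (nat \<Rightarrow> int ^ 'd) measure)"
    using sets.sigma_sets_subset[of cylinders "path_space :: (nat \<Rightarrow> int ^ 'd) measure"]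
    unfolding space_path by (simp add: cylinders_def image_subset_iff)
qed

text \<open>The cylinders over finite words form a countable generator that is closed under intersection,
  because each coordinate takes values in a countable set.\<close>

lemma path_measure_eqI:
  fixes M N :: "(nat \<Rightarrow> int ^ 'd::finite) measure"
  assumes "prob_space M" "prob_space N" "sets M = sets path_space" "sets N = sets path_space"
    and eq: "\<And>n p. emeasure M (cylinder n p) = emeasure N (cylinder n p)"
  shows "M = N"
proof (rule measure_eqI_generator_eq_countable[where E=cylinders and \<Omega>=UNIV and A="range (\<lambda>z. cylinder 0 (\<lambda>_. z))"])
  show "Int_stable cylinders" by (rule Int_stable_cylinders)
  show "sets M = sigma_sets UNIV cylinders" "sets N = sigma_sets UNIV cylinders"
    using assms by (simp_all add: sets_path_space)
  interpret M: prob_space M by fact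
  show "\<And>X. X \<in> cylinders \<Longrightarrow> emeasure M X = emeasure N X"
    using eq by (auto simp: cylinders_def)
  show "\<Union> (range (\<lambda>z. cylinder 0 (\<lambda>_. z))) = UNIV"
    by (auto simp: cylinder_def)
  show "\<And>a. a \<in> range (\<lambda>z. cylinder 0 (\<lambda>_. z)) \<Longrightarrow> emeasure M a \<noteq> \<infinity>"
    by simp
qed (auto simp: cylinders_def)

section \<open>The Markov property at time one\<close>

lemma finite_dirs [simp]: "finite (dirs :: (int ^ 'd::finite) set)"
proof -
  have "dirs \<subseteq> {z :: int ^ 'd. \<forall>i. z $ i \<in> {-1..1}}"
  proof
    fix z :: "int ^ 'd" assume "z \<in> dirs"
    then have s: "(\<Sum>i\<in>UNIV. \<bar>z $ i\<bar>) = 1" by (simp add: dirs_def l1_def)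
    have "\<bar>z $ i\<bar> \<le> 1" for i
      unfolding s[symmetric] by (rule member_le_sum) auto
    then show "z \<in> {z. \<forall>i. z $ i \<in> {-1..1}}" by (force simp: abs_le_iff)
  qed
  moreover have "finite {z :: int ^ 'd. \<forall>i. z $ i \<in> {-1..1}}"
  proof -
    have "finite (vec_nth -` (PiE UNIV (\<lambda>_. {-1..1::int})) :: (int ^ 'd) set)"
      by (intro finite_vimageI finite_PiE) (auto simp: inj_on_def vec_eq_iff)
    then show ?thesis by (rule rev_finite_subset) auto
  qed
  ultimately show ?thesis by (rule finite_subset)
qed

definition elliptic :: "real \<Rightarrow> 'd::finite env \<Rightarrow> bool" where
  "elliptic \<kappa> \<omega> \<longleftrightarrow> (\<forall>y. \<omega> y \<in> site_simplex \<kappa>)"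

lemma elliptic_sum: "elliptic \<kappa> \<omega> \<Longrightarrow> (\<Sum>e\<in>dirs. \<omega> y e) = 1"
  by (auto simp: elliptic_def site_simplex_def)

lemma elliptic_ge: "elliptic \<kappa> \<omega> \<Longrightarrow> e \<in> dirs \<Longrightarrow> 2 * \<kappa> \<le> \<omega> y e"
  by (auto simp: elliptic_def site_simplex_def)

lemma pmf_step:
  fixes \<omega> :: "'d::finite env"
  assumes \<omega>: "\<omega> y \<in> site_simplex \<kappa>" and "0 \<le> \<kappa>"
  shows "pmf (step_pmf \<omega> y) z = (if z - y \<in> dirs then \<omega> y (z - y) else 0)"
  unfolding step_pmf_def
proof (rule pmf_embed_pmf)
  let ?f = "\<lambda>z. if z - y \<in> dirs then \<omega> y (z - y) else 0"
  have ge: "0 \<le> \<omega> y e" if "e \<in> dirs" for e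
    using \<omega> that \<open>0 \<le> \<kappa>\<close> by (force simp: site_simplex_def)
  then show "\<And>x. 0 \<le> ?f x" by auto
  have "(\<integral>\<^sup>+ z. ennreal (?f z) \<partial>count_space UNIV) =
      (\<integral>\<^sup>+ z. ennreal (?f z) * indicator ((\<lambda>e. y + e) ` dirs) z \<partial>count_space UNIV)"
  proof (intro nn_integral_cong)
    fix z
    show "ennreal (?f z) = ennreal (?f z) * indicator ((\<lambda>e. y + e) ` dirs) z"
      by (cases "z - y \<in> dirs") (auto simp: indicator_def image_iff intro!: bexI[of _ "z - y"])
  qed
  also have "\<dots> = (\<Sum>z\<in>(\<lambda>e. y + e) ` dirs. ennreal (?f z))"
    by (subst nn_integral_count_space_indicator[symmetric]) (auto simp: nn_integral_count_space_finite)
  also have "\<dots> = (\<Sum>e\<in>dirs. ennreal (\<omega> y e))"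
    by (subst sum.reindex) (auto simp: inj_on_def)
  also have "\<dots> = 1"
    using \<omega> ge by (subst sum_ennreal) (auto simp: site_simplex_def)
  finally show "(\<integral>\<^sup>+ z. ennreal (?f z) \<partial>count_space UNIV) = 1" .
qed

lemma integral_step:
  fixes \<omega> :: "'d::finite env" and f :: "int ^ 'd \<Rightarrow> real"
  assumes \<omega>: "\<omega> y \<in> site_simplex \<kappa>" and "0 \<le> \<kappa>"
  shows "measure_pmf.expectation (step_pmf \<omega> y) f = (\<Sum>e\<in>dirs. \<omega> y e * f (y + e))"
proof -
  have "measure_pmf.expectation (step_pmf \<omega> y) f = (\<Sum>z\<in>(\<lambda>e. y + e) ` dirs. f z * pmf (step_pmf \<omega> y) z)"
    by (rule integral_measure_pmf_real)
      (auto simp: set_pmf_eq pmf_step[of \<omega> y, OF assms] image_iff split: if_splits intro!: bexI[of _ "_ - y"])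
  also have "\<dots> = (\<Sum>e\<in>dirs. \<omega> y e * f (y + e))"
    by (subst sum.reindex) (auto simp: inj_on_def pmf_step[of \<omega> y, OF assms] intro!: sum.cong)
  finally show ?thesis .
qed

context
  fixes \<omega> :: "'d::finite env" and x :: "int ^ 'd"
begin

interpretation IT: Ionescu_Tulcea "walk_kernel \<omega> x" "\<lambda>_. count_space UNIV"
  by (rule Ionescu_Tulcea_walk_kernel)

text \<open>The stages of the Ionescu-Tulcea construction give to a finite word the product of its transition
  probabilities. This determines the quenched law, by \<open>path_measure_eqI\<close>.\<close>

lemma C_singleton:
  "emeasure (IT.C 0 (Suc n) (\<lambda>_. undefined)) {restrict p {0..<Suc n}} =
     (if p 0 = x then ennreal (\<Prod>i<n. pmf (step_pmf \<omega> (p i)) (p (Suc i))) else 0)"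
proof -
  let ?u = "\<lambda>_::nat. undefined :: int ^ 'd"
  have u: "?u \<in> space (PiM {0..<0} (\<lambda>_. count_space UNIV))" by (simp add: space_PiM)
  have sing: "{restrict p {0..<n}} \<in> sets (PiM {0..<n} (\<lambda>_. count_space UNIV))" for n
  proof -
    have "{restrict p {0..<n}} = PiE {0..<n} (\<lambda>i. {p i})"
      by (subst PiE_singleton[symmetric, OF restrict_extensional]) (rule PiE_cong, simp)
    then show ?thesis by (simp add: sets_PiM_I_finite)
  qed
  have step: "emeasure (IT.C 0 (Suc n) ?u) {restrict p {0..<Suc n}} =
     emeasure (IT.C 0 n ?u) {restrict p {0..<n}} * emeasure (walk_kernel \<omega> x n (restrict p {0..<n})) {p n}" for n
  proof -
    have "emeasure (IT.C 0 (Suc n) ?u) {restrict p {0..<Suc n}} =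
        (\<integral>\<^sup>+h. emeasure (IT.eP n h) {restrict p {0..<Suc n}} \<partial>IT.C 0 n ?u)"
      using IT.measurable_C[of 0 n] IT.space_C[OF u, of n] IT.measurable_eP[of n]
      by (simp, subst emeasure_bind[where N="PiM {0..<Suc n} (\<lambda>_. count_space UNIV)"])
         (auto simp: space_PiM_empty_iff measurable_cong_sets[OF IT.sets_C[OF u] refl] intro!: sing)
    also have "\<dots> = (\<integral>\<^sup>+h. emeasure (walk_kernel \<omega> x n (restrict p {0..<n})) {p n} * indicator {restrict p {0..<n}} h \<partial>IT.C 0 n ?u)"
    proof (intro nn_integral_cong)
      fix h assume "h \<in> space (IT.C 0 n ?u)"
      then have h: "h \<in> space (PiM {0..<n} (\<lambda>_. count_space UNIV))" using IT.space_C[OF u, of n] by simp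
      have E: "emeasure (IT.eP n h) {restrict p {0..<Suc n}} =
          emeasure (walk_kernel \<omega> x n h) ((\<lambda>y. h(n := y)) -` {restrict p {0..<Suc n}} \<inter> space (count_space UNIV))"
        by (rule IT.emeasure_eP[OF h sing])
      have eq: "h(n := y) = restrict p {0..<Suc n} \<longleftrightarrow> h = restrict p {0..<n} \<and> y = p n" for y
      proof -
        have hn: "h k = undefined" if "\<not> k < n" for k
          using h that by (auto simp: space_PiM PiE_def extensional_def)
        show ?thesis
          by (auto simp: fun_eq_iff restrict_def hn less_Suc_eq)
      qed
      have "(\<lambda>y. h(n := y)) -` {restrict p {0..<Suc n}} = (if h = restrict p {0..<n} then {p n} else {})"
        unfolding vimage_def singleton_iff eq by simp
      with E show "emeasure (IT.eP n h) {restrict p {0..<Suc n}} = emeasure (walk_kernel \<omega> x n (restrict p {0..<n})) {p n} * indicator {restrict p {0..<n}} h"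
        by (auto simp: indicator_def)
    qed
    also have "\<dots> = emeasure (IT.C 0 n ?u) {restrict p {0..<n}} * emeasure (walk_kernel \<omega> x n (restrict p {0..<n})) {p n}"
      using sing[of n] IT.sets_C[OF u, of n] by (subst nn_integral_cmult_indicator) (auto simp: mult.commute)
    finally show ?thesis .
  qed
  show ?thesis
  proof (induction n)
    case 0
    show ?case
      by (subst step) (auto simp: PiM_empty indicator_def restrict_def)
  next
    case (Suc n)
    show ?case
      by (subst step, subst Suc) (auto simp: emeasure_pmf_single ennreal_mult prod_nonneg)
  qed
qed

lemma sets_quenched [measurable_cong, simp]: "sets (quenched \<omega> x) = sets path_space"
  unfolding quenched_def by (rule IT.PF.sets_lim)

lemma space_quenched [simp]: "space (quenched \<omega> x) = UNIV"
  using sets_eq_imp_space_eq[OF sets_quenched] by simp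

lemma emeasure_quenched_cylinder:
  "emeasure (quenched \<omega> x) (cylinder n p) =
     (if p 0 = x then ennreal (\<Prod>i<n. pmf (step_pmf \<omega> (p i)) (p (Suc i))) else 0)"
proof -
  let ?J = "{0..<Suc n}"
  have X: "{restrict p ?J} \<in> sets (PiM ?J (\<lambda>_. count_space UNIV))"
  proof -
    have "{restrict p ?J} = PiE ?J (\<lambda>i. {p i})"
      by (subst PiE_singleton[symmetric, OF restrict_extensional]) (rule PiE_cong, simp)
    then show ?thesis by (simp add: sets_PiM_I_finite)
  qed
  have "cylinder n p = prod_emb UNIV (\<lambda>_. count_space UNIV) ?J {restrict p ?J}"
  proof (intro set_eqI iffI)
    fix X assume "X \<in> prod_emb UNIV (\<lambda>_. count_space UNIV) ?J {restrict p ?J}"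
    then have eq: "restrict X ?J = restrict p ?J" by (simp add: prod_emb_def)
    have "X i = p i" if "i \<le> n" for i
      using fun_cong[OF eq, of i] that by simp
    then show "X \<in> cylinder n p" by (simp add: cylinder_def)
  qed (auto simp: cylinder_def prod_emb_def restrict_def)
  then have "emeasure (quenched \<omega> x) (cylinder n p) = emeasure (IT.CI ?J) {restrict p ?J}"
    unfolding quenched_def using IT.lim[OF _ X] by simp
  also have "\<dots> = emeasure (IT.C 0 (Suc n) (\<lambda>_. undefined)) {restrict p ?J}"
    by (subst IT.emeasure_CI[OF order_refl X])
       (subst prod_emb_id, auto simp del: IT.C.simps)
  finally show ?thesis unfolding C_singleton .
qed

lemma prob_space_quenched: "prob_space (quenched \<omega> x)"
proof (rule prob_spaceI)
  have "emeasure (quenched \<omega> x) (space (quenched \<omega> x)) = emeasure IT.PF.lim (prod_emb UNIV (\<lambda>_. count_space UNIV) {} {\<lambda>_. undefined})"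
    unfolding quenched_def by (simp add: IT.PF.space_lim prod_emb_def space_PiM restrict_def vimage_def)
  also have "\<dots> = emeasure (IT.CI {}) {\<lambda>_. undefined}"
    by (rule IT.lim) (auto simp: PiM_empty)
  also have "\<dots> = 1"
    using prob_space.emeasure_space_1[OF IT.PF.prob_space_P[of "{}"]] by (simp add: IT.PF.space_P PiM_empty IT.CI_def)
  finally show "emeasure (quenched \<omega> x) (space (quenched \<omega> x)) = 1" .
qed

end

text \<open>Both sides give to a cylinder the product of the transition probabilities along its word; on the
  right the first factor is split off.\<close>

lemma quenched_first_step:
  fixes \<omega> :: "'d::finite env"
  shows "quenched \<omega> x = measure_pmf (step_pmf \<omega> x) \<bind> (\<lambda>y. distr (quenched \<omega> y) path_space (case_nat x))"
    (is "_ = ?N")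
proof (rule path_measure_eqI)
  have m[measurable]: "case_nat x \<in> measurable path_space (path_space :: (nat \<Rightarrow> int ^ 'd) measure)"
    by (rule measurable_PiM_single') (auto simp: space_PiM split: nat.split)
  then have m': "case_nat x \<in> measurable (quenched \<omega> y) path_space" for y
    by (simp add: measurable_cong_sets[OF sets_quenched refl])
  have ps: "prob_space (distr (quenched \<omega> y) path_space (case_nat x))" for y
    by (rule prob_space.prob_space_distr[OF prob_space_quenched m'])
  have ker: "(\<lambda>y. distr (quenched \<omega> y) path_space (case_nat x)) \<in> measurable (measure_pmf (step_pmf \<omega> x)) (subprob_algebra path_space)"
    using ps by (auto simp: measurable_def space_subprob_algebra intro!: prob_space_imp_subprob_space)
  show "prob_space (quenched \<omega> x)" by (rule prob_space_quenched)
  show "prob_space ?N"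
    by (rule measure_pmf.prob_space_bind[OF _ ker]) (use ps in auto)
  show "sets (quenched \<omega> x) = sets path_space" by simp
  show "sets ?N = sets path_space"
    by (rule sets_bind) auto
  fix n p
  have "emeasure ?N (cylinder n p) = (\<integral>\<^sup>+y. emeasure (distr (quenched \<omega> y) path_space (case_nat x)) (cylinder n p) \<partial>step_pmf \<omega> x)"
    by (rule emeasure_bind[OF _ ker]) auto
  also have "\<dots> = (\<integral>\<^sup>+y. emeasure (quenched \<omega> y) (case_nat x -` cylinder n p) \<partial>step_pmf \<omega> x)"
    by (intro nn_integral_cong) (simp add: emeasure_distr m')
  also have "\<dots> = emeasure (quenched \<omega> x) (cylinder n p)"
  proof (cases "p 0 = x")
    case False
    then have "case_nat x -` cylinder n p = {}" by (auto simp: cylinder_def)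
    then show ?thesis using False by (simp add: emeasure_quenched_cylinder)
  next
    case True
    show ?thesis
    proof (cases n)
      case 0
      then have "case_nat x -` cylinder n p = UNIV" using True by (auto simp: cylinder_def)
      then show ?thesis
        using True 0 prob_space.emeasure_space_1[OF prob_space_quenched, of \<omega>] measure_pmf.emeasure_space_1[of "step_pmf \<omega> x"]
        by (simp add: emeasure_quenched_cylinder)
    next
      case (Suc m)
      have "case_nat x -` cylinder n p = cylinder m (\<lambda>i. p (Suc i))"
        using True Suc by (auto simp: cylinder_def All_less_Suc2 less_Suc_eq_le[symmetric] simp del: less_Suc_eq_le split: nat.splits)
      then have "(\<integral>\<^sup>+y. emeasure (quenched \<omega> y) (case_nat x -` cylinder n p) \<partial>step_pmf \<omega> x) =
         (\<integral>\<^sup>+y. ennreal (\<Prod>i<m. pmf (step_pmf \<omega> (p (Suc i))) (p (Suc (Suc i)))) * indicator {p 1} y \<partial>step_pmf \<omega> x)"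
        by (auto simp: emeasure_quenched_cylinder indicator_def intro!: nn_integral_cong)
      also have "\<dots> = ennreal (\<Prod>i<m. pmf (step_pmf \<omega> (p (Suc i))) (p (Suc (Suc i)))) * ennreal (pmf (step_pmf \<omega> x) (p 1))"
        by (subst nn_integral_cmult_indicator) (auto simp: emeasure_pmf_single)
      also have "\<dots> = ennreal (\<Prod>i<Suc m. pmf (step_pmf \<omega> (p i)) (p (Suc i)))"
        unfolding prod.lessThan_Suc_shift using True by (simp add: ennreal_mult prod_nonneg mult.commute)
      finally show ?thesis using True Suc by (simp add: emeasure_quenched_cylinder del: prod.lessThan_Suc)
    qed
  qed
  finally show "emeasure (quenched \<omega> x) (cylinder n p) = emeasure ?N (cylinder n p)" by simp
qed

lemma measure_quenched_first_step:
  fixes \<omega> :: "'d::finite env"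
  assumes \<omega>: "\<omega> x \<in> site_simplex \<kappa>" "0 \<le> \<kappa>" and E[measurable]: "E \<in> sets path_space"
  shows "measure (quenched \<omega> x) E = (\<Sum>e\<in>dirs. \<omega> x e * measure (quenched \<omega> (x + e)) (case_nat x -` E))"
proof -
  have m[measurable]: "case_nat x \<in> measurable path_space (path_space :: (nat \<Rightarrow> int ^ 'd) measure)"
    by (rule measurable_PiM_single') (auto simp: space_PiM split: nat.split)
  then have m': "case_nat x \<in> measurable (quenched \<omega> y) path_space" for y
    by (simp add: measurable_cong_sets[OF sets_quenched refl])
  have ps: "prob_space (distr (quenched \<omega> y) path_space (case_nat x))" for y
    by (rule prob_space.prob_space_distr[OF prob_space_quenched m'])
  have ker: "(\<lambda>y. distr (quenched \<omega> y) path_space (case_nat x)) \<in> measurable (measure_pmf (step_pmf \<omega> x)) (subprob_algebra path_space)"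
    using ps by (auto simp: measurable_def space_subprob_algebra intro!: prob_space_imp_subprob_space)
  have "measure (quenched \<omega> x) E = measure_pmf.expectation (step_pmf \<omega> x) (\<lambda>y. measure (distr (quenched \<omega> y) path_space (case_nat x)) E)"
    by (subst quenched_first_step) (rule measure_pmf.measure_bind[OF ker E])
  also have "\<dots> = measure_pmf.expectation (step_pmf \<omega> x) (\<lambda>y. measure (quenched \<omega> y) (case_nat x -` E))"
    using m' by (simp add: measure_distr)
  finally show ?thesis by (simp add: integral_step[of \<omega> x, OF \<omega>])
qed

section \<open>Exit probabilities\<close>

lemma exits_via_iff:
  "exits_via B S X \<longleftrightarrow> (\<exists>n. (\<forall>i<n. X i \<in> B) \<and> X n \<notin> B \<and> X n \<in> S)"
proof (cases "\<exists>n. X n \<notin> B")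
  case True
  define m where "m = (LEAST n. X n \<notin> B)"
  have m: "X m \<notin> B" unfolding m_def using True by (rule LeastI_ex)
  have lt: "X i \<in> B" if "i < m" for i using not_less_Least that unfolding m_def by blast
  have "exit_time B X = enat m"
    unfolding exit_time_def
  proof (rule antisym)
    show "(INF n\<in>{n. X n \<notin> B}. enat n) \<le> enat m" using m by (intro INF_lower) auto
    show "enat m \<le> (INF n\<in>{n. X n \<notin> B}. enat n)"
      using lt by (intro INF_greatest) (auto simp: not_less[symmetric])
  qed
  then have "exits_via B S X \<longleftrightarrow> X m \<in> S" by (simp add: exits_via_def)
  also have "\<dots> \<longleftrightarrow> (\<exists>n. (\<forall>i<n. X i \<in> B) \<and> X n \<notin> B \<and> X n \<in> S)"
    using m lt by (metis linorder_neqE_nat)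
  finally show ?thesis .
next
  case False
  then have "exit_time B X = \<infinity>" by (simp add: exit_time_def top_enat_def)
  then show ?thesis using False by (simp add: exits_via_def)
qed

lemma exits_via_case_nat:
  "exits_via B S (case_nat x X) \<longleftrightarrow> (if x \<in> B then exits_via B S X else x \<in> S)"
proof (cases "x \<in> B")
  case True
  have ex: "(\<exists>n. P n) \<longleftrightarrow> P 0 \<or> (\<exists>n. P (Suc n))" for P
    by (metis not0_implies_Suc)
  show ?thesis
    unfolding exits_via_iff by (subst ex) (use True in \<open>simp add: All_less_Suc2\<close>)
next
  case False
  then have "(\<forall>i<n. case_nat x X i \<in> B) \<longleftrightarrow> n = 0" for n by (cases n) (auto split: nat.splits)
  then show ?thesis using False by (auto simp: exits_via_iff)
qed

lemma sets_exits_via [measurable]: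
  "{X. exits_via B S X} \<in> sets (path_space :: (nat \<Rightarrow> int ^ 'd::finite) measure)"
proof -
  have s: "{X. X i \<in> A} \<in> sets (path_space :: (nat \<Rightarrow> int ^ 'd) measure)" for i and A :: "(int ^ 'd) set"
  proof -
    have "(\<lambda>X. X i) -` A \<inter> space path_space \<in> sets (path_space :: (nat \<Rightarrow> int ^ 'd) measure)"
      by (rule measurable_sets[OF measurable_component_singleton]) auto
    then show ?thesis by (simp add: vimage_def)
  qed
  have "{X. exits_via B S X} = (\<Union>n. (\<Inter>i\<in>{..<n}. {X. X i \<in> B}) \<inter> {X. X n \<in> - B \<inter> S})"
    by (auto simp: exits_via_iff)
  moreover have "(\<Inter>i\<in>{..<n}. {X. X i \<in> B}) \<in> sets (path_space :: (nat \<Rightarrow> int ^ 'd) measure)" for n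
  proof (cases "n = 0")
    case True
    then show ?thesis using sets.top[of "path_space :: (nat \<Rightarrow> int ^ 'd) measure"] by simp
  next
    case False
    then show ?thesis by (intro sets.finite_INT s) auto
  qed
  ultimately show ?thesis using s by (auto intro!: sets.Int sets.countable_UN')
qed

text \<open>The walk enters the later arguments through this function alone: it is harmonic in \<open>B\<close> with boundary
  values \<open>0\<close> on \<open>S\<close> and \<open>1\<close> elsewhere, and the maximum principle takes the role of stopping times.\<close>

definition fail_prob :: "'d::finite env \<Rightarrow> (int ^ 'd) set \<Rightarrow> (int ^ 'd) set \<Rightarrow> int ^ 'd \<Rightarrow> real" where
  "fail_prob \<omega> B S x = measure (quenched \<omega> x) {X. \<not> exits_via B S X}"

lemma sets_not_exits_via [measurable]:
  "{X. \<not> exits_via B S X} \<in> sets (path_space :: (nat \<Rightarrow> int ^ 'd::finite) measure)"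
  using sets.compl_sets[OF sets_exits_via[of B S]] by (simp add: Collect_neg_eq Compl_eq_Diff_UNIV)

lemma fail_prob_compl:
  "measure (quenched \<omega> x) {X. exits_via B S X} = 1 - fail_prob \<omega> B S x"
proof -
  interpret prob_space "quenched \<omega> x" by (rule prob_space_quenched)
  have "prob (space (quenched \<omega> x) - {X. \<not> exits_via B S X}) = 1 - prob {X. \<not> exits_via B S X}"
    by (rule prob_compl) simp
  moreover have "space (quenched \<omega> x) - {X. \<not> exits_via B S X} = {X. exits_via B S X}" by auto
  ultimately show ?thesis by (simp add: fail_prob_def)
qed

lemma fail_prob_nonneg: "0 \<le> fail_prob \<omega> B S x"
  by (simp add: fail_prob_def)

lemma fail_prob_le_1: "fail_prob \<omega> B S x \<le> 1"
  unfolding fail_prob_def by (rule prob_space.prob_le_1[OF prob_space_quenched])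

lemma fail_prob_inside:
  fixes \<omega> :: "'d::finite env"
  assumes "elliptic \<kappa> \<omega>" "0 \<le> \<kappa>" "x \<in> B"
  shows "fail_prob \<omega> B S x = (\<Sum>e\<in>dirs. \<omega> x e * fail_prob \<omega> B S (x + e))"
proof -
  have "\<omega> x \<in> site_simplex \<kappa>" using assms by (simp add: elliptic_def)
  then show ?thesis
    unfolding fail_prob_def using assms
    by (subst measure_quenched_first_step[of \<omega> x \<kappa>]) (auto simp: exits_via_case_nat vimage_def)
qed

lemma fail_prob_outside:
  fixes \<omega> :: "'d::finite env"
  assumes "elliptic \<kappa> \<omega>" "0 \<le> \<kappa>" "x \<notin> B"
  shows "fail_prob \<omega> B S x = (if x \<in> S then 0 else 1)"
proof -
  have \<omega>: "\<omega> x \<in> site_simplex \<kappa>" using assms by (simp add: elliptic_def)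
  have "fail_prob \<omega> B S x = (\<Sum>e\<in>dirs. \<omega> x e * measure (quenched \<omega> (x + e)) (if x \<in> S then {} else UNIV))"
    unfolding fail_prob_def using assms \<omega>
    by (subst measure_quenched_first_step[of \<omega> x \<kappa>]) (auto simp: exits_via_case_nat vimage_def)
  also have "\<dots> = (if x \<in> S then 0 else 1)"
    using elliptic_sum[OF assms(1)] prob_space.prob_space[OF prob_space_quenched, of \<omega>] by simp
  finally show ?thesis .
qed

section \<open>The maximum principle\<close>

lemma axis_dirs: "axis i 1 \<in> (dirs :: (int ^ 'd::finite) set)" "- axis i 1 \<in> (dirs :: (int ^ 'd::finite) set)"
  by (auto simp: dirs_def l1_def axis_def if_distrib[of abs] sum.delta cong: if_cong)

text \<open>Among the points where a positive maximum is attained choose one that is extremal in a coordinate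
  direction. Its neighbour in this direction carries positive weight and a strictly smaller
  value, which contradicts the mean value inequality.\<close>

lemma max_principle:
  fixes \<omega> :: "'d::finite env" and f :: "int ^ 'd \<Rightarrow> real"
  assumes \<omega>: "elliptic \<kappa> \<omega>" and \<kappa>: "0 < \<kappa>" and D: "finite D"
    and sub: "\<And>y. y \<in> D \<Longrightarrow> f y \<le> (\<Sum>e\<in>dirs. \<omega> y e * f (y + e))"
    and bnd: "\<And>y e. y \<in> D \<Longrightarrow> e \<in> dirs \<Longrightarrow> y + e \<notin> D \<Longrightarrow> f (y + e) \<le> 0"
    and x: "x \<in> D"
  shows "f x \<le> 0"
proof (rule ccontr)
  assume "\<not> f x \<le> 0"
  define M where "M = Max (f ` D)"
  have le_M: "f y \<le> M" if "y \<in> D" for y using D that by (simp add: M_def)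
  then have M: "M > 0" using \<open>\<not> f x \<le> 0\<close> x by force
  define D' where "D' = {y \<in> D. f y = M}"
  have "M \<in> f ` D" unfolding M_def using D x by (intro Max_in) auto
  then have "D' \<noteq> {}" "finite D'" using D by (auto simp: D'_def)
  fix i0 :: 'd
  obtain y where y: "y \<in> D'" and ymax: "\<And>z. z \<in> D' \<Longrightarrow> z $ i0 \<le> y $ i0"
  proof -
    have "Max ((\<lambda>y. y $ i0) ` D') \<in> (\<lambda>y. y $ i0) ` D'"
      using \<open>D' \<noteq> {}\<close> \<open>finite D'\<close> by (intro Max_in) auto
    then obtain y where "y \<in> D'" "y $ i0 = Max ((\<lambda>y. y $ i0) ` D')" by auto
    then show thesis using \<open>finite D'\<close> by (intro that[of y]) auto
  qed
  then have yD: "y \<in> D" and fy: "f y = M" by (auto simp: D'_def)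
  have le: "f (y + e) \<le> M" if "e \<in> dirs" for e
    using le_M[of "y + e"] bnd[OF yD that] M by (cases "y + e \<in> D") auto
  have "y + axis i0 1 \<notin> D'" using ymax[of "y + axis i0 1"] by (auto simp: axis_def)
  then have lt: "f (y + axis i0 1) < M"
  proof (cases "y + axis i0 1 \<in> D")
    case True
    then show ?thesis using le_M[OF True] \<open>y + axis i0 1 \<notin> D'\<close> by (auto simp: D'_def)
  next
    case False
    then show ?thesis using bnd[OF yD axis_dirs(1)[of i0]] M by linarith
  qed
  have pos: "0 < \<omega> y e" if "e \<in> dirs" for e
    using elliptic_ge[OF \<omega> that, of y] \<kappa> by simp
  have "M \<le> (\<Sum>e\<in>dirs. \<omega> y e * f (y + e))" using sub[OF yD] fy by simp
  also have "\<dots> < (\<Sum>e\<in>dirs. \<omega> y e * M)"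
    using le lt pos axis_dirs(1)[of i0]
    by (intro sum_strict_mono_ex1) (auto intro!: mult_left_mono less_imp_le bexI[of _ "axis i0 1"])
  also have "\<dots> = M" using elliptic_sum[OF \<omega>] by (simp add: sum_distrib_right[symmetric])
  finally show False by simp
qed

text \<open>A harmonic function is determined by its boundary values, so the environment outside \<open>B\<close> does
  not matter.\<close>

lemma fail_prob_cong:
  fixes \<omega> \<omega>' :: "'d::finite env"
  assumes \<omega>: "elliptic \<kappa> \<omega>" and \<omega>': "elliptic \<kappa> \<omega>'" and \<kappa>: "0 < \<kappa>" and B: "finite B"
    and eq: "\<And>y. y \<in> B \<Longrightarrow> \<omega> y = \<omega>' y"
    and x: "x \<in> B"
  shows "fail_prob \<omega> B S x = fail_prob \<omega>' B S x"
proof -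
  have *: "fail_prob \<omega> B S x - fail_prob \<omega>' B S x \<le> 0"
    if "elliptic \<kappa> \<omega>" "elliptic \<kappa> \<omega>'" "\<And>y. y \<in> B \<Longrightarrow> \<omega> y = \<omega>' y" for \<omega> \<omega>' :: "'d env"
  proof (rule max_principle[OF that(1) \<kappa> B _ _ x, where f = "\<lambda>y. fail_prob \<omega> B S y - fail_prob \<omega>' B S y"])
    fix y assume y: "y \<in> B"
    show "fail_prob \<omega> B S y - fail_prob \<omega>' B S y
        \<le> (\<Sum>e\<in>dirs. \<omega> y e * (fail_prob \<omega> B S (y + e) - fail_prob \<omega>' B S (y + e)))"
      using fail_prob_inside[OF that(1) _ y] fail_prob_inside[OF that(2) _ y] that(3)[OF y] \<kappa>
      by (simp add: right_diff_distrib sum_subtractf)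
  next
    fix y e assume "y + e \<notin> B"
    then show "fail_prob \<omega> B S (y + e) - fail_prob \<omega>' B S (y + e) \<le> 0"
      using fail_prob_outside[OF that(1)] fail_prob_outside[OF that(2)] \<kappa> by simp
  qed
  show ?thesis
    using *[OF \<omega> \<omega>' eq] *[OF \<omega>' \<omega>] eq by force
qed

text \<open>The walk takes \<open>k\<close> given steps in direction \<open>e0\<close> with probability at least \<open>(2 * \<kappa>) ^ k\<close>. Only the points
  one step away from this straight path enter as places of deviation, so the bound \<open>b\<close> is needed
  next to the path and not in a whole ball of radius \<open>k\<close>.\<close>

lemma push_bound:
  fixes \<omega> :: "'d::finite env" and g :: "int ^ 'd \<Rightarrow> real"
  assumes \<omega>: "elliptic \<kappa> \<omega>" and \<kappa>: "0 < \<kappa>" and e0: "e0 \<in> dirs" and ab: "a \<le> b"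
    and sub: "\<And>j. j < k \<Longrightarrow> g (x + int j *s e0) \<le> (\<Sum>e\<in>dirs. \<omega> (x + int j *s e0) e * g (x + int j *s e0 + e))"
    and dev: "\<And>j e. j < k \<Longrightarrow> e \<in> dirs \<Longrightarrow> g (x + int j *s e0 + e) \<le> b"
    and top: "g (x + int k *s e0) \<le> a"
  shows "g x \<le> b - (2 * \<kappa>) ^ k * (b - a)"
  using sub dev top
proof (induction k arbitrary: x)
  case 0
  then show ?case by simp
next
  case (Suc k)
  have sh: "x + e0 + int j *s e0 = x + int (Suc j) *s e0" for j
    by (simp add: vec_eq_iff algebra_simps)
  have IH: "g (x + e0) \<le> b - (2 * \<kappa>) ^ k * (b - a)"
  proof (rule Suc.IH)
    fix j assume "j < k"
    then show "g (x + e0 + int j *s e0) \<le> (\<Sum>e\<in>dirs. \<omega> (x + e0 + int j *s e0) e * g (x + e0 + int j *s e0 + e))"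
      unfolding sh by (intro Suc.prems(1)) simp
  next
    fix j e assume "j < k" "e \<in> (dirs :: (int ^ 'd) set)"
    then show "g (x + e0 + int j *s e0 + e) \<le> b"
      unfolding sh by (intro Suc.prems(2)) auto
  next
    show "g (x + e0 + int k *s e0) \<le> a" unfolding sh by (rule Suc.prems(3))
  qed
  have nn: "0 \<le> \<omega> x e" if "e \<in> dirs" for e
    using elliptic_ge[OF \<omega> that, of x] \<kappa> by simp
  have "g x \<le> (\<Sum>e\<in>dirs. \<omega> x e * g (x + e))" using Suc.prems(1)[of 0] by simp
  also have "\<dots> \<le> (\<Sum>e\<in>dirs. \<omega> x e * (b - (if e = e0 then (2 * \<kappa>) ^ k * (b - a) else 0)))"
    using Suc.prems(2)[of 0] IH nn by (intro sum_mono mult_left_mono) auto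
  also have "\<dots> = b - \<omega> x e0 * ((2 * \<kappa>) ^ k * (b - a))"
    using elliptic_sum[OF \<omega>, of x] e0
    by (simp add: right_diff_distrib sum_subtractf sum_distrib_right[symmetric] if_distrib[of "\<lambda>z. _ * z"] cong: if_cong)
  also have "\<dots> \<le> b - 2 * \<kappa> * ((2 * \<kappa>) ^ k * (b - a))"
    using elliptic_ge[OF \<omega> e0, of x] \<kappa> ab by (intro diff_left_mono mult_right_mono) auto
  finally show ?case by (simp add: mult.assoc)
qed

section \<open>Lattice coordinates in the rotated frame\<close>

definition coord :: "real ^ 'd ^ 'd \<Rightarrow> 'd::finite \<Rightarrow> int ^ 'd \<Rightarrow> real" where
  "coord R j z = rvec z \<bullet> (R *v axis j 1)"

lemma rvec_simps: "rvec (x + y) = rvec x + rvec y" "rvec (x - y) = rvec x - rvec y" "rvec (- x) = - rvec x"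
  "rvec (k *s x) = real_of_int k *\<^sub>R rvec x" "rvec 0 = 0"
  by (auto simp: rvec_def vec_eq_iff)

lemma coord_simps [simp]: "coord R j (x + y) = coord R j x + coord R j y" "coord R j (x - y) = coord R j x - coord R j y"
  "coord R j (- x) = - coord R j x" "coord R j (k *s x) = real_of_int k * coord R j x" "coord R j 0 = 0"
  by (auto simp: coord_def rvec_simps inner_simps)

lemma norm_rvec_le_l1: "norm (rvec z) \<le> real_of_int (l1 z)"
proof -
  have "norm (rvec z) \<le> (\<Sum>i\<in>UNIV. \<bar>rvec z $ i\<bar>)" by (rule norm_le_l1_cart)
  then show ?thesis by (simp add: l1_def rvec_def)
qed

context
  fixes R :: "real ^ 'd::finite ^ 'd" and i1 :: 'd and l :: "real ^ 'd"
  assumes R: "rotation_to i1 R l"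
begin

lemma orthR: "orthogonal_matrix R"
  using R by (simp add: rotation_to_def rotation_matrix_def)

lemma norm_R_axis: "norm (R *v axis j 1) = 1"
  using orthogonal_transformation_norm[OF orthogonal_transformation_matrix[THEN iffD2], of "(*v) R" "axis j 1"] orthR
  by (simp add: norm_axis_1)

lemma inner_l: "rvec z \<bullet> l = coord R i1 z"
  using R by (simp add: rotation_to_def coord_def)

lemma abs_coord_le_norm: "\<bar>coord R j z\<bar> \<le> norm (rvec z)"
  using Cauchy_Schwarz_ineq2[of "rvec z" "R *v axis j 1"] norm_R_axis by (simp add: coord_def)

lemma abs_coord_le_l1: "\<bar>coord R j z\<bar> \<le> real_of_int (l1 z)"
  using abs_coord_le_norm norm_rvec_le_l1 order_trans by blast

lemma abs_coord_dirs: "e \<in> dirs \<Longrightarrow> \<bar>coord R j e\<bar> \<le> 1"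
  using abs_coord_le_l1[of j e] by (simp add: dirs_def)

lemma coord_eq: "coord R j z = (transpose R *v rvec z) $ j"
proof -
  have "coord R j z = (transpose R *v rvec z) \<bullet> axis j 1"
    unfolding coord_def by (simp add: dot_lmul_matrix[symmetric] transpose_matrix_vector)
  then show ?thesis by (simp add: inner_axis)
qed

lemma in_rotated_box:
  "z \<in> rotated_lattice_box i1 R S T \<longleftrightarrow> coord R i1 z \<in> S \<and> (\<forall>j. j \<noteq> i1 \<longrightarrow> coord R j z \<in> T)"
proof -
  have 1: "transpose R *v (R *v y) = y" and 2: "R *v (transpose R *v y) = y" for y :: "real ^ 'd"
    using orthR by (simp_all add: matrix_vector_mul_assoc orthogonal_matrix_def del: transpose_matrix_vector)
  have "rvec z \<in> (\<lambda>y. R *v y) ` A \<longleftrightarrow> transpose R *v rvec z \<in> A" for A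
    by (metis (no_types, lifting) 1 2 imageE image_eqI)
  then show ?thesis by (simp add: rotated_lattice_box_def coord_eq)
qed

lemma norm_rvec_coord: "norm (rvec z) \<le> (\<Sum>j\<in>UNIV. \<bar>coord R j z\<bar>)"
proof -
  have "R *v (transpose R *v rvec z) = rvec z"
    using orthR by (simp add: matrix_vector_mul_assoc orthogonal_matrix_def del: transpose_matrix_vector)
  then have "norm (rvec z) = norm (transpose R *v rvec z)"
    using orthogonal_transformation_norm[OF orthogonal_transformation_matrix[THEN iffD2], of "(*v) R" "transpose R *v rvec z"] orthR
    by simp
  also have "\<dots> \<le> (\<Sum>j\<in>UNIV. \<bar>coord R j z\<bar>)"
    unfolding coord_eq by (rule norm_le_l1_cart)
  finally show ?thesis .
qed

text \<open>Some coordinate of a unit vector has absolute value at least \<open>1 / sqrt d\<close>.\<close>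

lemma up_direction: "\<exists>e0\<in>dirs. 1 / sqrt CARD('d) \<le> coord R i1 e0"
proof -
  have l: "norm l = 1" using norm_R_axis[of i1] R by (simp add: rotation_to_def)
  have "\<exists>i. 1 / sqrt CARD('d) \<le> \<bar>l $ i\<bar>"
  proof (rule ccontr)
    assume "\<not> ?thesis"
    then have "\<bar>l $ i\<bar> < 1 / sqrt CARD('d)" for i by (auto simp: not_le)
    then have "(l $ i)\<^sup>2 < (1 / sqrt CARD('d))\<^sup>2" for i
      by (metis abs_ge_zero power2_abs power_strict_mono zero_less_numeral)
    then have "(\<Sum>i\<in>UNIV. (l $ i)\<^sup>2) < (\<Sum>i\<in>(UNIV::'d set). (1 / sqrt CARD('d))\<^sup>2)"
      by (intro sum_strict_mono) auto
    also have "\<dots> = 1" by (simp add: power_divide)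
    finally have "(\<Sum>i\<in>UNIV. (l $ i)\<^sup>2) < 1" .
    moreover have "(\<Sum>i\<in>UNIV. (l $ i)\<^sup>2) = (norm l)\<^sup>2"
      by (simp add: norm_vec_def L2_set_def sum_nonneg)
    ultimately show False using l by simp
  qed
  then obtain i where i: "1 / sqrt CARD('d) \<le> \<bar>l $ i\<bar>" by blast
  have ax: "coord R i1 (axis i 1) = l $ i"
  proof -
    have "rvec (axis i 1) = axis i 1" by (auto simp: rvec_def axis_def vec_eq_iff)
    then show ?thesis by (simp add: inner_l[symmetric] inner_axis' )
  qed
  show ?thesis
  proof (cases "l $ i \<ge> 0")
    case True
    then show ?thesis using i ax axis_dirs(1) by (intro bexI[of _ "axis i 1"]) auto
  next
    case False
    then show ?thesis using i ax axis_dirs(2) by (intro bexI[of _ "- axis i 1"]) auto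
  qed
qed

end

lemma bdry_step:
  assumes "y \<in> B" "e \<in> dirs" "y + e \<notin> B"
  shows "y + e \<in> bdry 1 B"
proof -
  have "d1 {y + e} B \<le> ereal (real_of_int (l1 (y + e - y)))"
    unfolding d1_def using assms by (auto intro!: INF_lower2[of y])
  then show ?thesis using assms by (simp add: bdry_def dirs_def)
qed

definition cube :: "real \<Rightarrow> (int ^ 'd::finite) set" where
  "cube M = {z. \<forall>i. \<bar>real_of_int (z $ i)\<bar> \<le> M}"

lemma cube_bound:
  assumes "0 \<le> M"
  shows "finite (cube M :: (int ^ 'd::finite) set)" "real (card (cube M :: (int ^ 'd::finite) set)) \<le> (2 * M + 1) ^ CARD('d)"
proof -
  let ?P = "PiE (UNIV :: 'd set) (\<lambda>_. {-\<lfloor>M\<rfloor>..\<lfloor>M\<rfloor>})"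
  have inj: "inj_on vec_nth (cube M :: (int ^ 'd) set)" by (auto simp: inj_on_def vec_eq_iff)
  have sub: "vec_nth ` (cube M :: (int ^ 'd) set) \<subseteq> ?P"
    by (auto simp: cube_def PiE_def abs_le_iff le_floor_iff) (smt (verit) le_floor_iff of_int_minus)
  have fin: "finite ?P" by (intro finite_PiE) auto
  show "finite (cube M :: (int ^ 'd) set)"
    using finite_imageD[OF finite_subset[OF sub fin] inj] .
  have "card (cube M :: (int ^ 'd) set) \<le> card ?P"
    using card_mono[OF fin sub] card_image[OF inj] by simp
  also have "\<dots> = nat (2 * \<lfloor>M\<rfloor> + 1) ^ CARD('d)" by (simp add: card_PiE)
  finally have "real (card (cube M :: (int ^ 'd) set)) \<le> real (nat (2 * \<lfloor>M\<rfloor> + 1)) ^ CARD('d)"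
    by (metis of_nat_le_iff of_nat_power)
  also have "\<dots> \<le> (2 * M + 1) ^ CARD('d)"
    using assms by (intro power_mono) auto
  finally show "real (card (cube M :: (int ^ 'd) set)) \<le> (2 * M + 1) ^ CARD('d)" .
qed

section \<open>Comparison inside one block\<close>

text \<open>The failure probability of the large box \<open>B\<close> is compared with that of the block \<open>x + Q\<close> on the
  intersection of the two, where both are harmonic. Where the walk leaves the intersection through
  \<open>F\<close>, the failure probability of \<open>B\<close> vanishes; where it leaves the block, it is at most \<open>a\<close> on the front
  of the block and at most \<open>b\<close> elsewhere.\<close>

lemma block_step:
  fixes \<omega> :: "'d::finite env"
  assumes \<omega>: "elliptic \<kappa> \<omega>" and \<kappa>: "0 < \<kappa>" and B: "finite B" and xB: "x \<in> B" and x0: "0 \<in> Q"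
    and right: "\<And>y e. y \<in> B \<Longrightarrow> y - x \<in> Q \<Longrightarrow> e \<in> dirs \<Longrightarrow> y + e \<notin> B \<Longrightarrow> y + e \<in> F"
    and rear: "\<And>y e. y \<in> B \<Longrightarrow> y - x \<in> Q \<Longrightarrow> e \<in> dirs \<Longrightarrow> y + e \<in> B \<Longrightarrow> y + e - x \<notin> Q \<Longrightarrow>
       fail_prob \<omega> B F (y + e) \<le> b"
    and front: "\<And>y e. y \<in> B \<Longrightarrow> y - x \<in> Q \<Longrightarrow> e \<in> dirs \<Longrightarrow> y + e \<in> B \<Longrightarrow> y + e - x \<notin> Q \<Longrightarrow>
       y + e - x \<in> Q' \<Longrightarrow> fail_prob \<omega> B F (y + e) \<le> a"
    and ab: "a \<le> b" and a: "0 \<le> a"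
  shows "fail_prob \<omega> B F x \<le> a + (b - a) * fail_prob (shift x \<omega>) Q Q' 0"
proof -
  let ?f = "fail_prob \<omega> B F" and ?h = "\<lambda>y. fail_prob (shift x \<omega>) Q Q' (y - x)"
  let ?D = "{y \<in> B. y - x \<in> Q}"
  have sh: "elliptic \<kappa> (shift x \<omega>)" using \<omega> by (simp add: elliptic_def shift_def)
  have "?f x - a - (b - a) * ?h x \<le> 0"
  proof (rule max_principle[OF \<omega> \<kappa>, of ?D "\<lambda>y. ?f y - a - (b - a) * ?h y"])
    fix y assume y: "y \<in> ?D"
    have 1: "?f y = (\<Sum>e\<in>dirs. \<omega> y e * ?f (y + e))"
      using fail_prob_inside[OF \<omega>, of y B F] \<kappa> y by simp
    have 2: "?h y = (\<Sum>e\<in>dirs. \<omega> y e * ?h (y + e))"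
      using fail_prob_inside[OF sh, of "y - x" Q Q'] \<kappa> y by (simp add: shift_def algebra_simps)
    show "?f y - a - (b - a) * ?h y \<le> (\<Sum>e\<in>dirs. \<omega> y e * (?f (y + e) - a - (b - a) * ?h (y + e)))"
      apply (subst 1, subst 2)
      using elliptic_sum[OF \<omega>, of y]
      by (simp add: algebra_simps sum_subtractf sum.distrib sum_distrib_left[symmetric])
  next
    fix y e assume y: "y \<in> ?D" and e: "e \<in> dirs" and z: "y + e \<notin> ?D"
    show "?f (y + e) - a - (b - a) * ?h (y + e) \<le> 0"
    proof (cases "y + e \<in> B")
      case False
      then have "?f (y + e) = 0"
        using fail_prob_outside[OF \<omega>, of "y + e" B F] right[of y e] y e \<kappa> by simp
      moreover have "0 \<le> (b - a) * ?h (y + e)" using ab by (simp add: fail_prob_nonneg)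
      ultimately show ?thesis using a by linarith
    next
      case True
      with z have nQ: "y + e - x \<notin> Q" by simp
      show ?thesis
      proof (cases "y + e - x \<in> Q'")
        case True
        have "?f (y + e) \<le> a" using front[of y e] y e nQ True \<open>y + e \<in> B\<close> by simp
        moreover have "0 \<le> (b - a) * ?h (y + e)" using ab by (simp add: fail_prob_nonneg)
        ultimately show ?thesis by linarith
      next
        case False
        then have "?h (y + e) = 1" using fail_prob_outside[OF sh, of "y + e - x" Q Q'] nQ \<kappa> by simp
        then show ?thesis using rear[of y e] y e nQ \<open>y + e \<in> B\<close> by simp
      qed
    qed
  qed (use B xB x0 in auto)
  then show ?thesis by simp
qed

section \<open>The one-dimensional potential\<close>

context
  fixes I :: "int set" and s0 s2 :: int and \<rho>0 \<rho>1 :: real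
  assumes \<rho>: "0 < \<rho>0" "\<rho>0 \<le> 1" "1 \<le> \<rho>1" and s: "s0 \<le> s2" and I: "finite I"
begin

text \<open>This is the potential of a walk on the integers whose odds of stepping down against up are
  governed by \<open>\<rho>1\<close> on \<open>I\<close> and by \<open>\<rho>0\<close> elsewhere: \<open>slab_drop i\<close> is the product of the odds from \<open>s0\<close> to
  \<open>i\<close>, and the potential is its tail sum up to \<open>s2\<close>. Slabs up to \<open>s0\<close> are too close to the back of the box to be
  controlled; there the potential is at least \<open>1\<close> and bounds any probability.\<close>

definition slab_drop :: "int \<Rightarrow> real" where
  "slab_drop i = (\<Prod>j\<in>{s0<..i}. if j \<in> I then \<rho>1 else \<rho>0)"

definition slab_pot :: "int \<Rightarrow> real" where
  "slab_pot i = (\<Sum>j\<in>{i..s2}. slab_drop j)"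

lemma slab_drop_pos: "0 < slab_drop i"
  using \<rho> by (auto simp: slab_drop_def intro!: prod_pos)

lemma slab_drop_start: "i \<le> s0 \<Longrightarrow> slab_drop i = 1"
  by (simp add: slab_drop_def)

lemma slab_drop_step: "s0 < i \<Longrightarrow> slab_drop i = (if i \<in> I then \<rho>1 else \<rho>0) * slab_drop (i - 1)"
proof -
  assume "s0 < i"
  then have "{s0<..i} = insert i {s0<..i - 1}" by auto
  then show ?thesis by (simp add: slab_drop_def)
qed

lemma slab_pot_step: "i \<le> s2 \<Longrightarrow> slab_pot i = slab_drop i + slab_pot (i + 1)"
proof -
  assume "i \<le> s2"
  then have "{i..s2} = insert i {i + 1..s2}" by auto
  then show ?thesis by (simp add: slab_pot_def)
qed

lemma slab_pot_nonneg: "0 \<le> slab_pot i"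
  using slab_drop_pos by (auto simp: slab_pot_def less_imp_le intro!: sum_nonneg)

lemma slab_pot_antimono: "i \<le> j \<Longrightarrow> slab_pot j \<le> slab_pot i"
  using slab_drop_pos by (auto simp: slab_pot_def less_imp_le intro!: sum_mono2)

lemma slab_pot_ge_1: "i \<le> s0 \<Longrightarrow> 1 \<le> slab_pot i"
proof -
  assume "i \<le> s0"
  have "1 = slab_drop s0" by (simp add: slab_drop_start)
  also have "\<dots> \<le> slab_pot s0" using slab_pot_step[OF s] slab_pot_nonneg[of "s0 + 1"] by simp
  also have "\<dots> \<le> slab_pot i" by (rule slab_pot_antimono) fact
  finally show ?thesis .
qed

lemma slab_drop_lower: "\<rho>0 ^ nat (i - s0) \<le> slab_drop i"
proof -
  have "\<rho>0 ^ nat (i - s0) = (\<Prod>j\<in>{s0<..i}. \<rho>0)" by simp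
  also have "\<dots> \<le> slab_drop i" unfolding slab_drop_def using \<rho> by (intro prod_mono) auto
  finally show ?thesis .
qed

lemma slab_drop_upper:
  assumes "int n \<le> i - s0" "card I \<le> M"
  shows "slab_drop i \<le> \<rho>0 ^ (n - M) * \<rho>1 ^ M"
proof -
  let ?A = "{s0<..i}"
  have "slab_drop i = (\<Prod>j\<in>?A - I. \<rho>0) * (\<Prod>j\<in>?A \<inter> I. \<rho>1)"
    unfolding slab_drop_def by (subst prod.If_cases) (auto simp: Diff_eq mult.commute)
  also have "\<dots> = \<rho>0 ^ card (?A - I) * \<rho>1 ^ card (?A \<inter> I)" by simp
  also have "\<dots> \<le> \<rho>0 ^ (n - M) * \<rho>1 ^ M"
  proof (rule mult_mono)
    have c: "card (?A \<inter> I) \<le> M" using card_mono[OF I, of "?A \<inter> I"] assms by auto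
    have "card (?A - I) = card ?A - card (?A \<inter> I)" by (rule card_Diff_subset_Int) auto
    then have "n - M \<le> card (?A - I)" using c assms by simp
    then show "\<rho>0 ^ card (?A - I) \<le> \<rho>0 ^ (n - M)" using \<rho> by (intro power_decreasing) auto
    show "\<rho>1 ^ card (?A \<inter> I) \<le> \<rho>1 ^ M" using \<rho> c by (intro power_increasing) auto
  qed (use \<rho> in auto)
  finally show ?thesis .
qed

lemma slab_pot_upper:
  assumes "int n \<le> - s0" "card I \<le> M" "0 \<le> s2"
  shows "slab_pot 0 \<le> (real_of_int s2 + 1) * (\<rho>0 ^ (n - M) * \<rho>1 ^ M)"
proof -
  have "slab_pot 0 \<le> (\<Sum>j\<in>{0..s2}. \<rho>0 ^ (n - M) * \<rho>1 ^ M)"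
    unfolding slab_pot_def using assms by (intro sum_mono slab_drop_upper) auto
  then show ?thesis using assms by simp
qed

text \<open>One block exit leads from slab \<open>i\<close> to slab \<open>i + 1\<close> or beyond, up to an error of probability \<open>1 / N\<close> in which
  it may lead back to slab \<open>i - 1\<close>. Slabs in \<open>I\<close> are included, since the larger factor \<open>\<rho>1\<close>
  only helps: a slab with bad sites may also contain sites that are not bad.\<close>

lemma slab_pot_good:
  assumes i: "s0 < i" "i \<le> s2" and N: "2 < N" "\<rho>0 = 2 / N"
  shows "slab_pot (i + 1) + (slab_pot (i - 1) - slab_pot (i + 1)) / N < slab_pot i"
proof -
  have 1: "slab_pot (i - 1) = slab_drop (i - 1) + slab_drop i + slab_pot (i + 1)" "slab_pot i = slab_drop i + slab_pot (i + 1)"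
    using slab_pot_step[of "i - 1"] slab_pot_step[of i] i by auto
  have "\<rho>0 * slab_drop (i - 1) \<le> slab_drop i"
    using slab_drop_step[OF i(1)] slab_drop_pos[of "i - 1"] \<rho> by auto
  then have "N * (\<rho>0 * slab_drop (i - 1)) \<le> N * slab_drop i" using N(1) by (intro mult_left_mono) auto
  moreover have "N * (\<rho>0 * slab_drop (i - 1)) = 2 * slab_drop (i - 1)"
  proof -
    have "N * \<rho>0 = 2" using N by simp
    then show ?thesis by (metis mult.assoc)
  qed
  ultimately have "slab_drop (i - 1) \<le> slab_drop i * N / 2" by (simp add: mult.commute)
  then have "(slab_drop (i - 1) + slab_drop i) / N \<le> slab_drop i * (1 / 2 + 1 / N)"
    using N(1) by (simp add: field_simps)
  also have "\<dots> < slab_drop i * 1"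
    using N(1) slab_drop_pos[of i] by (intro mult_strict_left_mono) (auto simp: field_simps)
  finally show ?thesis unfolding 1 by simp
qed

text \<open>With probability \<open>\<eta>\<close> the walk is pushed to slab \<open>i + 1\<close>, otherwise it may fall to slab \<open>i - 1\<close>. As
  \<open>2 / \<eta>\<close> exceeds twice the odds \<open>(1 - \<eta>) / \<eta>\<close> of a fall, a gap of one increment remains, which pays for
  the error term \<open>\<delta>\<close>.\<close>

lemma slab_pot_bad:
  assumes i: "s0 < i" "i \<le> s2" "i \<in> I" and \<eta>: "0 < \<eta>" "\<rho>1 = 2 / \<eta>" and \<delta>: "\<delta> \<le> slab_drop (i - 1)"
  shows "slab_pot (i - 1) + \<delta> - \<eta> * (slab_pot (i - 1) - slab_pot (i + 1)) < slab_pot i"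
proof -
  have 1: "slab_pot (i - 1) = slab_drop (i - 1) + slab_drop i + slab_pot (i + 1)" "slab_pot i = slab_drop i + slab_pot (i + 1)"
    using slab_pot_step[of "i - 1"] slab_pot_step[of i] i by auto
  have "\<eta> * slab_drop i = 2 * slab_drop (i - 1)"
    using slab_drop_step[OF i(1)] i \<eta> by simp
  moreover have "0 < \<eta> * slab_drop (i - 1)" using \<eta> slab_drop_pos by simp
  ultimately show ?thesis using \<delta> unfolding 1 by (simp add: algebra_simps)
qed

end

section \<open>The deterministic estimate\<close>

definition block_bad :: "'d \<Rightarrow> real ^ 'd ^ 'd \<Rightarrow> real ^ 'd \<Rightarrow> real \<Rightarrow> 'd::finite env \<Rightarrow> int ^ 'd \<Rightarrow> bool" where
  "block_bad i1 R l N \<omega> x \<longleftrightarrow> 1 / N < fail_prob (shift x \<omega>) (box2 i1 R N) (box2_front i1 R l N) 0"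

abbreviation big_box :: "'d \<Rightarrow> real ^ 'd ^ 'd \<Rightarrow> real \<Rightarrow> (int ^ 'd) set" where
  "big_box i1 R N \<equiv> spec_box i1 R (N ^ 3 - 2) (N ^ 3 + 2) (N ^ 7)"

abbreviation big_front :: "'d \<Rightarrow> real ^ 'd ^ 'd \<Rightarrow> real ^ 'd \<Rightarrow> real \<Rightarrow> (int ^ 'd) set" where
  "big_front i1 R l N \<equiv> spec_front i1 l R (N ^ 3 - 2) (N ^ 3 + 2) (N ^ 7)"

definition cell :: "real ^ 'd ^ 'd \<Rightarrow> 'd::finite \<Rightarrow> real \<Rightarrow> int ^ 'd \<Rightarrow> int" where
  "cell R i1 N x = \<lfloor>coord R i1 x / N\<rfloor>"

text \<open>So many steps in the direction of \<open>up_direction\<close> raise the level by at least \<open>N\<close>.\<close>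

definition climb_steps :: "nat \<Rightarrow> real \<Rightarrow> nat" where
  "climb_steps d N = nat \<lceil>sqrt (real d) * N\<rceil>"

lemma big_box_iff:
  assumes "rotation_to i1 R l"
  shows "x \<in> big_box i1 R N \<longleftrightarrow> - (N ^ 3 - 2) < coord R i1 x \<and> coord R i1 x < N ^ 3 + 2 \<and>
     (\<forall>j. j \<noteq> i1 \<longrightarrow> - (N ^ 7) < coord R j x \<and> coord R j x < N ^ 7)"
  unfolding spec_box_def in_rotated_box[OF assms] by auto

lemma box2_iff:
  assumes "rotation_to i1 R l"
  shows "x \<in> box2 i1 R N \<longleftrightarrow> - (N / 11) < coord R i1 x \<and> coord R i1 x < 12 * N / 11 \<and>
     (\<forall>j. j \<noteq> i1 \<longrightarrow> - (N ^ 3 / 10) < coord R j x \<and> coord R j x < 11 * N ^ 3 / 10)"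
  unfolding box2_def in_rotated_box[OF assms] by auto

lemma box2_front_iff:
  assumes "rotation_to i1 R l"
  shows "x \<in> box2_front i1 R l N \<longleftrightarrow> x \<in> bdry 1 (box2 i1 R N) \<and> 12 * N / 11 \<le> coord R i1 x \<and>
     (\<forall>j. j \<noteq> i1 \<longrightarrow> - (N ^ 3 / 10) < coord R j x \<and> coord R j x < 11 * N ^ 3 / 10)"
  unfolding box2_front_def inner_l[OF assms] coord_def[symmetric] by simp

lemma big_front_I:
  assumes R: "rotation_to i1 R l" and y: "y \<in> big_box i1 R N" "e \<in> dirs" "y + e \<notin> big_box i1 R N"
    and lev: "- (N ^ 3 - 2) < coord R i1 (y + e)"
    and tr: "\<And>j. j \<noteq> i1 \<Longrightarrow> \<bar>coord R j (y + e)\<bar> < N ^ 7"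
  shows "y + e \<in> big_front i1 R l N"
proof -
  have "N ^ 3 + 2 \<le> coord R i1 (y + e)"
    using y(3) lev tr unfolding big_box_iff[OF R] by (force simp: abs_less_iff)
  moreover have "y + e \<in> bdry 1 (big_box i1 R N)"
    using y by (rule bdry_step)
  ultimately show ?thesis
    using tr unfolding spec_front_def inner_l[OF R] coord_def[symmetric] by simp
qed

lemma finite_big_box:
  fixes R :: "real ^ 'd::finite ^ 'd"
  assumes R: "rotation_to i1 R l" and N: "1 \<le> N"
  shows "big_box i1 R N \<subseteq> cube (3 * real CARD('d) * N ^ 7)" "finite (big_box i1 R N)"
proof -
  show 1: "big_box i1 R N \<subseteq> cube (3 * real CARD('d) * N ^ 7)"
  proof
    fix x assume x: "x \<in> big_box i1 R N"
    have N37: "N ^ 3 \<le> N ^ 7" "1 \<le> N ^ 7" using N by (auto intro: power_increasing)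
    have "\<bar>coord R j x\<bar> \<le> 3 * N ^ 7" for j
    proof (cases "j = i1")
      case True
      then show ?thesis using x N37 unfolding big_box_iff[OF R] by (auto simp: abs_le_iff)
    next
      case False
      then show ?thesis using x N37 unfolding big_box_iff[OF R] by (force simp: abs_le_iff)
    qed
    then have "(\<Sum>j\<in>UNIV. \<bar>coord R j x\<bar>) \<le> (\<Sum>j\<in>(UNIV::'d set). 3 * N ^ 7)" by (intro sum_mono)
    then have "norm (rvec x) \<le> 3 * real CARD('d) * N ^ 7"
      using norm_rvec_coord[OF R, of x] by simp
    then have "\<bar>rvec x $ i\<bar> \<le> 3 * real CARD('d) * N ^ 7" for i
      using component_le_norm_cart[of "rvec x" i] by linarith
    then show "x \<in> cube (3 * real CARD('d) * N ^ 7)" by (simp add: cube_def rvec_def)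
  qed
  show "finite (big_box i1 R N)"
    using finite_subset[OF 1 cube_bound(1)] N by simp
qed

lemma exp_minus_2: "exp (- 2 :: real) \<le> 1 / 4" "exp (2 :: real) \<le> 9"
proof -
  have "2 \<le> exp (1 :: real)" using exp_ge_add_one_self[of 1] by simp
  then have "2 * 2 \<le> exp (1 :: real) * exp 1" by (intro mult_mono) auto
  then have "4 \<le> exp (2 :: real)" by (simp add: exp_add[symmetric])
  then show "exp (- 2 :: real) \<le> 1 / 4" by (simp add: exp_minus field_simps)
  have "exp (1 :: real) \<le> 3" using exp_le by simp
  then have "exp (1 :: real) * exp 1 \<le> 3 * 3" by (intro mult_mono) auto
  then show "exp (2 :: real) \<le> 9" by (simp add: exp_add[symmetric])
qed

text \<open>The properties of an environment, outside the rare event, from which the bound on the failure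
  probability is derived. The number \<open>t j \<sigma>\<close> is the inner end of the strip of width \<open>N ^ 6 / 4\<close> without bad
  sites in front of the lateral face in direction \<open>\<sigma>\<close> of coordinate \<open>j\<close>; \<open>margin\<close> says that the lateral terms at
  the inner end are smaller than any increment of the one-dimensional potential.\<close>

locale large_scale =
  fixes d :: nat and \<omega> :: "'d::finite env" and \<kappa> N :: real and i1 :: 'd and R :: "real ^ 'd ^ 'd" and l :: "real ^ 'd"
    and t :: "'d \<Rightarrow> real \<Rightarrow> real" and M :: nat
  assumes dim [simp]: "CARD('d) = d" and \<omega>: "elliptic \<kappa> \<omega>" and \<kappa>: "0 < \<kappa>" "2 * \<kappa> \<le> 1" and R: "rotation_to i1 R l"
    and N: "16 \<le> N" "real d \<le> N"
    and strip_range: "\<And>j \<sigma>. 0 \<le> t j \<sigma>" "\<And>j \<sigma>. t j \<sigma> + N ^ 6 / 4 \<le> N ^ 7"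
    and strip_good: "\<And>j \<sigma> x. j \<noteq> i1 \<Longrightarrow> \<sigma> \<in> {-1, 1} \<Longrightarrow> x \<in> big_box i1 R N \<Longrightarrow> block_bad i1 R l N \<omega> x \<Longrightarrow>
        t j \<sigma> \<le> \<sigma> * coord R j x \<Longrightarrow> t j \<sigma> + N ^ 6 / 4 \<le> \<sigma> * coord R j x"
    and few_slabs: "card (cell R i1 N ` {x \<in> big_box i1 R N. block_bad i1 R l N \<omega> x}) \<le> M"
    and margin: "2 * real d * exp (6 * N\<^sup>2 + 10 - N ^ 3 / 4) \<le> (2 / N) ^ nat (2 * \<lfloor>N\<^sup>2\<rfloor> + 2)"
begin

abbreviation "lev \<equiv> coord R i1"
abbreviation "B \<equiv> big_box i1 R N"
abbreviation "F \<equiv> big_front i1 R l N"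
abbreviation "bad \<equiv> block_bad i1 R l N \<omega>"
abbreviation "f \<equiv> fail_prob \<omega> B F"
abbreviation "n1 \<equiv> climb_steps d N"
abbreviation "\<eta> \<equiv> (2 * \<kappa>) ^ n1"
abbreviation "I \<equiv> cell R i1 N ` {x \<in> B. bad x}"
abbreviation "s0 \<equiv> - \<lfloor>N\<^sup>2\<rfloor>"
abbreviation "s2 \<equiv> \<lfloor>N\<^sup>2\<rfloor> + 2"
abbreviation "\<phi> \<equiv> slab_pot I s0 s2 (2 / N) (2 / \<eta>)"
abbreviation "Js \<equiv> (UNIV - {i1}) \<times> {-1, 1 :: real}"

text \<open>The comparison takes place in the part of the box up to the outer ends of the free strips, so that bad
  sites of this region stay a full strip width away from its lateral boundary.\<close>

definition U :: "(int ^ 'd) set" where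
  "U = {x \<in> B. \<forall>(j, \<sigma>)\<in>Js. \<sigma> * coord R j x < t j \<sigma> + N ^ 6 / 4}"

text \<open>The rate \<open>3\<close> in the level against \<open>1\<close> in the lateral coordinate makes this term decrease over a
  successful block exit, which gains \<open>12 N / 11\<close> levels and shifts by at most \<open>11 N ^ 3 / 10\<close> laterally. The
  constant is such that the term is at least \<open>1\<close> within \<open>2 N ^ 3\<close> of the outer end of the strip, at every
  level of the box.\<close>

definition side :: "'d \<Rightarrow> real \<Rightarrow> int ^ 'd \<Rightarrow> real" where
  "side j \<sigma> x = exp (- 3 * lev x / N + (\<sigma> * coord R j x - t j \<sigma> - N ^ 6 / 4) / N ^ 3 + 2 + 3 * (N ^ 3 + 2) / N)"

definition sides :: "int ^ 'd \<Rightarrow> real" where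
  "sides x = (\<Sum>(j, \<sigma>)\<in>Js. side j \<sigma> x)"

definition barrier :: "int ^ 'd \<Rightarrow> real" where
  "barrier x = \<phi> (cell R i1 N x) + sides x"

abbreviation "\<delta> \<equiv> 2 * real d * exp (6 * N\<^sup>2 + 10 - N ^ 3 / 4)"

lemma \<eta>_bounds: "0 < \<eta>" "\<eta> \<le> 1"
  using \<kappa> by (simp, intro power_le_one) auto

lemma \<rho>: "0 < 2 / N" "2 / N \<le> 1" "1 \<le> 2 / \<eta>"
  using N \<eta>_bounds by (auto simp: field_simps)

lemma s: "s0 \<le> s2"
  using N by (simp add: add_increasing2 minus_le_iff)

lemma finB: "finite B" using finite_big_box(2)[OF R] N by simp

lemma finI: "finite I" using finB by simp

lemma side_pos: "0 < side j \<sigma> x" by (simp add: side_def)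

lemma sides_nonneg: "0 \<le> sides x"
  using side_pos by (auto simp: sides_def less_imp_le intro!: sum_nonneg)

lemma side_le_sides: "(j, \<sigma>) \<in> Js \<Longrightarrow> side j \<sigma> x \<le> sides x"
proof -
  assume "(j, \<sigma>) \<in> Js"
  then have "(\<lambda>(j, \<sigma>). side j \<sigma> x) (j, \<sigma>) \<le> sides x"
    unfolding sides_def using side_pos by (intro member_le_sum) (auto simp: less_imp_le)
  then show ?thesis by simp
qed

lemmas slab_pot_facts = slab_pot_nonneg[OF \<rho> s finI] slab_pot_antimono[OF \<rho> s finI] slab_pot_ge_1[OF \<rho> s finI]

lemma UB: "x \<in> U \<Longrightarrow> x \<in> B" by (simp add: U_def)

lemma U_tr: "x \<in> U \<Longrightarrow> j \<noteq> i1 \<Longrightarrow> \<sigma> \<in> {-1, 1} \<Longrightarrow> \<sigma> * coord R j x < t j \<sigma> + N ^ 6 / 4"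
  unfolding U_def by blast

lemma U_I:
  assumes "z \<in> B" "\<And>j \<sigma>. j \<noteq> i1 \<Longrightarrow> \<sigma> \<in> {-1, 1} \<Longrightarrow> \<sigma> * coord R j z < t j \<sigma> + N ^ 6 / 4"
  shows "z \<in> U"
  unfolding U_def using assms(1) assms(2)[of _ 1] assms(2)[of _ "-1"] by auto

text \<open>Where the barrier is at least \<open>1\<close> there is nothing to prove. Elsewhere the block of \<open>x\<close> reaches
  neither the back nor the lateral boundary of \<open>U\<close>, and it can leave the large box only through
  the front.\<close>

lemma barrier_less_1:
  assumes x: "x \<in> U" and u: "barrier x < 1"
  shows "s0 < cell R i1 N x" "- (N ^ 3) + N \<le> lev x"
    "cell R i1 N x \<le> s2"
    "\<And>j \<sigma>. j \<noteq> i1 \<Longrightarrow> \<sigma> \<in> {-1, 1} \<Longrightarrow> \<sigma> * coord R j x < t j \<sigma> + N ^ 6 / 4 - 2 * N ^ 3"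
proof -
  have "\<phi> (cell R i1 N x) < 1" using u sides_nonneg[of x] by (simp add: barrier_def)
  then show c: "s0 < cell R i1 N x" using slab_pot_facts(3)[of "cell R i1 N x"] by linarith
  then have "s0 + 1 \<le> \<lfloor>lev x / N\<rfloor>" by (simp add: cell_def)
  then have "real_of_int (s0 + 1) \<le> lev x / N" by (simp add: le_floor_iff)
  then have 2: "(real_of_int s0 + 1) * N \<le> lev x" using N by (simp add: field_simps)
  have "real_of_int \<lfloor>N\<^sup>2\<rfloor> * N \<le> N\<^sup>2 * N" using N by (intro mult_right_mono) auto
  then show "- (N ^ 3) + N \<le> lev x" using 2 by (simp add: algebra_simps power2_eq_square power3_eq_cube)
  have "lev x < N ^ 3 + 2" using UB[OF x] unfolding big_box_iff[OF R] by simp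
  then have "lev x / N < N\<^sup>2 + 1" using N by (simp add: field_simps power2_eq_square power3_eq_cube)
  then have "lev x / N < real_of_int s2 + 1" by linarith
  then show "cell R i1 N x \<le> s2" unfolding cell_def by linarith
  fix j and \<sigma> :: real assume j: "j \<noteq> i1" "\<sigma> \<in> {-1, 1}"
  show "\<sigma> * coord R j x < t j \<sigma> + N ^ 6 / 4 - 2 * N ^ 3"
  proof (rule ccontr)
    assume "\<not> ?thesis"
    then have "- 2 * N ^ 3 \<le> \<sigma> * coord R j x - t j \<sigma> - N ^ 6 / 4" by linarith
    then have "- 2 \<le> (\<sigma> * coord R j x - t j \<sigma> - N ^ 6 / 4) / N ^ 3" using N by (simp add: field_simps)
    moreover have "3 * lev x / N \<le> 3 * (N ^ 3 + 2) / N"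
      using \<open>lev x < N ^ 3 + 2\<close> N by (intro divide_right_mono) auto
    ultimately have "1 \<le> side j \<sigma> x" unfolding side_def by simp
    also have "\<dots> \<le> sides x" using j by (intro side_le_sides) auto
    also have "\<dots> \<le> barrier x" using slab_pot_facts(1) by (simp add: barrier_def)
    finally show False using u by simp
  qed
qed

text \<open>By \<open>block_step\<close> it is enough that the barrier strictly decreases in mean over one block exit. The
  lateral terms are multiplied by \<open>exp (- 2)\<close> with probability at least \<open>1 - 1 / N\<close> and by at most \<open>exp 2\<close>
  otherwise; the potential decreases by \<open>slab_pot_good\<close>.\<close>

lemma good_case:
  assumes x: "x \<in> U" and u: "barrier x < 1" and good: "\<not> bad x"
    and m: "0 \<le> m" "\<And>z. z \<in> U \<Longrightarrow> f z \<le> barrier z + m"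
  shows "f x < barrier x + m"
proof -
  let ?Q = "box2 i1 R N" and ?Q' = "box2_front i1 R l N"
  let ?i = "cell R i1 N x"
  let ?a = "\<phi> (?i + 1) + exp (- 2) * sides x + m" and ?b = "\<phi> (?i - 1) + exp 2 * sides x + m"
  let ?h = "fail_prob (shift x \<omega>) ?Q ?Q' 0"
  note b = barrier_less_1[OF x u]
  have N0: "0 < N" using N by simp
  have N3: "16 * 16 * 16 \<le> N ^ 3"
  proof -
    have "16 ^ 3 \<le> N ^ 3" using N by (intro power_mono) auto
    then show ?thesis by simp
  qed
  have step: "f (y + e) \<le> (if y + e - x \<in> ?Q' then ?a else ?b)"
    "y + e \<in> U \<or> y + e \<in> F"
    if y: "y \<in> B" "y - x \<in> ?Q" "e \<in> dirs" for y e
  proof -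
    have e1: "\<bar>coord R j e\<bar> \<le> 1" for j using abs_coord_dirs[OF R that(3)] .
    have lv: "lev x - N / 11 - 1 \<le> lev (y + e)"
    proof -
      have "- (N / 11) < lev y - lev x" using y(2) unfolding box2_iff[OF R] by simp
      moreover have "lev (y + e) = lev y + lev e" by simp
      ultimately show ?thesis using e1[of i1] by linarith
    qed
    have tr: "\<sigma> * coord R j (y + e) \<le> \<sigma> * coord R j x + 11 * N ^ 3 / 10 + 1" if "j \<noteq> i1" "\<sigma> \<in> {-1, 1}" for j \<sigma>
    proof -
      have "- (N ^ 3 / 10) < coord R j y - coord R j x" "coord R j y - coord R j x < 11 * N ^ 3 / 10"
        using y(2) that unfolding box2_iff[OF R] by auto
      then show ?thesis using e1[of j] that N3 by (auto simp: abs_le_iff)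
    qed
    have trU: "\<sigma> * coord R j (y + e) < t j \<sigma> + N ^ 6 / 4" if "j \<noteq> i1" "\<sigma> \<in> {-1, 1}" for j \<sigma>
      using tr[OF that] b(4)[OF that] N3 by linarith
    have lvB: "- (N ^ 3 - 2) < lev (y + e)"
      using lv b(2) N by simp
    show UF: "y + e \<in> U \<or> y + e \<in> F"
    proof (cases "y + e \<in> B")
      case True
      then show ?thesis using U_I[OF _ trU] by simp
    next
      case False
      have "\<bar>coord R j (y + e)\<bar> < N ^ 7" if "j \<noteq> i1" for j
        using trU[OF that, of 1] trU[OF that, of "-1"] strip_range(2)[of j 1] strip_range(2)[of j "-1"]
        by (auto simp: abs_less_iff)
      then show ?thesis using big_front_I[OF R y(1,3) False lvB] by simp
    qed
    have fz: "f (y + e) \<le> max 0 (barrier (y + e) + m)"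
    proof (cases "y + e \<in> U")
      case True
      then show ?thesis using m(2)[of "y + e"] by simp
    next
      case False
      then have "y + e \<in> F" using UF by simp
      moreover have "y + e \<notin> B" using \<open>y + e \<in> F\<close> by (auto simp: spec_front_def bdry_def)
      ultimately show ?thesis using fail_prob_outside[OF \<omega>, of "y + e" B F] \<kappa> by simp
    qed
    have sidec: "side j \<sigma> (y + e) \<le> exp c * side j \<sigma> x"
      if "- 3 * lev (y + e) / N + \<sigma> * coord R j (y + e) / N ^ 3 \<le> c - 3 * lev x / N + \<sigma> * coord R j x / N ^ 3"
      for j \<sigma> c
      using that unfolding side_def exp_add[symmetric] exp_le_cancel_iff by (simp add: diff_divide_distrib)
    have N1: "1 / N ^ 3 \<le> 1 / 100" using N3 by (intro frac_le) auto
    show "f (y + e) \<le> (if y + e - x \<in> ?Q' then ?a else ?b)"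
    proof (cases "y + e - x \<in> ?Q'")
      case True
      have lf: "lev x + 12 * N / 11 \<le> lev (y + e)" using True unfolding box2_front_iff[OF R] by simp
      have "side j \<sigma> (y + e) \<le> exp (- 2) * side j \<sigma> x" if "j \<noteq> i1" "\<sigma> \<in> {-1, 1}" for j \<sigma>
      proof (rule sidec)
        have "- 3 * lev (y + e) / N \<le> - 3 * (lev x + 12 * N / 11) / N"
          using lf N0 by (intro divide_right_mono) auto
        also have "\<dots> = - 3 * lev x / N - 36 / 11" using N0 by (simp add: field_simps)
        finally have 1: "- 3 * lev (y + e) / N \<le> - 3 * lev x / N - 36 / 11" .
        have "\<sigma> * coord R j (y + e) / N ^ 3 \<le> (\<sigma> * coord R j x + 11 * N ^ 3 / 10 + 1) / N ^ 3"
          using tr[OF that] N0 by (intro divide_right_mono) auto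
        also have "\<dots> = \<sigma> * coord R j x / N ^ 3 + 11 / 10 + 1 / N ^ 3" using N0 by (simp add: field_simps)
        finally show "- 3 * lev (y + e) / N + \<sigma> * coord R j (y + e) / N ^ 3 \<le> - 2 - 3 * lev x / N + \<sigma> * coord R j x / N ^ 3"
          using 1 N1 by simp
      qed
      then have sd: "sides (y + e) \<le> exp (- 2) * sides x"
        unfolding sides_def sum_distrib_left by (intro sum_mono) auto
      have "(lev x + 12 * N / 11) / N \<le> lev (y + e) / N" using lf N0 by (intro divide_right_mono) auto
      then have "lev x / N + 1 \<le> lev (y + e) / N" using N0 by (simp add: add_divide_distrib)
      then have "?i + 1 \<le> cell R i1 N (y + e)" unfolding cell_def by linarith
      then have "barrier (y + e) \<le> \<phi> (?i + 1) + exp (- 2) * sides x"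
        using slab_pot_facts(2)[of "?i + 1" "cell R i1 N (y + e)"] sd unfolding barrier_def by simp
      moreover have "0 \<le> exp (- 2) * sides x" using sides_nonneg by simp
      ultimately have "f (y + e) \<le> ?a" using fz m(1) slab_pot_facts(1)[of "?i + 1"] by linarith
      then show ?thesis using True by simp
    next
      case False
      have "side j \<sigma> (y + e) \<le> exp 2 * side j \<sigma> x" if "j \<noteq> i1" "\<sigma> \<in> {-1, 1}" for j \<sigma>
      proof (rule sidec)
        have "- 3 * lev (y + e) / N \<le> - 3 * (lev x - N / 11 - 1) / N"
          using lv N0 by (intro divide_right_mono) auto
        also have "\<dots> = - 3 * lev x / N + 3 / 11 + 3 / N" using N0 by (simp add: field_simps)
        finally have 1: "- 3 * lev (y + e) / N \<le> - 3 * lev x / N + 3 / 11 + 3 / N" .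
        have "\<sigma> * coord R j (y + e) / N ^ 3 \<le> (\<sigma> * coord R j x + 11 * N ^ 3 / 10 + 1) / N ^ 3"
          using tr[OF that] N0 by (intro divide_right_mono) auto
        also have "\<dots> = \<sigma> * coord R j x / N ^ 3 + 11 / 10 + 1 / N ^ 3" using N0 by (simp add: field_simps)
        moreover have "3 / N \<le> 3 / 16" using N by (simp add: field_simps)
        ultimately show "- 3 * lev (y + e) / N + \<sigma> * coord R j (y + e) / N ^ 3 \<le> 2 - 3 * lev x / N + \<sigma> * coord R j x / N ^ 3"
          using 1 N1 by simp
      qed
      then have sd: "sides (y + e) \<le> exp 2 * sides x"
        unfolding sides_def sum_distrib_left by (intro sum_mono) auto
      have "(lev x - N / 11 - 1) / N \<le> lev (y + e) / N" using lv N0 by (intro divide_right_mono) auto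
      moreover have "(lev x - N / 11 - 1) / N = lev x / N - 1 / 11 - 1 / N"
        using N0 by (simp add: field_simps)
      moreover have "1 / N \<le> 1 / 16" using N by (simp add: field_simps)
      ultimately have "lev x / N - 1 \<le> lev (y + e) / N" by linarith
      then have "?i - 1 \<le> cell R i1 N (y + e)" unfolding cell_def by linarith
      then have "barrier (y + e) \<le> \<phi> (?i - 1) + exp 2 * sides x"
        using slab_pot_facts(2)[of "?i - 1" "cell R i1 N (y + e)"] sd unfolding barrier_def by simp
      moreover have "0 \<le> exp 2 * sides x" using sides_nonneg by simp
      ultimately have "f (y + e) \<le> ?b" using fz m(1) slab_pot_facts(1)[of "?i - 1"] by linarith
      then show ?thesis using False by simp
    qed
  qed
  have ab: "?a \<le> ?b"
    using slab_pot_facts(2)[of "?i - 1" "?i + 1"] sides_nonneg[of x]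
    by (intro add_mono mult_right_mono) auto
  have "f x \<le> ?a + (?b - ?a) * ?h"
  proof (rule block_step[OF \<omega> \<kappa>(1) finB UB[OF x] _ _ _ _ ab])
    show "0 \<in> ?Q" unfolding box2_iff[OF R] using N0 by simp
    fix y e :: "int ^ 'd" assume y: "y \<in> B" "y - x \<in> ?Q" "e \<in> dirs"
    show "y + e \<in> F" if "y + e \<notin> B" using step(2)[OF y] that by (auto simp: U_def)
    show "f (y + e) \<le> ?b" using step(1)[OF y] ab by (auto split: if_splits)
    show "f (y + e) \<le> ?a" if "y + e - x \<in> ?Q'" using step(1)[OF y] that by simp
  next
    show "0 \<le> ?a" using slab_pot_facts(1) sides_nonneg m(1) by simp
  qed
  also have "\<dots> \<le> ?a + (?b - ?a) * (1 / N)"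
    using good ab unfolding block_bad_def by (intro add_left_mono mult_left_mono) auto
  also have "\<dots> = (\<phi> (?i + 1) + (\<phi> (?i - 1) - \<phi> (?i + 1)) / N) + (exp (- 2) + (exp 2 - exp (- 2)) / N) * sides x + m"
    by (simp add: algebra_simps diff_divide_distrib add_divide_distrib)
  also have "\<dots> < \<phi> ?i + 1 * sides x + m"
  proof -
    have "\<phi> (?i + 1) + (\<phi> (?i - 1) - \<phi> (?i + 1)) / N < \<phi> ?i"
      using b(1,3) N by (intro slab_pot_good[OF \<rho> s finI]) auto
    moreover have "exp (- 2) + (exp 2 - exp (- 2)) / N \<le> 1 / 4 + 9 / 16"
    proof (rule add_mono)
      have "(exp 2 - exp (- 2)) / N \<le> exp 2 / N" using N0 by (intro divide_right_mono) auto
      also have "\<dots> \<le> 9 / 16" using N exp_minus_2 by (intro frac_le) auto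
      finally show "(exp 2 - exp (- 2)) / N \<le> 9 / 16" .
    qed (use exp_minus_2 in auto)
    then have "exp (- 2) + (exp 2 - exp (- 2)) / N \<le> 1" by linarith
    then have "(exp (- 2) + (exp 2 - exp (- 2)) / N) * sides x \<le> 1 * sides x"
      using sides_nonneg by (intro mult_right_mono) auto
    ultimately show ?thesis by linarith
  qed
  finally show ?thesis by (simp add: barrier_def)
qed

lemma n1_bounds: "sqrt (real d) * N \<le> real n1" "real n1 + 1 \<le> 2 * N ^ 3 - 1"
proof -
  show "sqrt (real d) * N \<le> real n1" unfolding climb_steps_def by linarith
  have "real n1 \<le> sqrt (real d) * N + 1" using N unfolding climb_steps_def by (simp add: of_nat_ceiling)
  moreover have "sqrt (real d) \<le> N"
    using N by (intro real_le_lsqrt) (auto intro: order_trans[of _ "N * 1"] simp: power2_eq_square mult_left_mono)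
  then have "sqrt (real d) * N \<le> N * N" using N by (intro mult_right_mono) auto
  moreover have "N * N * 1 + 3 \<le> 2 * (N * N * N)"
  proof -
    have "N * N * 1 \<le> N * N * N" using N by (intro mult_left_mono) auto
    moreover have "16 * 16 * 16 \<le> N * N * N" using N by (intro mult_mono) auto
    ultimately show ?thesis by linarith
  qed
  ultimately show "real n1 + 1 \<le> 2 * N ^ 3 - 1" by (simp add: power3_eq_cube)
qed

lemma sides_small:
  assumes lv: "- (N ^ 3) \<le> lev z"
    and tr: "\<And>j \<sigma>. j \<noteq> i1 \<Longrightarrow> \<sigma> \<in> {-1, 1} \<Longrightarrow> \<sigma> * coord R j z \<le> t j \<sigma> + 2 * N ^ 3"
  shows "sides z \<le> \<delta>"
proof -
  have N0: "0 < N" using N by simp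
  have "side j \<sigma> z \<le> exp (6 * N\<^sup>2 + 10 - N ^ 3 / 4)" if "j \<noteq> i1" "\<sigma> \<in> {-1, 1}" for j \<sigma>
  proof -
    have "- 3 * lev z / N \<le> 3 * N ^ 3 / N" using lv N0 by (intro divide_right_mono) auto
    also have "\<dots> = 3 * N\<^sup>2" using N0 by (simp add: power2_eq_square power3_eq_cube)
    finally have 1: "- 3 * lev z / N \<le> 3 * N\<^sup>2" .
    have "(\<sigma> * coord R j z - t j \<sigma> - N ^ 6 / 4) / N ^ 3 \<le> (2 * N ^ 3 - N ^ 6 / 4) / N ^ 3"
      using tr[OF that] N0 by (intro divide_right_mono) auto
    also have "\<dots> = 2 - N ^ 3 / 4" using N0 by (simp add: field_simps)
    finally have 2: "(\<sigma> * coord R j z - t j \<sigma> - N ^ 6 / 4) / N ^ 3 \<le> 2 - N ^ 3 / 4" .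
    have "3 * (N ^ 3 + 2) / N = 3 * N\<^sup>2 + 6 / N" using N0 by (simp add: field_simps power2_eq_square power3_eq_cube)
    moreover have "6 / N \<le> 1" using N by (simp add: field_simps)
    ultimately show ?thesis using 1 2 unfolding side_def exp_le_cancel_iff by linarith
  qed
  then have "sides z \<le> (\<Sum>(j, \<sigma>)\<in>Js. exp (6 * N\<^sup>2 + 10 - N ^ 3 / 4))"
    unfolding sides_def by (intro sum_mono) auto
  also have "\<dots> = real (2 * (d - 1)) * exp (6 * N\<^sup>2 + 10 - N ^ 3 / 4)"
    by (simp add: card_cartesian_product split_def card_Diff_singleton)
  also have "\<dots> \<le> \<delta>" by (intro mult_right_mono) auto
  finally show ?thesis .
qed

text \<open>A bad site of \<open>U\<close> lies inside the inner ends of all free strips. There the lateral terms are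
  at most \<open>\<delta>\<close>, even after the upward push, and the gap in \<open>slab_pot_bad\<close> absorbs them.\<close>

lemma bad_case:
  assumes x: "x \<in> U" and u: "barrier x < 1" and bd: "bad x"
    and m: "0 \<le> m" "\<And>z. z \<in> U \<Longrightarrow> f z \<le> barrier z + m"
  shows "f x < barrier x + m"
proof -
  let ?i = "cell R i1 N x"
  note b = barrier_less_1[OF x u]
  have N0: "0 < N" using N by simp
  have iI: "?i \<in> I" using UB[OF x] bd by auto
  have inner: "\<sigma> * coord R j x < t j \<sigma>" if "j \<noteq> i1" "\<sigma> \<in> {-1, 1}" for j \<sigma>
    using strip_good[OF that UB[OF x] bd] U_tr[OF x that] by linarith
  obtain e0 where e0: "e0 \<in> dirs" "1 / sqrt d \<le> lev e0" using up_direction[OF R] unfolding dim by blast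
  have e0nn: "0 \<le> lev e0" using e0(2) by (rule order_trans[rotated]) simp
  define y where "y j = x + int j *s e0" for j :: nat
  \<comment> \<open>the climb is stopped early if it leaves the large box, which it can do only through the front\<close>
  define k where "k = (LEAST j. j = n1 \<or> y j \<notin> B)"
  have kP: "k = n1 \<or> y k \<notin> B" unfolding k_def by (rule LeastI[of _ n1]) simp
  have k_le: "k \<le> n1" unfolding k_def by (rule Least_le) simp
  have k_lt: "y j \<in> B" if "j < k" for j using not_less_Least[of j] that unfolding k_def by blast
  have lev_y: "lev (y j) = lev x + real j * lev e0" for j by (simp add: y_def)
  have N3: "N \<le> N ^ 3" using N by (intro self_le_power) auto
  have near: "y j + e \<in> U \<and> barrier (y j + e) \<le> \<phi> (?i - 1) + \<delta> \<or> y j + e \<in> F"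
    if j: "j < k" and e: "e \<in> dirs" for j e
  proof -
    have e1: "\<bar>coord R j' e\<bar> \<le> 1" for j' using abs_coord_dirs[OF R e] .
    have lv: "lev x - 1 \<le> lev (y j + e)"
      using e1[of i1] mult_nonneg_nonneg[OF of_nat_0_le_iff e0nn, of j] lev_y[of j] by (simp add: abs_le_iff)
    have tr: "\<sigma> * coord R j' (y j + e) \<le> t j' \<sigma> + 2 * N ^ 3" if "j' \<noteq> i1" "\<sigma> \<in> {-1, 1}" for j' \<sigma>
    proof -
      have "\<bar>real j * coord R j' e0\<bar> \<le> real n1 * 1"
        unfolding abs_mult using abs_coord_dirs[OF R e0(1), of j'] j k_le by (intro mult_mono) auto
      then have "\<bar>coord R j' (y j + e) - coord R j' x\<bar> \<le> real n1 + 1"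
        using e1[of j'] by (simp add: y_def)
      then show ?thesis using inner[OF that] n1_bounds(2) that(2) by (auto simp: abs_le_iff)
    qed
    have N6: "2 * N ^ 3 < N ^ 6 / 4"
    proof -
      have "16 * 1 \<le> N * N ^ 2" using N by (intro mult_mono) auto
      then have "16 * N ^ 3 \<le> N ^ 3 * N ^ 3" using N0 by (intro mult_right_mono) (auto simp: power3_eq_cube power2_eq_square)
      moreover have "0 < N ^ 3" using N0 by simp
      moreover have "N ^ 3 * N ^ 3 = N ^ 6" by (simp flip: power_add)
      ultimately show ?thesis by linarith
    qed
    have lvB: "- (N ^ 3 - 2) < lev (y j + e)" using lv b(2) N by simp
    have trU: "\<sigma> * coord R j' (y j + e) < t j' \<sigma> + N ^ 6 / 4" if "j' \<noteq> i1" "\<sigma> \<in> {-1, 1}" for j' \<sigma>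
      using tr[OF that] N6 by linarith
    show ?thesis
    proof (cases "y j + e \<in> B")
      case True
      then have "y j + e \<in> U" using trU by (rule U_I)
      moreover have "barrier (y j + e) \<le> \<phi> (?i - 1) + \<delta>"
      proof -
        have "(lev x - 1) / N \<le> lev (y j + e) / N" using lv N0 by (intro divide_right_mono) auto
        moreover have "1 / N \<le> 1" using N by (simp add: field_simps)
        ultimately have "lev x / N - 1 \<le> lev (y j + e) / N" by (simp add: diff_divide_distrib)
        then have "?i - 1 \<le> cell R i1 N (y j + e)" unfolding cell_def by linarith
        then show ?thesis
          unfolding barrier_def using lvB tr by (intro add_mono slab_pot_facts(2) sides_small) auto
      qed
      ultimately show ?thesis by simp
    next
      case False
      have "\<bar>coord R j' (y j + e)\<bar> < N ^ 7" if "j' \<noteq> i1" for j'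
        using trU[OF that, of 1] trU[OF that, of "-1"] strip_range(2)[of j' 1] strip_range(2)[of j' "-1"]
        by (auto simp: abs_less_iff)
      then show ?thesis using big_front_I[OF R k_lt[OF j] e False lvB] by simp
    qed
  qed
  have fF: "f z = 0" if "z \<in> F" for z
  proof -
    have "z \<notin> B" using that by (auto simp: spec_front_def bdry_def)
    then show ?thesis using fail_prob_outside[OF \<omega>, of z B F] that \<kappa> by simp
  qed
  have \<delta>0: "0 \<le> \<delta>" by simp
  let ?a = "\<phi> (?i + 1) + \<delta> + m" and ?b = "\<phi> (?i - 1) + \<delta> + m"
  have nn: "0 \<le> ?a" "0 \<le> ?b" using slab_pot_facts(1)[of "?i + 1"] slab_pot_facts(1)[of "?i - 1"] \<delta>0 m(1) by auto
  have ab: "?a \<le> ?b" using slab_pot_facts(2)[of "?i - 1" "?i + 1"] by simp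
  have "f x \<le> ?b - (2 * \<kappa>) ^ k * (?b - ?a)"
  proof (rule push_bound[OF \<omega> \<kappa>(1) e0(1) ab, of k f x])
    fix j assume "j < k"
    then show "f (x + int j *s e0) \<le> (\<Sum>e\<in>dirs. \<omega> (x + int j *s e0) e * f (x + int j *s e0 + e))"
      using fail_prob_inside[OF \<omega>, of "y j" B F] k_lt \<kappa> by (simp add: y_def)
  next
    fix j e assume "j < k" "e \<in> (dirs :: (int ^ 'd) set)"
    from near[OF this] show "f (x + int j *s e0 + e) \<le> ?b"
      using m(2)[of "y j + e"] fF[of "y j + e"] nn(2) by (auto simp: y_def)
  next
    show "f (x + int k *s e0) \<le> ?a"
    proof (cases k)
      case 0
      have "0 < d" using zero_less_card_finite[where 'a='d] by simp
      then have "0 < sqrt (real d) * N" using N by simp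
      then have "0 < n1" using n1_bounds(1) by linarith
      then have "y 0 \<notin> B" using kP 0 by simp
      then show ?thesis using UB[OF x] by (simp add: y_def)
    next
      case (Suc k')
      have yk: "y k = y k' + e0" unfolding y_def Suc by (simp add: vec_eq_iff algebra_simps)
      show ?thesis
      proof (cases "y k \<in> F")
        case True
        then show ?thesis using fF nn(1) by (simp add: y_def)
      next
        case False
        then have yU: "y k \<in> U" using near[of k' e0] Suc e0(1) yk by auto
        then have kn: "k = n1" using kP UB by blast
        have "1 / sqrt (real d) * (sqrt (real d) * N) \<le> lev e0 * real n1"
          using e0(2) n1_bounds(1) N0 e0nn by (intro mult_mono) auto
        moreover have "0 < d" using zero_less_card_finite[where 'a='d] by simp
        ultimately have "lev x + N \<le> lev (y k)" unfolding lev_y kn by (simp add: mult.commute)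
        then have "(lev x + N) / N \<le> lev (y k) / N" using N0 by (intro divide_right_mono) auto
        then have "lev x / N + 1 \<le> lev (y k) / N" using N0 by (simp add: add_divide_distrib)
        then have c: "?i + 1 \<le> cell R i1 N (y k)" unfolding cell_def by linarith
        have "sides (y k) \<le> \<delta>"
        proof (rule sides_small)
          show "- (N ^ 3) \<le> lev (y k)" using UB[OF yU] unfolding big_box_iff[OF R] by simp
          fix j' and \<sigma> :: real assume j': "j' \<noteq> i1" "\<sigma> \<in> {-1, 1}"
          have "\<bar>real k * coord R j' e0\<bar> \<le> real n1 * 1"
            unfolding abs_mult using abs_coord_dirs[OF R e0(1), of j'] k_le by (intro mult_mono) auto
          then have "\<bar>coord R j' (y k) - coord R j' x\<bar> \<le> real n1" by (simp add: y_def)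
          then show "\<sigma> * coord R j' (y k) \<le> t j' \<sigma> + 2 * N ^ 3"
            using inner[OF j'] n1_bounds(2) j'(2) by (auto simp: abs_le_iff)
        qed
        then have "barrier (y k) \<le> \<phi> (?i + 1) + \<delta>"
          unfolding barrier_def using slab_pot_facts(2)[OF c] by simp
        then show ?thesis using m(2)[OF yU] by (simp add: y_def)
      qed
    qed
  qed
  also have "\<dots> \<le> ?b - \<eta> * (?b - ?a)"
    using ab \<kappa> k_le by (intro diff_left_mono mult_right_mono power_decreasing) auto
  also have "\<dots> = \<phi> (?i - 1) + \<delta> - \<eta> * (\<phi> (?i - 1) - \<phi> (?i + 1)) + m" by (simp add: algebra_simps)
  also have "\<dots> < \<phi> ?i + m"
  proof -
    have "\<delta> \<le> (2 / N) ^ nat (2 * \<lfloor>N\<^sup>2\<rfloor> + 2)" by (rule margin)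
    also have "\<dots> \<le> (2 / N) ^ nat (?i - 1 - s0)"
      using b(3) \<rho> by (intro power_decreasing) auto
    also have "\<dots> \<le> slab_drop I s0 (2 / N) (2 / \<eta>) (?i - 1)"
      by (rule slab_drop_lower[OF \<rho> s finI])
    finally show ?thesis
      using slab_pot_bad[OF \<rho> s finI b(1,3) iI \<eta>_bounds(1)] by simp
  qed
  also have "\<dots> \<le> barrier x + m" using sides_nonneg by (simp add: barrier_def)
  finally show ?thesis .
qed

text \<open>A positive maximum of \<open>f - barrier\<close> over \<open>U\<close> contradicts the strict inequality of \<open>good_case\<close> or
  \<open>bad_case\<close> at the point where it is attained.\<close>

lemma fail_le_barrier:
  assumes "x \<in> U"
  shows "f x \<le> barrier x"
proof (rule ccontr)
  assume neg: "\<not> ?thesis"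
  define m where "m = Max ((\<lambda>z. f z - barrier z) ` U)"
  have finU: "finite U" using finB by (rule rev_finite_subset) (auto simp: U_def)
  have "m \<in> (\<lambda>z. f z - barrier z) ` U" unfolding m_def using finU assms by (intro Max_in) auto
  then obtain z where z: "z \<in> U" "m = f z - barrier z" by auto
  have le: "f y - barrier y \<le> m" if "y \<in> U" for y unfolding m_def using finU that by simp
  have m: "0 < m" using le[OF assms] neg by linarith
  have u: "barrier z < 1" using m z(2) fail_prob_le_1[of \<omega> B F z] by linarith
  have le': "f y \<le> barrier y + m" if "y \<in> U" for y using le[OF that] by linarith
  have "f z < barrier z + m"
    using good_case[OF z(1) u _ _ le'] bad_case[OF z(1) u _ _ le'] m by (cases "bad z") auto
  then show False using z(2) by simp
qed

text \<open>Between slab \<open>s0\<close> and the origin there are \<open>\<lfloor>N\<^sup>2\<rfloor>\<close> slabs, at most \<open>M\<close> of them with bad sites.\<close>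

lemma fail_prob_origin:
  "f 0 \<le> (real_of_int \<lfloor>N\<^sup>2\<rfloor> + 3) * ((2 / N) ^ (nat \<lfloor>N\<^sup>2\<rfloor> - M) * (2 / \<eta>) ^ M) + \<delta>"
proof -
  have N0: "0 < N" using N by simp
  have "16 ^ 3 \<le> N ^ 3" using N by (intro power_mono) auto
  then have "0 \<in> U" using strip_range(1) N0 by (auto simp: U_def big_box_iff[OF R] add_nonneg_pos)
  then have "f 0 \<le> barrier 0" by (rule fail_le_barrier)
  also have "\<dots> \<le> (real_of_int s2 + 1) * ((2 / N) ^ (nat \<lfloor>N\<^sup>2\<rfloor> - M) * (2 / \<eta>) ^ M) + \<delta>"
    unfolding barrier_def
  proof (rule add_mono)
    have "cell R i1 N 0 = 0" by (simp add: cell_def)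
    then show "\<phi> (cell R i1 N 0) \<le> (real_of_int s2 + 1) * ((2 / N) ^ (nat \<lfloor>N\<^sup>2\<rfloor> - M) * (2 / \<eta>) ^ M)"
      using slab_pot_upper[OF \<rho> s finI _ few_slabs, of "nat \<lfloor>N\<^sup>2\<rfloor>"] by (simp del: power_mult_distrib)
    show "sides 0 \<le> \<delta>" using strip_range(1) N0 by (intro sides_small) (auto intro: add_nonneg_nonneg)
  qed
  finally show ?thesis by (simp add: add.commute)
qed

end

section \<open>Separated bad sites\<close>

text \<open>A block has extent less than \<open>3 N / 2\<close> in the direction \<open>\<ell>\<close> and \<open>6 N ^ 3 / 5\<close> laterally, so the blocks of
  separated sites are at distance at least \<open>N\<close> (\<open>separated_blocks_far\<close>).\<close>

definition separated :: "'d \<Rightarrow> real ^ 'd ^ 'd \<Rightarrow> real \<Rightarrow> int ^ 'd::finite \<Rightarrow> int ^ 'd \<Rightarrow> bool" where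
  "separated i1 R N x y \<longleftrightarrow> 3 * N \<le> \<bar>coord R i1 x - coord R i1 y\<bar> \<or>
     (\<exists>j. j \<noteq> i1 \<and> 3 * N ^ 3 \<le> \<bar>coord R j x - coord R j y\<bar>)"

definition separated_sets :: "'d \<Rightarrow> real ^ 'd ^ 'd \<Rightarrow> real \<Rightarrow> nat \<Rightarrow> (int ^ 'd::finite) set set" where
  "separated_sets i1 R N K = {S. S \<subseteq> big_box i1 R N \<and> card S = K \<and> pairwise (separated i1 R N) S}"

text \<open>The rare event, outside of which the quenched failure probability is controlled.\<close>

definition rich :: "'d \<Rightarrow> real ^ 'd ^ 'd \<Rightarrow> real ^ 'd \<Rightarrow> real \<Rightarrow> nat \<Rightarrow> 'd::finite env \<Rightarrow> bool" where
  "rich i1 R l N K \<omega> \<longleftrightarrow> (\<exists>S\<in>separated_sets i1 R N K. \<forall>x\<in>S. block_bad i1 R l N \<omega> x)"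

lemma separated_sym: "separated i1 R N x y \<longleftrightarrow> separated i1 R N y x"
  by (simp add: separated_def abs_minus_commute)

text \<open>Sites in distinct slabs whose indices agree modulo \<open>4\<close> differ by more than \<open>3 N\<close> in level. One bad site from
  each bad slab of a residue class therefore gives a separated set.\<close>

lemma few_bad_slabs:
  fixes R :: "real ^ 'd::finite ^ 'd"
  assumes R: "rotation_to i1 R l" and N: "1 \<le> N" and nr: "\<not> rich i1 R l N K \<omega>"
  shows "card (cell R i1 N ` {x \<in> big_box i1 R N. block_bad i1 R l N \<omega> x}) \<le> 4 * K"
proof -
  let ?A = "{x \<in> big_box i1 R N. block_bad i1 R l N \<omega> x}"
  let ?I = "cell R i1 N ` ?A"
  have fin: "finite ?I" using finite_big_box(2)[OF R N] by simp
  have c: "card {i \<in> ?I. i mod 4 = c} \<le> K" for c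
  proof (rule ccontr)
    assume "\<not> ?thesis"
    then have "K \<le> card {i \<in> ?I. i mod 4 = c}" by simp
    then obtain T where T: "T \<subseteq> {i \<in> ?I. i mod 4 = c}" "card T = K"
      by (rule obtain_subset_with_card_n)
    define g where "g = inv_into ?A (cell R i1 N)"
    have g: "g i \<in> ?A" "cell R i1 N (g i) = i" if "i \<in> T" for i
    proof -
      have "i \<in> ?I" using that T(1) by blast
      then show "g i \<in> ?A" "cell R i1 N (g i) = i"
        unfolding g_def by (rule inv_into_into, rule f_inv_into_f)
    qed
    have inj: "inj_on g T" using g(2) by (metis inj_onI)
    have "pairwise (separated i1 R N) (g ` T)"
    proof (rule pairwiseI)
      have *: "separated i1 R N (g i) (g i')" if "i \<in> T" "i' \<in> T" "i < i'" for i i'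
      proof -
        have "i mod 4 = i' mod 4" using that T by auto
        then have "4 dvd i' - i" by (metis mod_eq_dvd_iff)
        then have "4 \<le> i' - i" using that by (simp add: zdvd_imp_le)
        moreover have "real_of_int i' \<le> coord R i1 (g i') / N" "coord R i1 (g i) / N < real_of_int i + 1"
          using g(2)[OF that(1)] g(2)[OF that(2)] unfolding cell_def by linarith+
        ultimately have "3 \<le> coord R i1 (g i') / N - coord R i1 (g i) / N" by linarith
        then have "3 * N \<le> coord R i1 (g i') - coord R i1 (g i)" using N by (simp add: field_simps)
        then show ?thesis unfolding separated_def by (intro disjI1) linarith
      qed
      fix x y assume "x \<in> g ` T" "y \<in> g ` T" "x \<noteq> y"
      then obtain i i' where "i \<in> T" "i' \<in> T" "x = g i" "y = g i'" "i \<noteq> i'" by blast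
      then show "separated i1 R N x y"
        using *[of i i'] *[of i' i] separated_sym by (metis linorder_neqE)
    qed
    moreover have "g ` T \<subseteq> big_box i1 R N" "card (g ` T) = K"
      using g(1) T(2) card_image[OF inj] by auto
    ultimately have "g ` T \<in> separated_sets i1 R N K" by (simp add: separated_sets_def)
    moreover have "\<forall>x\<in>g ` T. block_bad i1 R l N \<omega> x" using g(1) by auto
    ultimately show False using nr unfolding rich_def by blast
  qed
  \<comment> \<open>the four residue classes contribute at most K bad slabs each\<close>
  have "?I = (\<Union>c\<in>{0..<4}. {i \<in> ?I. i mod 4 = c})" by auto
  then have "card ?I \<le> (\<Sum>c\<in>{0..<4::int}. card {i \<in> ?I. i mod 4 = c})"
    using card_UN_le[of "{0..<4::int}" "\<lambda>c. {i \<in> ?I. i mod 4 = c}"] by simp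
  also have "\<dots> \<le> (\<Sum>c\<in>{0..<4::int}. K)" using c by (rule sum_mono)
  finally show ?thesis by simp
qed

text \<open>Consider \<open>K\<close> parallel strips with gaps of their own width between them. If each contained a bad site, these
  \<open>K\<close> sites would be separated.\<close>

lemma free_strip:
  fixes R :: "real ^ 'd::finite ^ 'd" and \<sigma> :: real
  assumes R: "rotation_to i1 R l" and N: "16 \<le> N" and K: "0 < K" "real K \<le> N + 1"
    and nr: "\<not> rich i1 R l N K \<omega>" and j: "j \<noteq> i1" and \<sigma>: "\<sigma> \<in> {-1, 1}"
  shows "\<exists>t. 0 \<le> t \<and> t + N ^ 6 / 4 \<le> N ^ 7 \<and> (\<forall>x. x \<in> big_box i1 R N \<longrightarrow> block_bad i1 R l N \<omega> x \<longrightarrow>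
        t \<le> \<sigma> * coord R j x \<longrightarrow> t + N ^ 6 / 4 \<le> \<sigma> * coord R j x)"
proof (rule ccontr)
  assume neg: "\<not> ?thesis"
  define W where "W = N ^ 6 / 4"
  have W: "3 * N ^ 3 \<le> W" "0 < W"
  proof -
    have "16 * 1 \<le> N * N ^ 2" using N by (intro mult_mono) auto
    then have "16 * N ^ 3 \<le> N ^ 3 * N ^ 3" using N by (intro mult_right_mono) (auto simp: power3_eq_cube power2_eq_square)
    moreover have "0 \<le> N ^ 3" using N by simp
    moreover have "N ^ 3 * N ^ 3 = N ^ 6" by (simp flip: power_add)
    ultimately show "3 * N ^ 3 \<le> W" unfolding W_def by linarith
    show "0 < W" using N by (simp add: W_def)
  qed
  \<comment> \<open>the strip with index k starts at 2 k W, so that consecutive strips leave a gap W\<close>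
  have "\<exists>x. x \<in> big_box i1 R N \<and> block_bad i1 R l N \<omega> x \<and>
      2 * real k * W \<le> \<sigma> * coord R j x \<and> \<sigma> * coord R j x < 2 * real k * W + W" if k: "k < K" for k
  proof -
    have "2 * real k * W + W = (2 * real k + 1) * W" by (simp add: algebra_simps)
    also have "\<dots> \<le> (4 * N) * W" using k K(2) N W(2) by (intro mult_right_mono) auto
    also have "\<dots> = N ^ 7" by (simp add: W_def power_numeral_reduce)
    finally have "2 * real k * W + W \<le> N ^ 7" .
    moreover have "0 \<le> 2 * real k * W" using W(2) by simp
    ultimately have "\<not> (\<forall>x. x \<in> big_box i1 R N \<longrightarrow> block_bad i1 R l N \<omega> x \<longrightarrow>
        2 * real k * W \<le> \<sigma> * coord R j x \<longrightarrow> 2 * real k * W + W \<le> \<sigma> * coord R j x)"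
      using neg unfolding W_def[symmetric] by blast
    then show ?thesis by (simp add: not_le)
  qed
  then obtain g where g: "\<And>k. k < K \<Longrightarrow> g k \<in> big_box i1 R N \<and> block_bad i1 R l N \<omega> (g k) \<and>
      2 * real k * W \<le> \<sigma> * coord R j (g k) \<and> \<sigma> * coord R j (g k) < 2 * real k * W + W" by metis
  have *: "3 * N ^ 3 \<le> \<bar>coord R j (g k) - coord R j (g k')\<bar>" if "k < k'" "k' < K" for k k'
  proof -
    have "1 * W \<le> (2 * (real k' - real k) - 1) * W" using that W(2) by (intro mult_right_mono) auto
    then have "W \<le> 2 * real k' * W - (2 * real k * W + W)" by (simp add: algebra_simps)
    then have "W \<le> \<sigma> * coord R j (g k') - \<sigma> * coord R j (g k)" using g[of k] g[of k'] that by linarith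
    also have "\<dots> \<le> \<bar>coord R j (g k) - coord R j (g k')\<bar>" using \<sigma> by auto
    finally show ?thesis using W(1) by linarith
  qed
  have pos: "0 < 3 * N ^ 3" using N by simp
  have inj: "inj_on g {..<K}"
  proof (rule inj_onI)
    fix k k' assume k: "k \<in> {..<K}" "k' \<in> {..<K}" "g k = g k'"
    show "k = k'"
    proof (rule ccontr)
      assume "k \<noteq> k'"
      then show False using *[of k k'] *[of k' k] k pos by (cases "k < k'") auto
    qed
  qed
  have "pairwise (separated i1 R N) (g ` {..<K})"
  proof (rule pairwiseI)
    fix x y assume "x \<in> g ` {..<K}" "y \<in> g ` {..<K}" "x \<noteq> y"
    then obtain k k' where k: "k < K" "k' < K" "x = g k" "y = g k'" "k \<noteq> k'" by blast
    then have "3 * N ^ 3 \<le> \<bar>coord R j x - coord R j y\<bar>"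
      using *[of k k'] *[of k' k] by (cases "k < k'") (auto simp: abs_minus_commute)
    then show "separated i1 R N x y" using j unfolding separated_def by blast
  qed
  moreover have "g ` {..<K} \<subseteq> big_box i1 R N" "card (g ` {..<K}) = K"
    using g card_image[OF inj] by auto
  ultimately have "g ` {..<K} \<in> separated_sets i1 R N K" by (simp add: separated_sets_def)
  moreover have "\<forall>x\<in>g ` {..<K}. block_bad i1 R l N \<omega> x" using g by auto
  ultimately show False using nr unfolding rich_def by blast
qed

lemma q_box_bound:
  fixes \<omega> :: "'d::finite env"
  assumes \<omega>: "elliptic \<kappa> \<omega>" and \<kappa>: "0 < \<kappa>" "2 * \<kappa> \<le> 1" and R: "rotation_to i1 R l"
    and N: "16 \<le> N" "real CARD('d) \<le> N" and K: "0 < K" "real K \<le> N + 1"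
    and nr: "\<not> rich i1 R l N K \<omega>"
    and margin: "2 * real CARD('d) * exp (6 * N\<^sup>2 + 10 - N ^ 3 / 4) \<le> (2 / N) ^ nat (2 * \<lfloor>N\<^sup>2\<rfloor> + 2)"
  shows "q_box \<omega> i1 l R (N ^ 3 - 2) (N ^ 3 + 2) (N ^ 7) \<le>
    (real_of_int \<lfloor>N\<^sup>2\<rfloor> + 3) * ((2 / N) ^ (nat \<lfloor>N\<^sup>2\<rfloor> - 4 * K) * (2 / (2 * \<kappa>) ^ climb_steps CARD('d) N) ^ (4 * K))
      + 2 * real CARD('d) * exp (6 * N\<^sup>2 + 10 - N ^ 3 / 4)"
proof -
  define P where "P j \<sigma> t \<longleftrightarrow> 0 \<le> t \<and> t + N ^ 6 / 4 \<le> N ^ 7 \<and>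
     (j \<noteq> i1 \<longrightarrow> \<sigma> \<in> {-1, 1} \<longrightarrow> (\<forall>x. x \<in> big_box i1 R N \<longrightarrow> block_bad i1 R l N \<omega> x \<longrightarrow>
        t \<le> \<sigma> * coord R j x \<longrightarrow> t + N ^ 6 / 4 \<le> \<sigma> * coord R j x))" for j and \<sigma> t :: real
  have "\<exists>t. P j \<sigma> t" for j \<sigma>
  proof (cases "j \<noteq> i1 \<and> \<sigma> \<in> {-1, 1}")
    case True
    then show ?thesis using free_strip[OF R N(1) K nr, of j \<sigma>] unfolding P_def by blast
  next
    case False
    have "N ^ 6 \<le> N ^ 7" "0 \<le> N ^ 6" using N by (auto intro: power_increasing)
    then have "N ^ 6 / 4 \<le> N ^ 7" by linarith
    then show ?thesis using False by (intro exI[of _ 0]) (auto simp: P_def)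
  qed
  then obtain t where t: "\<And>j \<sigma>. P j \<sigma> (t j \<sigma>)" by metis
  have ls: "large_scale CARD('d) \<omega> \<kappa> N i1 R l t (4 * K)"
  proof
    show "card (cell R i1 N ` {x \<in> big_box i1 R N. block_bad i1 R l N \<omega> x}) \<le> 4 * K"
      using few_bad_slabs[OF R _ nr] N by simp
    show "0 \<le> t j \<sigma>" "t j \<sigma> + N ^ 6 / 4 \<le> N ^ 7" for j \<sigma>
      using t[of j \<sigma>] unfolding P_def by blast+
    show "t j \<sigma> + N ^ 6 / 4 \<le> \<sigma> * coord R j x"
      if "j \<noteq> i1" "\<sigma> \<in> {-1, 1}" "x \<in> big_box i1 R N" "block_bad i1 R l N \<omega> x" "t j \<sigma> \<le> \<sigma> * coord R j x" for j \<sigma> x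
      using t[of j \<sigma>] that unfolding P_def by blast
  qed (fact \<omega> \<kappa> R N margin refl)+
  have "q_box \<omega> i1 l R (N ^ 3 - 2) (N ^ 3 + 2) (N ^ 7) = fail_prob \<omega> (big_box i1 R N) (big_front i1 R l N) 0"
    by (simp only: q_box_def fail_prob_def)
  then show ?thesis
    using large_scale.fail_prob_origin[OF ls] by (simp only:)
qed

section \<open>Lower bound for the probability of a frontal exit\<close>

text \<open>The straight path from the origin in the direction of \<open>up_direction\<close> leaves the box through
  its front, as it is much shorter than the lateral width.\<close>

lemma p_box_lower:
  fixes \<omega> :: "'d::finite env"
  assumes \<omega>: "elliptic \<kappa> \<omega>" and \<kappa>: "0 < \<kappa>" "2 * \<kappa> \<le> 1" and R: "rotation_to i1 R l"
    and N: "16 \<le> N" "real CARD('d) \<le> N"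
  shows "(2 * \<kappa>) ^ climb_steps CARD('d) (N ^ 3 + 2) \<le> p_box \<omega> i1 l R (N ^ 3 - 2) (N ^ 3 + 2) (N ^ 7)"
proof -
  let ?B = "big_box i1 R N" and ?F = "big_front i1 R l N" and ?n = "climb_steps CARD('d) (N ^ 3 + 2)"
  have n: "sqrt (real CARD('d)) * (N ^ 3 + 2) \<le> real ?n" "real ?n < N ^ 7"
  proof -
    show "sqrt (real CARD('d)) * (N ^ 3 + 2) \<le> real ?n" unfolding climb_steps_def by linarith
    have N0: "0 \<le> sqrt (real CARD('d)) * (N ^ 3 + 2)" using N by simp
    have "real ?n \<le> sqrt (real CARD('d)) * (N ^ 3 + 2) + 1"
      unfolding climb_steps_def using N0 by linarith
    moreover have "sqrt (real CARD('d)) \<le> N"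
      using N by (intro real_le_lsqrt) (auto intro: order_trans[of _ "N * 1"] simp: power2_eq_square mult_left_mono)
    then have "sqrt (real CARD('d)) * (N ^ 3 + 2) \<le> N * (N ^ 3 + 2)" using N by (intro mult_right_mono) auto
    moreover have "N * (N ^ 3 + 2) + 1 < N ^ 7"
    proof -
      have 1: "1 \<le> N ^ 4" "N \<le> N ^ 4" using N by (auto intro: self_le_power)
      have "16 ^ 3 * N ^ 4 \<le> N ^ 3 * N ^ 4" using N by (intro mult_right_mono power_mono) auto
      moreover have "N ^ 3 * N ^ 4 = N ^ 7" by (simp flip: power_add)
      moreover have "N * (N ^ 3 + 2) = N ^ 4 + 2 * N" by (simp add: algebra_simps power_numeral_reduce)
      ultimately show ?thesis using 1 by simp
    qed
    ultimately show "real ?n < N ^ 7" by linarith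
  qed
  obtain e0 where e0: "e0 \<in> dirs" "1 / sqrt CARD('d) \<le> coord R i1 e0" using up_direction[OF R] by blast
  have e0nn: "0 \<le> coord R i1 e0" using e0(2) by (rule order_trans[rotated]) simp
  define y where "y j = int j *s e0" for j :: nat
  have "y ?n \<notin> ?B"
  proof -
    have "N ^ 3 + 2 = 1 / sqrt (real CARD('d)) * (sqrt (real CARD('d)) * (N ^ 3 + 2))" by simp
    also have "\<dots> \<le> coord R i1 e0 * real ?n"
      using e0(2) n(1) N e0nn by (intro mult_mono) auto
    finally show ?thesis unfolding big_box_iff[OF R] by (simp add: y_def mult.commute)
  qed
  define k where "k = (LEAST j. y j \<notin> ?B)"
  have yk: "y k \<notin> ?B" unfolding k_def by (rule LeastI[of _ ?n]) fact
  have k_le: "k \<le> ?n" unfolding k_def by (rule Least_le) fact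
  have k_lt: "y j \<in> ?B" if "j < k" for j using not_less_Least[of j] that unfolding k_def by blast
  have "16 ^ 3 \<le> N ^ 3" using N by (intro power_mono) auto
  then have N3: "4096 \<le> N ^ 3" by simp
  moreover have "0 < N ^ 7" using N by simp
  ultimately have "y 0 \<in> ?B" by (simp add: y_def big_box_iff[OF R])
  then obtain k' where k': "k = Suc k'" using yk by (cases k) auto
  have step: "y k = y k' + e0" by (simp add: y_def k' vec_eq_iff algebra_simps)
  have "y k' + e0 \<in> ?F"
  proof (rule big_front_I[OF R k_lt e0(1)])
    show "y k' + e0 \<notin> ?B" using yk step by simp
    have "0 \<le> coord R i1 (y k)" using e0nn by (simp add: y_def)
    then show "- (N ^ 3 - 2) < coord R i1 (y k' + e0)" using N3 unfolding step by linarith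
    fix j assume "j \<noteq> i1"
    have "\<bar>coord R j (y k)\<bar> \<le> real ?n * 1"
      unfolding y_def coord_simps abs_mult using abs_coord_dirs[OF R e0(1), of j] k_le by (intro mult_mono) auto
    then show "\<bar>coord R j (y k' + e0)\<bar> < N ^ 7" using n(2) unfolding step by linarith
  qed (simp add: k')
  then have fk: "fail_prob \<omega> ?B ?F (y k) = 0"
    using fail_prob_outside[OF \<omega> _ yk, of ?F] \<kappa> step by simp
  have "fail_prob \<omega> ?B ?F 0 \<le> 1 - (2 * \<kappa>) ^ k * (1 - 0)"
  proof (rule push_bound[OF \<omega> \<kappa>(1) e0(1)])
    fix j assume "j < k"
    then show "fail_prob \<omega> ?B ?F (0 + int j *s e0) \<le>
        (\<Sum>e\<in>dirs. \<omega> (0 + int j *s e0) e * fail_prob \<omega> ?B ?F (0 + int j *s e0 + e))"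
      using fail_prob_inside[OF \<omega> _ k_lt, of j ?F] \<kappa> by (simp add: y_def)
  qed (use fk fail_prob_le_1 in \<open>auto simp: y_def\<close>)
  then have "(2 * \<kappa>) ^ k \<le> 1 - fail_prob \<omega> ?B ?F 0" by simp
  moreover have "(2 * \<kappa>) ^ ?n \<le> (2 * \<kappa>) ^ k" using \<kappa> k_le by (intro power_decreasing) auto
  ultimately show ?thesis by (simp add: p_box_def fail_prob_compl)
qed

section \<open>Measurability in the environment\<close>

lemma space_site [simp]: "space (site_space \<kappa> :: 'd::finite site measure) = site_simplex \<kappa>"
  by (auto simp: site_space_def space_restrict_space space_PiM site_simplex_def PiE_UNIV_domain PiE_def)

lemma elliptic_conf: "\<omega> \<in> space (conf_space \<kappa> UNIV) \<Longrightarrow> elliptic \<kappa> \<omega>"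
  by (auto simp: space_PiM elliptic_def)

lemma measurable_site_coordinate:
  assumes "e \<in> dirs"
  shows "(\<lambda>p. p e) \<in> borel_measurable (site_space \<kappa> :: 'd::finite site measure)"
  unfolding site_space_def
  by (intro measurable_restrict_space1 measurable_component_singleton assms)

lemma measurable_env_coordinate:
  assumes "y \<in> A" "e \<in> dirs"
  shows "(\<lambda>\<omega>. \<omega> y e) \<in> borel_measurable (conf_space \<kappa> A :: 'd::finite env measure)"
  using measurable_compose[OF measurable_component_singleton[OF assms(1)] measurable_site_coordinate[OF assms(2)]] .

lemma measurable_quenched:
  assumes "0 \<le> \<kappa>"
  shows "(\<lambda>\<omega>. quenched \<omega> x) \<in> measurable (conf_space \<kappa> UNIV) (prob_algebra (path_space :: (nat \<Rightarrow> int ^ 'd::finite) measure))"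
proof (rule measurable_prob_algebra_generated[where \<Omega>=UNIV and G=cylinders])
  show "sets (path_space :: (nat \<Rightarrow> int ^ 'd) measure) = sigma_sets UNIV cylinders" by (rule sets_path_space)
  show "Int_stable (cylinders :: (nat \<Rightarrow> int ^ 'd) set set)" by (rule Int_stable_cylinders)
  fix A :: "(nat \<Rightarrow> int ^ 'd) set" assume "A \<in> cylinders"
  then consider "A = {}" | n p where "A = cylinder n p" by (auto simp: cylinders_def)
  then show "(\<lambda>\<omega>. emeasure (quenched \<omega> x) A) \<in> borel_measurable (conf_space \<kappa> UNIV)"
  proof cases
    case (2 n p)
    have 1: "(\<lambda>\<omega>. pmf (step_pmf \<omega> y) z) \<in> borel_measurable (conf_space \<kappa> UNIV)" for y z :: "int ^ 'd"
    proof -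
      have "(\<lambda>\<omega>. if z - y \<in> dirs then \<omega> y (z - y) else 0) \<in> borel_measurable (conf_space \<kappa> UNIV)"
        using measurable_env_coordinate[of y UNIV "z - y" \<kappa>] by (cases "z - y \<in> dirs") simp_all
      then show ?thesis
      proof (rule measurable_cong[THEN iffD1, rotated])
        fix \<omega> :: "'d env" assume "\<omega> \<in> space (conf_space \<kappa> UNIV)"
        then have "\<omega> y \<in> site_simplex \<kappa>" using elliptic_conf[of \<omega> \<kappa>] by (simp add: elliptic_def)
        then show "(if z - y \<in> dirs then \<omega> y (z - y) else 0) = pmf (step_pmf \<omega> y) z"
          using pmf_step[of \<omega> y \<kappa> z] assms by simp
      qed
    qed
    have "(\<lambda>\<omega>. ennreal (\<Prod>i<n. pmf (step_pmf \<omega> (p i)) (p (Suc i)))) \<in> borel_measurable (conf_space \<kappa> UNIV)"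
      using 1 by measurable
    then show ?thesis unfolding 2 emeasure_quenched_cylinder by (cases "p 0 = x") simp_all
  qed simp
qed (auto intro: prob_space_quenched)

lemma measurable_fail_prob:
  assumes "0 \<le> \<kappa>"
  shows "(\<lambda>\<omega>. fail_prob \<omega> B S x) \<in> borel_measurable (conf_space \<kappa> UNIV :: 'd::finite env measure)"
proof -
  have "(\<lambda>\<omega>. measure (quenched \<omega> x) {X. \<not> exits_via B S X}) \<in> borel_measurable (conf_space \<kappa> UNIV)"
    using measurable_compose[OF measurable_prob_algebraD[OF measurable_quenched[OF assms]]
        measurable_measure_subprob_algebra[OF sets_not_exits_via]] .
  then show ?thesis by (simp add: fail_prob_def[abs_def])
qed

lemma measurable_shift: "shift z \<in> measurable (conf_space \<kappa> UNIV) (conf_space \<kappa> UNIV :: 'd::finite env measure)"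
proof (rule measurable_PiM_single')
  fix i show "(\<lambda>\<omega>. shift z \<omega> i) \<in> measurable (conf_space \<kappa> UNIV) (site_space \<kappa> :: 'd site measure)"
    unfolding shift_def by (rule measurable_component_singleton) simp
qed (auto simp: space_PiM shift_def PiE_def)

lemma measurable_block_bad:
  assumes "0 \<le> \<kappa>"
  shows "{\<omega> \<in> space (conf_space \<kappa> UNIV). block_bad i1 R l N \<omega> x} \<in> sets (conf_space \<kappa> UNIV :: 'd::finite env measure)"
proof -
  have "(\<lambda>\<omega>. fail_prob (shift x \<omega>) (box2 i1 R N) (box2_front i1 R l N) 0) \<in> borel_measurable (conf_space \<kappa> UNIV :: 'd env measure)"
    using measurable_compose[OF measurable_shift measurable_fail_prob[OF assms]] .
  then show ?thesis unfolding block_bad_def by measurable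
qed

section \<open>Dependence of a bad block on finitely many sites\<close>

definition block_sites :: "'d \<Rightarrow> real ^ 'd ^ 'd \<Rightarrow> real \<Rightarrow> int ^ 'd \<Rightarrow> (int ^ 'd::finite) set" where
  "block_sites i1 R N x = (\<lambda>y. y + x) ` box2 i1 R N"

lemma finite_box2:
  fixes R :: "real ^ 'd::finite ^ 'd"
  assumes R: "rotation_to i1 R l" and N: "1 \<le> N"
  shows "box2 i1 R N \<subseteq> cube (2 * real CARD('d) * N ^ 3)" "finite (box2 i1 R N)"
proof -
  show 1: "box2 i1 R N \<subseteq> cube (2 * real CARD('d) * N ^ 3)"
  proof
    fix x assume x: "x \<in> box2 i1 R N"
    have N3: "N \<le> N ^ 3" "1 \<le> N ^ 3" using N by (auto intro: self_le_power)
    have "\<bar>coord R j x\<bar> \<le> 2 * N ^ 3" for j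
    proof (cases "j = i1")
      case True
      then show ?thesis using x N3 unfolding box2_iff[OF R] by (auto simp: abs_le_iff)
    next
      case False
      then show ?thesis using x N3 unfolding box2_iff[OF R] by (force simp: abs_le_iff)
    qed
    then have "(\<Sum>j\<in>UNIV. \<bar>coord R j x\<bar>) \<le> (\<Sum>j\<in>(UNIV::'d set). 2 * N ^ 3)" by (intro sum_mono)
    then have "norm (rvec x) \<le> 2 * real CARD('d) * N ^ 3"
      using norm_rvec_coord[OF R, of x] by simp
    then have "\<bar>rvec x $ i\<bar> \<le> 2 * real CARD('d) * N ^ 3" for i
      using component_le_norm_cart[of "rvec x" i] by linarith
    then show "x \<in> cube (2 * real CARD('d) * N ^ 3)" by (simp add: cube_def rvec_def)
  qed
  show "finite (box2 i1 R N)"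
    using finite_subset[OF 1 cube_bound(1)] N by simp
qed

lemma block_bad_local:
  fixes R :: "real ^ 'd::finite ^ 'd" and \<omega> :: "'d env"
  assumes R: "rotation_to i1 R l" and N: "1 \<le> N" and \<kappa>: "0 < \<kappa>"
    and \<omega>: "elliptic \<kappa> \<omega>" "elliptic \<kappa> \<omega>'" and eq: "\<And>y. y \<in> block_sites i1 R N x \<Longrightarrow> \<omega> y = \<omega>' y"
  shows "block_bad i1 R l N \<omega> x \<longleftrightarrow> block_bad i1 R l N \<omega>' x"
proof -
  have "fail_prob (shift x \<omega>) (box2 i1 R N) (box2_front i1 R l N) 0 = fail_prob (shift x \<omega>') (box2 i1 R N) (box2_front i1 R l N) 0"
  proof (rule fail_prob_cong[OF _ _ \<kappa> finite_box2(2)[OF R N]])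
    show "elliptic \<kappa> (shift x \<omega>)" "elliptic \<kappa> (shift x \<omega>')" using \<omega> by (auto simp: elliptic_def shift_def)
    show "shift x \<omega> y = shift x \<omega>' y" if "y \<in> box2 i1 R N" for y
      using eq[of "y + x"] that by (simp add: shift_def block_sites_def)
    show "0 \<in> box2 i1 R N" using N unfolding box2_iff[OF R] by simp
  qed
  then show ?thesis by (simp add: block_bad_def)
qed

text \<open>A configuration on the block is extended by a fixed site law \<open>p0\<close>; by \<open>block_bad_local\<close> the extension
  does not influence whether \<open>x\<close> is bad.\<close>

lemma block_bad_event:
  fixes R :: "real ^ 'd::finite ^ 'd"
  assumes R: "rotation_to i1 R l" and N: "1 \<le> N" and \<kappa>: "0 < \<kappa>" and ne: "site_simplex \<kappa> \<noteq> ({} :: 'd site set)"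
  shows "\<exists>E\<in>sets (conf_space \<kappa> (block_sites i1 R N x)). \<forall>\<omega>\<in>space (conf_space \<kappa> UNIV).
     block_bad i1 R l N \<omega> x \<longleftrightarrow> restrict \<omega> (block_sites i1 R N x) \<in> E"
proof -
  let ?D = "block_sites i1 R N x"
  obtain p0 :: "'d site" where p0: "p0 \<in> site_simplex \<kappa>" using ne by blast
  define ext where "ext = (\<lambda>(\<xi> :: 'd env) y. if y \<in> ?D then \<xi> y else p0)"
  have m: "ext \<in> measurable (conf_space \<kappa> ?D) (conf_space \<kappa> UNIV)"
  proof (rule measurable_PiM_single')
    fix y show "(\<lambda>\<xi>. ext \<xi> y) \<in> measurable (conf_space \<kappa> ?D) (site_space \<kappa>)"
      using p0 measurable_component_singleton[of y ?D] by (cases "y \<in> ?D") (simp_all add: ext_def)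
  qed (use p0 in \<open>auto simp: ext_def space_PiM PiE_def Pi_def\<close>)
  define E where "E = ext -` {\<omega> \<in> space (conf_space \<kappa> UNIV). block_bad i1 R l N \<omega> x} \<inter> space (conf_space \<kappa> ?D)"
  have E: "E \<in> sets (conf_space \<kappa> ?D)"
    unfolding E_def using \<kappa> by (intro measurable_sets[OF m] measurable_block_bad) auto
  show ?thesis
  proof (intro bexI[OF _ E] ballI)
    fix \<omega> :: "'d env" assume \<omega>: "\<omega> \<in> space (conf_space \<kappa> UNIV)"
    have r: "restrict \<omega> ?D \<in> space (conf_space \<kappa> ?D)" using \<omega> by (auto simp: space_PiM)
    have e: "ext (restrict \<omega> ?D) \<in> space (conf_space \<kappa> UNIV)" using measurable_space[OF m r] .
    have "block_bad i1 R l N \<omega> x \<longleftrightarrow> block_bad i1 R l N (ext (restrict \<omega> ?D)) x"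
      by (rule block_bad_local[OF R N \<kappa> elliptic_conf[OF \<omega>] elliptic_conf[OF e]]) (simp add: ext_def)
    then show "block_bad i1 R l N \<omega> x \<longleftrightarrow> restrict \<omega> ?D \<in> E" using r e by (simp add: E_def)
  qed
qed

section \<open>Mixing\<close>

lemma env_sigma_facts:
  fixes A :: "(int ^ 'd::finite) set"
  shows space_env_sigma: "space (env_sigma \<kappa> A) = space (conf_space \<kappa> UNIV)"
    and sets_env_sigma: "sets (env_sigma \<kappa> A) \<subseteq> sets (conf_space \<kappa> UNIV :: 'd env measure)"
    and measurable_env_sigma: "y \<in> A \<Longrightarrow> (\<lambda>\<omega>. \<omega> y) \<in> measurable (env_sigma \<kappa> A) (site_space \<kappa>)"
    and measurable_env_sigma_restrict: "D \<subseteq> A \<Longrightarrow> (\<lambda>\<omega>. restrict \<omega> D) \<in> measurable (env_sigma \<kappa> A) (conf_space \<kappa> D)"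
proof -
  let ?G = "{(\<lambda>\<omega>. \<omega> x) -` B \<inter> space (conf_space \<kappa> UNIV) | x B. x \<in> A \<and> B \<in> sets (site_space \<kappa> :: 'd site measure)}"
  have G: "?G \<subseteq> Pow (space (conf_space \<kappa> UNIV))" by auto
  show sp: "space (env_sigma \<kappa> A) = space (conf_space \<kappa> UNIV)"
    unfolding env_sigma_def by (simp add: space_measure_of[OF G])
  have st: "sets (env_sigma \<kappa> A) = sigma_sets (space (conf_space \<kappa> UNIV)) ?G"
    unfolding env_sigma_def by (simp add: sets_measure_of[OF G])
  show "sets (env_sigma \<kappa> A) \<subseteq> sets (conf_space \<kappa> UNIV :: 'd env measure)"
    unfolding st
  proof (rule sets.sigma_sets_subset)
    show "?G \<subseteq> sets (conf_space \<kappa> UNIV)"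
      by (auto intro!: measurable_sets[OF measurable_component_singleton])
  qed
  show 1: "(\<lambda>\<omega>. \<omega> y) \<in> measurable (env_sigma \<kappa> A) (site_space \<kappa>)" if "y \<in> A" for y
  proof (rule measurableI)
    show "\<omega> y \<in> space (site_space \<kappa>)" if "\<omega> \<in> space (env_sigma \<kappa> A)" for \<omega>
      using that unfolding sp by (auto simp: space_PiM)
    show "(\<lambda>\<omega>. \<omega> y) -` B \<inter> space (env_sigma \<kappa> A) \<in> sets (env_sigma \<kappa> A)" if "B \<in> sets (site_space \<kappa>)" for B
      unfolding sp st using that \<open>y \<in> A\<close> by (intro sigma_sets.Basic) blast
  qed
  show "(\<lambda>\<omega>. restrict \<omega> D) \<in> measurable (env_sigma \<kappa> A) (conf_space \<kappa> D)" if "D \<subseteq> A"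
    using that by (intro measurable_restrict 1) auto
qed

lemma measure_le_of_RN_deriv_le:
  assumes M: "prob_space M" and N: "prob_space N" and s: "sets N = sets M" and ac: "absolutely_continuous M N"
    and le: "AE \<xi> in M. RN_deriv M N \<xi> \<le> ennreal c" and c: "0 \<le> c" and E: "E \<in> sets M"
  shows "measure N E \<le> c * measure M E"
proof -
  interpret M: prob_space M by fact
  interpret N: prob_space N by fact
  have "emeasure N E = emeasure (density M (RN_deriv M N)) E"
    by (subst M.density_RN_deriv[OF ac s]) simp
  also have "\<dots> = (\<integral>\<^sup>+\<xi>. RN_deriv M N \<xi> * indicator E \<xi> \<partial>M)"
    using E by (intro emeasure_density) auto
  also have "\<dots> \<le> (\<integral>\<^sup>+\<xi>. ennreal c * indicator E \<xi> \<partial>M)"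
  proof (rule nn_integral_mono_AE)
    show "AE \<xi> in M. RN_deriv M N \<xi> * indicator E \<xi> \<le> ennreal c * indicator E \<xi>"
      using le by eventually_elim (rule mult_right_mono, auto)
  qed
  also have "\<dots> = ennreal c * emeasure M E"
    using E by (simp add: nn_integral_cmult_indicator)
  finally have "ennreal (measure N E) \<le> ennreal (c * measure M E)"
    using c by (simp add: N.emeasure_eq_measure M.emeasure_eq_measure ennreal_mult)
  then show ?thesis using c by (simp add: ennreal_le_iff)
qed

text \<open>The density bound, for pairs of boundary conditions that may differ everywhere outside \<open>V\<close>, says that the
  conditional probability of \<open>E\<close> given one boundary condition is at most \<open>\<Gamma>\<close> times that given
  another. Averaging over the second bounds the conditional probability by \<open>\<Gamma>\<close> times the
  unconditional one, and the claim follows by integration over \<open>H\<close>.\<close>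

lemma SMG_decoupling:
  fixes \<P> :: "'d::finite env measure"
  assumes re: "random_environment \<kappa> \<P>" and smg: "SMG \<kappa> r C g \<P>"
    and V: "finite V" and DV: "D \<subseteq> V" and r: "ereal r \<le> d1 D (- V)"
    and E: "E \<in> sets (conf_space \<kappa> D)" and H: "H \<in> sets (env_sigma \<kappa> (- V))"
    and \<Gamma>: "exp (C * (\<Sum>\<^sub>\<infinity>(x, y)\<in>D \<times> (- V). exp (- g * real_of_int (l1 (x - y))))) \<le> \<Gamma>"
  shows "measure \<P> ({\<omega> \<in> space \<P>. restrict \<omega> D \<in> E} \<inter> H) \<le> \<Gamma> * measure \<P> {\<omega> \<in> space \<P>. restrict \<omega> D \<in> E} * measure \<P> H"
proof -
  have P: "prob_space \<P>" and sP: "sets \<P> = sets (conf_space \<kappa> UNIV)" using re by (auto simp: random_environment_def)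
  interpret P: prob_space \<P> by fact
  have spP: "space \<P> = space (conf_space \<kappa> UNIV)" using sets_eq_imp_space_eq[OF sP] .
  let ?F = "env_sigma \<kappa> (- V)"
  have sub: "subalgebra \<P> ?F"
    using space_env_sigma[of \<kappa> "- V"] sets_env_sigma[of \<kappa> "- V"] by (auto simp: subalgebra_def sP spP)
  interpret F: finite_measure_subalgebra \<P> ?F by unfold_locales (rule sub)
  have mD: "(\<lambda>\<omega>. restrict \<omega> D) \<in> measurable \<P> (conf_space \<kappa> D)"
    unfolding measurable_cong_sets[OF sP refl] by (rule measurable_restrict_subset) simp
  let ?A = "{\<omega> \<in> space \<P>. restrict \<omega> D \<in> E}"
  have A: "?A \<in> sets \<P>" using measurable_sets[OF mD E] by (simp add: vimage_def Int_def conj_commute)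
  define f where "f = (\<lambda>\<omega>. indicator E (restrict \<omega> D) :: real)"
  have f_eq: "f \<omega> = indicator ?A \<omega>" if "\<omega> \<in> space \<P>" for \<omega> using that by (simp add: f_def indicator_def)
  have intf: "integrable \<P> f"
    by (subst Bochner_Integration.integrable_cong[OF refl f_eq])
       (auto intro!: integrable_real_indicator A simp: less_top[symmetric])
  define c where "c = cond_prob_conf \<kappa> \<P> D E (- V)"
  have c_eq: "c = real_cond_exp \<P> ?F f" by (simp add: c_def cond_prob_conf_def f_def)
  have intc: "integrable \<P> c" unfolding c_eq by (rule F.real_cond_exp_int(1)[OF intf])
  have int_f: "(\<integral>\<omega>. f \<omega> \<partial>\<P>) = measure \<P> ?A"
    by (subst Bochner_Integration.integral_cong[OF refl f_eq]) (use A in auto)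
  have int_c: "(\<integral>\<omega>. c \<omega> \<partial>\<P>) = measure \<P> ?A" unfolding c_eq using F.real_cond_exp_int(2)[OF intf] int_f by simp
  define \<gamma> where "\<gamma> = exp (C * (\<Sum>\<^sub>\<infinity>(x, y)\<in>D \<times> (- V). exp (- g * real_of_int (l1 (x - y)))))"
  obtain K G where K: "regular_cond_law \<kappa> \<P> D V K" and G: "G \<subseteq> space (conf_space \<kappa> (- V))"
    and aeG: "AE \<omega> in \<P>. restrict \<omega> (- V) \<in> G"
    and bd: "\<And>\<eta> \<eta>'. \<eta> \<in> G \<Longrightarrow> \<eta>' \<in> G \<Longrightarrow> absolutely_continuous (K \<eta>') (K \<eta>) \<and>
             (AE \<xi> in K \<eta>'. RN_deriv (K \<eta>') (K \<eta>) \<xi> \<le> ennreal \<gamma>)"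
  proof -
    have "\<exists>K G. regular_cond_law \<kappa> \<P> D V K \<and>
          G \<subseteq> space (conf_space \<kappa> (- V)) \<and> (AE \<omega> in \<P>. restrict \<omega> (- V) \<in> G) \<and>
          (\<forall>\<eta>\<in>G. \<forall>\<eta>'\<in>G. (\<forall>x\<in>- V - - V. \<eta> x = \<eta>' x) \<longrightarrow>
             absolutely_continuous (K \<eta>') (K \<eta>) \<and>
             (AE \<xi> in K \<eta>'. RN_deriv (K \<eta>') (K \<eta>) \<xi> \<le> ennreal \<gamma>))"
      using smg V DV r unfolding SMG_def \<gamma>_def by (elim conjE allE[of _ D] allE[of _ V] allE[of _ "- V"]) auto
    then show thesis using that by (auto simp del: Compl_iff)
  qed
  have Kspace: "K \<eta> \<in> space (prob_algebra (conf_space \<kappa> D))" if "\<eta> \<in> G" for \<eta>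
    using K G that by (auto simp: regular_cond_law_def dest: measurable_space)
  have Kle: "measure (K \<eta>) E \<le> \<gamma> * measure (K \<eta>') E" if "\<eta> \<in> G" "\<eta>' \<in> G" for \<eta> \<eta>'
    using Kspace[OF that(1)] Kspace[OF that(2)] bd[OF that] E
    by (intro measure_le_of_RN_deriv_le) (auto simp: space_prob_algebra \<gamma>_def)
  have aec: "AE \<omega> in \<P>. measure (K (restrict \<omega> (- V))) E = c \<omega>"
    using K E by (simp add: regular_cond_law_def c_def)
  have ub: "AE \<omega> in \<P>. c \<omega> \<le> \<gamma> * measure \<P> ?A"
    using aeG aec
  proof eventually_elim
    case (elim \<omega>)
    have "AE \<omega>' in \<P>. c \<omega> \<le> \<gamma> * c \<omega>'"
      using aeG aec
    proof eventually_elim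
      case (elim \<omega>')
      then show ?case using Kle[OF \<open>restrict \<omega> (- V) \<in> G\<close> elim(1)] \<open>measure (K (restrict \<omega> (- V))) E = c \<omega>\<close> by simp
    qed
    then have "(\<integral>\<omega>'. c \<omega> \<partial>\<P>) \<le> (\<integral>\<omega>'. \<gamma> * c \<omega>' \<partial>\<P>)"
      using intc by (intro integral_mono_AE) auto
    then show ?case using int_c P.prob_space by simp
  qed
  have HP: "H \<in> sets \<P>" using H sub by (auto simp: subalgebra_def)
  have "measure \<P> (?A \<inter> H) = (\<integral>\<omega>. indicator H \<omega> * f \<omega> \<partial>\<P>)"
  proof -
    have "(\<integral>\<omega>. indicator H \<omega> * f \<omega> \<partial>\<P>) = (\<integral>\<omega>. indicator (?A \<inter> H) \<omega> \<partial>\<P>)"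
      by (intro Bochner_Integration.integral_cong refl) (auto simp: f_eq indicator_def)
    also have "\<dots> = measure \<P> (?A \<inter> H)" using A HP by simp
    finally show ?thesis by simp
  qed
  also have "\<dots> = (\<integral>\<omega>. indicator H \<omega> * c \<omega> \<partial>\<P>)"
    using F.real_cond_exp_intA[OF intf H] unfolding c_eq set_lebesgue_integral_def by simp
  also have "\<dots> \<le> (\<integral>\<omega>. indicator H \<omega> * (\<gamma> * measure \<P> ?A) \<partial>\<P>)"
  proof (rule integral_mono_AE)
    show "integrable \<P> (\<lambda>\<omega>. indicator H \<omega> * c \<omega>)"
      using integrable_mult_indicator[OF HP intc] by simp
    have "integrable \<P> (indicator H :: _ \<Rightarrow> real)"
      by (intro integrable_real_indicator HP) (simp add: less_top[symmetric])
    then show "integrable \<P> (\<lambda>\<omega>. indicator H \<omega> * (\<gamma> * measure \<P> ?A))"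
      by (rule integrable_mult_left)
    show "AE \<omega> in \<P>. indicator H \<omega> * c \<omega> \<le> indicator H \<omega> * (\<gamma> * measure \<P> ?A)"
      using ub by eventually_elim (auto simp: indicator_def)
  qed
  also have "\<dots> = \<gamma> * measure \<P> ?A * measure \<P> H" using HP by simp
  also have "\<dots> \<le> \<Gamma> * measure \<P> ?A * measure \<P> H"
    using \<Gamma> by (intro mult_right_mono) (auto simp: \<gamma>_def)
  finally show ?thesis .
qed

section \<open>Summing the exponential weights\<close>

lemma sum_exp_abs_le:
  assumes "0 < h"
  shows "(\<Sum>k\<in>{-int m..int m}. exp (- h * \<bar>real_of_int k\<bar>)) \<le> 2 / (1 - exp (- h))"
proof -
  let ?f = "\<lambda>k. exp (- h * \<bar>real_of_int k\<bar>)"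
  let ?A = "int ` {..m}" and ?B = "(\<lambda>n. - int n) ` {..m}"
  have q: "0 \<le> exp (- h)" "exp (- h) < 1" using assms by auto
  have geo: "(\<Sum>n\<le>m. exp (- h) ^ n) \<le> 1 / (1 - exp (- h))"
  proof -
    have "(\<Sum>n\<le>m. exp (- h) ^ n) \<le> (\<Sum>n. exp (- h) ^ n)"
      using q by (intro sum_le_suminf summable_geometric) auto
    also have "\<dots> = 1 / (1 - exp (- h))" using q by (intro suminf_geometric) auto
    finally show ?thesis .
  qed
  have pw: "exp (- (h * real n)) = exp (- h) ^ n" for n by (simp add: exp_of_nat_mult[symmetric] mult.commute)
  have sub: "{-int m..int m} \<subseteq> ?A \<union> ?B"
  proof
    fix k assume k: "k \<in> {-int m..int m}"
    show "k \<in> ?A \<union> ?B"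
    proof (cases "0 \<le> k")
      case True
      then have "k = int (nat k)" "nat k \<le> m" using k by auto
      then show ?thesis by blast
    next
      case False
      then have "k = - int (nat (- k))" "nat (- k) \<le> m" using k by auto
      then show ?thesis by blast
    qed
  qed
  have "sum ?f {-int m..int m} \<le> sum ?f (?A \<union> ?B)" by (intro sum_mono2 sub) auto
  also have "\<dots> \<le> sum ?f ?A + sum ?f ?B"
  proof -
    have "sum ?f (?A \<union> ?B) + sum ?f (?A \<inter> ?B) = sum ?f ?A + sum ?f ?B" by (rule sum.union_inter) auto
    moreover have "0 \<le> sum ?f (?A \<inter> ?B)" by (intro sum_nonneg) auto
    ultimately show ?thesis by linarith
  qed
  also have "sum ?f ?A = (\<Sum>n\<le>m. exp (- h) ^ n)" by (subst sum.reindex) (auto simp: pw)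
  also have "sum ?f ?B = (\<Sum>n\<le>m. exp (- h) ^ n)" by (subst sum.reindex) (auto simp: pw inj_on_def)
  finally show ?thesis using geo by simp
qed

text \<open>The \<open>d\<close>-th power of a bound for the sum of \<open>exp (- h \<bar>k\<bar>)\<close> over the integers \<open>k\<close>.\<close>

definition lattice_sum_bound :: "nat \<Rightarrow> real \<Rightarrow> real" where
  "lattice_sum_bound d h = (2 / (1 - exp (- h))) ^ d"

lemma sum_exp_l1_le:
  fixes F :: "(int ^ 'd::finite) set"
  assumes h: "0 < h" and F: "finite F"
  shows "(\<Sum>z\<in>F. exp (- h * real_of_int (l1 z))) \<le> lattice_sum_bound CARD('d) h"
proof -
  define m where "m = nat (\<Sum>z\<in>F. l1 z)"
  have l1n: "0 \<le> l1 z" for z :: "int ^ 'd" by (simp add: l1_def sum_nonneg)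
  have bnd: "z $ i \<in> {-int m..int m}" if "z \<in> F" for z i
  proof -
    have "\<bar>z $ i\<bar> \<le> l1 z" unfolding l1_def by (rule member_le_sum) auto
    also have "\<dots> \<le> (\<Sum>z\<in>F. l1 z)" using that F l1n by (intro member_le_sum) auto
    finally show ?thesis by (auto simp: m_def abs_le_iff)
  qed
  let ?f = "\<lambda>k. exp (- h * \<bar>real_of_int k\<bar>)"
  have pr: "exp (- h * real_of_int (l1 z)) = (\<Prod>i\<in>UNIV. ?f (z $ i))" for z :: "int ^ 'd"
    by (simp add: l1_def exp_sum[symmetric] sum_distrib_left)
  have "(\<Sum>z\<in>F. exp (- h * real_of_int (l1 z))) = (\<Sum>p\<in>vec_nth ` F. \<Prod>i\<in>UNIV. ?f (p i))"
    unfolding pr by (subst sum.reindex) (auto simp: inj_on_def vec_eq_iff)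
  also have "\<dots> \<le> (\<Sum>p\<in>PiE (UNIV :: 'd set) (\<lambda>_. {-int m..int m}). \<Prod>i\<in>UNIV. ?f (p i))"
  proof (rule sum_mono2)
    show "vec_nth ` F \<subseteq> PiE UNIV (\<lambda>_. {-int m..int m})" using bnd by (auto simp: PiE_UNIV_domain)
  qed (auto intro!: finite_PiE prod_nonneg)
  also have "\<dots> = (\<Prod>i\<in>(UNIV :: 'd set). \<Sum>k\<in>{-int m..int m}. ?f k)"
    by (rule prod_sum_PiE[symmetric]) auto
  also have "\<dots> \<le> (\<Prod>i\<in>(UNIV :: 'd set). 2 / (1 - exp (- h)))"
    by (intro prod_mono conjI sum_exp_abs_le h sum_nonneg) auto
  finally show ?thesis by (simp add: lattice_sum_bound_def)
qed

text \<open>Half of the exponential rate is spent on the minimal distance \<open>N\<close>, the other half on the convergence of the sum.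
  An infinite sum that diverges has the value \<open>0\<close> by convention, hence the case distinction.\<close>

lemma infsum_exp_le:
  fixes D W :: "(int ^ 'd::finite) set"
  assumes g: "0 < g" and D: "finite D" and far: "\<And>x y. x \<in> D \<Longrightarrow> y \<in> W \<Longrightarrow> N \<le> real_of_int (l1 (x - y))"
  shows "(\<Sum>\<^sub>\<infinity>(x, y)\<in>D \<times> W. exp (- g * real_of_int (l1 (x - y)))) \<le>
     real (card D) * (exp (- (g / 2) * N) * lattice_sum_bound CARD('d) (g / 2))"
    (is "infsum ?f _ \<le> ?b")
proof (cases "?f summable_on D \<times> W")
  case True
  show ?thesis
  proof (rule infsum_le_finite_sums[OF True])
    fix F assume F: "finite F" "F \<subseteq> D \<times> W"
    let ?Y = "snd ` F"
    have "sum ?f F \<le> sum ?f (D \<times> ?Y)"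
      using F D by (intro sum_mono2) force+
    also have "\<dots> = (\<Sum>x\<in>D. \<Sum>y\<in>?Y. exp (- g * real_of_int (l1 (x - y))))"
      by (subst sum.cartesian_product) simp
    also have "\<dots> \<le> (\<Sum>x\<in>D. exp (- (g / 2) * N) * lattice_sum_bound CARD('d) (g / 2))"
    proof (rule sum_mono)
      fix x assume x: "x \<in> D"
      have "(\<Sum>y\<in>?Y. exp (- g * real_of_int (l1 (x - y)))) \<le>
          (\<Sum>y\<in>?Y. exp (- (g / 2) * N) * exp (- (g / 2) * real_of_int (l1 (x - y))))"
      proof (rule sum_mono)
        fix y assume "y \<in> ?Y"
        then have "y \<in> W" using F by auto
        then have "g / 2 * N \<le> g / 2 * real_of_int (l1 (x - y))" using far[OF x] g by simp
        then show "exp (- g * real_of_int (l1 (x - y))) \<le> exp (- (g / 2) * N) * exp (- (g / 2) * real_of_int (l1 (x - y)))"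
          unfolding exp_add[symmetric] exp_le_cancel_iff by (simp add: field_simps)
      qed
      also have "\<dots> = exp (- (g / 2) * N) * (\<Sum>z\<in>(\<lambda>y. x - y) ` ?Y. exp (- (g / 2) * real_of_int (l1 z)))"
        by (subst sum.reindex) (auto simp: inj_on_def sum_distrib_left)
      also have "\<dots> \<le> exp (- (g / 2) * N) * lattice_sum_bound CARD('d) (g / 2)"
        using F g by (intro mult_left_mono sum_exp_l1_le) auto
      finally show "(\<Sum>y\<in>?Y. exp (- g * real_of_int (l1 (x - y)))) \<le> exp (- (g / 2) * N) * lattice_sum_bound CARD('d) (g / 2)" .
    qed
    finally show "sum ?f F \<le> ?b" by simp
  qed
next
  case False
  have "0 \<le> lattice_sum_bound CARD('d) (g / 2)" using g by (simp add: lattice_sum_bound_def)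
  then show ?thesis using infsum_not_exists[OF False] by simp
qed

section \<open>The probability of many separated bad blocks\<close>

lemma block_sites_iff:
  assumes R: "rotation_to i1 R l"
  shows "z \<in> block_sites i1 R N x \<longleftrightarrow> z - x \<in> box2 i1 R N"
  by (auto simp: block_sites_def image_iff intro: bexI[of _ "z - x"])

lemma separated_blocks_far:
  fixes R :: "real ^ 'd::finite ^ 'd"
  assumes R: "rotation_to i1 R l" and N: "1 \<le> N" and s: "separated i1 R N x y"
    and z: "z \<in> block_sites i1 R N x" and w: "w \<in> block_sites i1 R N y"
  shows "N \<le> real_of_int (l1 (w - z))"
proof -
  have N3: "N \<le> N ^ 3" using N by (intro self_le_power) auto
  have zz: "z - x \<in> box2 i1 R N" "w - y \<in> box2 i1 R N" using z w unfolding block_sites_iff[OF R] by auto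
  have "\<exists>j. N \<le> \<bar>coord R j (w - z)\<bar>"
    using s unfolding separated_def
  proof (elim disjE exE conjE)
    assume "3 * N \<le> \<bar>coord R i1 x - coord R i1 y\<bar>"
    moreover have "- (N / 11) < coord R i1 z - coord R i1 x" "coord R i1 z - coord R i1 x < 12 * N / 11"
      "- (N / 11) < coord R i1 w - coord R i1 y" "coord R i1 w - coord R i1 y < 12 * N / 11"
      using zz unfolding box2_iff[OF R] by auto
    ultimately have "N \<le> \<bar>coord R i1 w - coord R i1 z\<bar>" using N by linarith
    then show ?thesis by (intro exI[of _ i1]) simp
  next
    fix j assume j: "j \<noteq> i1" and "3 * N ^ 3 \<le> \<bar>coord R j x - coord R j y\<bar>"
    moreover have "- (N ^ 3 / 10) < coord R j z - coord R j x" "coord R j z - coord R j x < 11 * N ^ 3 / 10"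
      "- (N ^ 3 / 10) < coord R j w - coord R j y" "coord R j w - coord R j y < 11 * N ^ 3 / 10"
      using zz j unfolding box2_iff[OF R] by auto
    ultimately have "N \<le> \<bar>coord R j w - coord R j z\<bar>" using N N3 by linarith
    then show ?thesis by (intro exI[of _ j]) simp
  qed
  then obtain j where "N \<le> \<bar>coord R j (w - z)\<bar>" by blast
  then show ?thesis using abs_coord_le_l1[OF R, of j "w - z"] by linarith
qed

lemma l1_minus: "l1 (x - y) = l1 (y - x)"
  unfolding l1_def by (rule sum.cong) auto

text \<open>The power \<open>(4 * d * N ^ 3 + 1) ^ d\<close> bounds the number of sites of a block.\<close>

definition mixing_constant :: "nat \<Rightarrow> real \<Rightarrow> real \<Rightarrow> real \<Rightarrow> real" where
  "mixing_constant d C g N = exp (C * ((4 * real d * N ^ 3 + 1) ^ d * (exp (- (g / 2) * N) * lattice_sum_bound d (g / 2))))"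

context
  fixes \<P> :: "'d::finite env measure" and \<kappa> C g r N :: real and i1 :: 'd and R :: "real ^ 'd ^ 'd" and l :: "real ^ 'd"
  assumes re: "random_environment \<kappa> \<P>" and smg: "SMG \<kappa> r C g \<P>" and \<kappa>: "0 < \<kappa>"
    and R: "rotation_to i1 R l" and N: "1 \<le> N" "r \<le> N" and Cg: "0 < C" "0 < g"
begin

lemma prob_P: "prob_space \<P>" using re by (simp add: random_environment_def)

lemma sets_P: "sets \<P> = sets (conf_space \<kappa> UNIV)" using re by (simp add: random_environment_def)

lemma space_P: "space \<P> = space (conf_space \<kappa> UNIV)" using sets_eq_imp_space_eq[OF sets_P] .

definition bad_prob :: real where
  "bad_prob = measure \<P> {\<omega> \<in> space \<P>. block_bad i1 R l N \<omega> 0}"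

lemma sets_block_bad: "{\<omega> \<in> space \<P>. block_bad i1 R l N \<omega> x} \<in> sets \<P>"
  unfolding space_P sets_P using \<kappa> by (intro measurable_block_bad) auto

lemma block_bad_stationary: "measure \<P> {\<omega> \<in> space \<P>. block_bad i1 R l N \<omega> x} = bad_prob"
proof -
  have m: "shift x \<in> measurable \<P> \<P>"
    unfolding measurable_cong_sets[OF sets_P sets_P] by (rule measurable_shift)
  have "bad_prob = measure (distr \<P> \<P> (shift x)) {\<omega> \<in> space \<P>. block_bad i1 R l N \<omega> 0}"
    using re by (simp add: bad_prob_def random_environment_def)
  also have "\<dots> = measure \<P> (shift x -` {\<omega> \<in> space \<P>. block_bad i1 R l N \<omega> 0} \<inter> space \<P>)"
    by (rule measure_distr[OF m sets_block_bad])
  also have "shift x -` {\<omega> \<in> space \<P>. block_bad i1 R l N \<omega> 0} \<inter> space \<P> = {\<omega> \<in> space \<P>. block_bad i1 R l N \<omega> x}"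
    using measurable_space[OF m] by (auto simp: block_bad_def shift_def)
  finally show ?thesis by simp
qed

text \<open>The inequality of Markov for the quenched failure probability, whose mean is an annealed probability.\<close>

lemma bad_prob_le:
  assumes pc: "polynomial_condition \<P> i1 R l J N"
  shows "bad_prob \<le> N * N powr (- J)"
proof -
  interpret prob_space \<P> by (rule prob_P)
  let ?Q = "box2 i1 R N" and ?Q' = "box2_front i1 R l N"
  let ?E = "{X. \<not> exits_via ?Q ?Q' X}"
  have mq: "(\<lambda>\<omega>. quenched \<omega> x) \<in> measurable \<P> (prob_algebra path_space)" for x
    unfolding measurable_cong_sets[OF sets_P refl] using \<kappa> by (intro measurable_quenched) auto
  have ann: "measure (annealed \<P> x) ?E = (\<integral>\<omega>. fail_prob \<omega> ?Q ?Q' x \<partial>\<P>)" for x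
    unfolding annealed_def fail_prob_def
    by (rule measure_bind[OF measurable_prob_algebraD[OF mq] sets_not_exits_via])
  have mf: "(\<lambda>\<omega>. fail_prob \<omega> ?Q ?Q' x) \<in> borel_measurable \<P>" for x
    unfolding measurable_cong_sets[OF sets_P refl] using \<kappa> by (intro measurable_fail_prob) auto
  have intf: "integrable \<P> (\<lambda>\<omega>. fail_prob \<omega> ?Q ?Q' x)" for x
    by (rule integrable_const_bound[of _ 1]) (use mf in \<open>auto simp: fail_prob_nonneg fail_prob_le_1\<close>)
  have "measure (annealed \<P> x) ?E \<le> 1" for x
  proof -
    have "(\<integral>\<omega>. fail_prob \<omega> ?Q ?Q' x \<partial>\<P>) \<le> (\<integral>\<omega>. 1 \<partial>\<P>)"
      using intf by (intro integral_mono) (auto simp: fail_prob_le_1)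
    then show ?thesis unfolding ann by (simp add: prob_space)
  qed
  then have "bdd_above ((\<lambda>x. measure (annealed \<P> x) ?E) ` box1 i1 R N)" by (intro bdd_aboveI2)
  moreover have "0 \<in> box1 i1 R N" using N unfolding box1_def in_rotated_box[OF R] by simp
  ultimately have "measure (annealed \<P> 0) ?E \<le> (SUP x\<in>box1 i1 R N. measure (annealed \<P> x) ?E)"
    by (intro cSUP_upper)
  also have "\<dots> \<le> N powr (- J)" using pc unfolding polynomial_condition_def by (rule less_imp_le)
  finally have le: "(\<integral>\<omega>. fail_prob \<omega> ?Q ?Q' 0 \<partial>\<P>) \<le> N powr (- J)" unfolding ann .
  have "bad_prob = (\<integral>\<omega>. indicator {\<omega> \<in> space \<P>. block_bad i1 R l N \<omega> 0} \<omega> \<partial>\<P>)"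
    unfolding bad_prob_def using sets_block_bad by simp
  also have "\<dots> \<le> (\<integral>\<omega>. N * fail_prob \<omega> ?Q ?Q' 0 \<partial>\<P>)"
  proof (rule integral_mono)
    show "integrable \<P> (indicator {\<omega> \<in> space \<P>. block_bad i1 R l N \<omega> 0} :: _ \<Rightarrow> real)"
      by (intro integrable_real_indicator sets_block_bad) (simp add: less_top[symmetric])
    fix \<omega> assume "\<omega> \<in> space \<P>"
    have sh0: "shift 0 \<omega> = \<omega>" by (simp add: shift_def)
    show "indicator {\<omega> \<in> space \<P>. block_bad i1 R l N \<omega> 0} \<omega> \<le> N * fail_prob \<omega> ?Q ?Q' 0"
      using N by (auto simp: indicator_def block_bad_def sh0 fail_prob_nonneg field_simps)
  qed (use intf in auto)
  also have "\<dots> = N * (\<integral>\<omega>. fail_prob \<omega> ?Q ?Q' 0 \<partial>\<P>)" by simp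
  also have "\<dots> \<le> N * N powr (- J)" using le N by (intro mult_left_mono) auto
  finally show ?thesis .
qed

text \<open>One site after the other is split off by \<open>SMG_decoupling\<close>. The set \<open>V\<close> is the neighbourhood of radius \<open>N\<close> of
  the block of \<open>x\<close>; the blocks of the remaining sites lie outside of it.\<close>

lemma separated_bad_prob:
  assumes "finite S" "pairwise (separated i1 R N) S"
  shows "measure \<P> {\<omega> \<in> space \<P>. \<forall>x\<in>S. block_bad i1 R l N \<omega> x} \<le> (mixing_constant CARD('d) C g N * bad_prob) ^ card S"
  using assms
proof (induction S rule: finite_induct)
  case empty
  then show ?case using prob_space.prob_space[OF prob_P] by simp
next
  case (insert x S)
  interpret prob_space \<P> by (rule prob_P)
  let ?D = "block_sites i1 R N x"
  define V where "V = {z. \<exists>y\<in>?D. real_of_int (l1 (z - y)) < N}"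
  have finD: "finite ?D" unfolding block_sites_def using finite_box2(2)[OF R N(1)] by simp
  have cardD: "real (card ?D) \<le> (4 * real CARD('d) * N ^ 3 + 1) ^ CARD('d)"
  proof -
    have "card ?D \<le> card (box2 i1 R N)" unfolding block_sites_def by (rule card_image_le[OF finite_box2(2)[OF R N(1)]])
    also have "\<dots> \<le> card (cube (2 * real CARD('d) * N ^ 3) :: (int ^ 'd) set)"
      using N by (intro card_mono cube_bound finite_box2(1)[OF R]) auto
    finally have "real (card ?D) \<le> real (card (cube (2 * real CARD('d) * N ^ 3) :: (int ^ 'd) set))" by simp
    also have "\<dots> \<le> (2 * (2 * real CARD('d) * N ^ 3) + 1) ^ CARD('d)" using N by (intro cube_bound(2)) auto
    finally show ?thesis by (simp add: mult.assoc)
  qed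
  have finV: "finite V"
  proof (rule finite_subset)
    show "V \<subseteq> (\<Union>y\<in>?D. (\<lambda>z. z + y) ` cube N)"
    proof
      fix z assume "z \<in> V"
      then obtain y where y: "y \<in> ?D" "real_of_int (l1 (z - y)) < N" by (auto simp: V_def)
      have "\<bar>real_of_int ((z - y) $ i)\<bar> \<le> N" for i
      proof -
        have "\<bar>(z - y) $ i\<bar> \<le> l1 (z - y)" unfolding l1_def by (rule member_le_sum) auto
        then show ?thesis using y(2) by linarith
      qed
      then have "z - y \<in> cube N" by (simp add: cube_def)
      then show "z \<in> (\<Union>y\<in>?D. (\<lambda>z. z + y) ` cube N)" using y(1) by (force intro!: image_eqI[of _ _ "z - y"])
    qed
    show "finite (\<Union>y\<in>?D. (\<lambda>z. z + y) ` cube N)" using finD N by (auto intro!: finite_imageI cube_bound(1))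
  qed
  have DV: "?D \<subseteq> V" using N by (force simp: V_def l1_def)
  have far: "N \<le> real_of_int (l1 (y - z))" if "y \<in> ?D" "z \<in> - V" for y z
    using that l1_minus[of y z] by (force simp: V_def not_less)
  have rd: "ereal r \<le> d1 ?D (- V)"
    unfolding d1_def using far N(2) by (intro INF_greatest) force
  have ne: "site_simplex \<kappa> \<noteq> ({} :: 'd site set)"
    using not_empty unfolding space_P by (auto simp: space_PiM PiE_eq_empty_iff)
  obtain E where E: "\<And>y. E y \<in> sets (conf_space \<kappa> (block_sites i1 R N y))"
    "\<And>y \<omega>. \<omega> \<in> space (conf_space \<kappa> UNIV) \<Longrightarrow> block_bad i1 R l N \<omega> y \<longleftrightarrow> restrict \<omega> (block_sites i1 R N y) \<in> E y"
    using block_bad_event[OF R N(1) \<kappa> ne] by metis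
  define H where "H = {\<omega> \<in> space \<P>. \<forall>y\<in>S. block_bad i1 R l N \<omega> y}"
  have "H = {\<omega> \<in> space (env_sigma \<kappa> (- V)). \<forall>y\<in>S. restrict \<omega> (block_sites i1 R N y) \<in> E y}"
    unfolding H_def space_P space_env_sigma using E(2) by blast
  also have "\<dots> \<in> sets (env_sigma \<kappa> (- V))"
  proof (rule sets.sets_Collect_finite_All[OF _ insert.hyps(1)])
    fix y assume y: "y \<in> S"
    then have "separated i1 R N x y" using insert.prems insert.hyps(2) by (auto simp: pairwise_insert)
    then have sub: "block_sites i1 R N y \<subseteq> - V"
      using separated_blocks_far[OF R N(1)] by (force simp: V_def)
    have "(\<lambda>\<omega>. restrict \<omega> (block_sites i1 R N y)) -` E y \<inter> space (env_sigma \<kappa> (- V)) \<in> sets (env_sigma \<kappa> (- V))"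
      by (rule measurable_sets[OF measurable_env_sigma_restrict[OF sub] E(1)])
    moreover have "(\<lambda>\<omega>. restrict \<omega> (block_sites i1 R N y)) -` E y \<inter> space (env_sigma \<kappa> (- V)) =
        {\<omega> \<in> space (env_sigma \<kappa> (- V)). restrict \<omega> (block_sites i1 R N y) \<in> E y}" by auto
    ultimately show "{\<omega> \<in> space (env_sigma \<kappa> (- V)). restrict \<omega> (block_sites i1 R N y) \<in> E y} \<in> sets (env_sigma \<kappa> (- V))"
      by metis
  qed
  finally have H: "H \<in> sets (env_sigma \<kappa> (- V))" .
  have Aeq: "{\<omega> \<in> space \<P>. block_bad i1 R l N \<omega> x} = {\<omega> \<in> space \<P>. restrict \<omega> ?D \<in> E x}"
    unfolding space_P using E(2) by blast
  have lsb: "0 \<le> lattice_sum_bound CARD('d) (g / 2)" using Cg by (simp add: lattice_sum_bound_def)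
  have "(\<Sum>\<^sub>\<infinity>(x, y)\<in>?D \<times> (- V). exp (- g * real_of_int (l1 (x - y)))) \<le>
      real (card ?D) * (exp (- (g / 2) * N) * lattice_sum_bound CARD('d) (g / 2))"
    using far by (intro infsum_exp_le Cg finD)
  also have "\<dots> \<le> (4 * real CARD('d) * N ^ 3 + 1) ^ CARD('d) * (exp (- (g / 2) * N) * lattice_sum_bound CARD('d) (g / 2))"
    using lsb by (intro mult_right_mono cardD mult_nonneg_nonneg) auto
  finally have \<Gamma>: "exp (C * (\<Sum>\<^sub>\<infinity>(x, y)\<in>?D \<times> (- V). exp (- g * real_of_int (l1 (x - y))))) \<le> mixing_constant CARD('d) C g N"
    unfolding mixing_constant_def exp_le_cancel_iff using Cg by (intro mult_left_mono) auto
  have "{\<omega> \<in> space \<P>. \<forall>y\<in>insert x S. block_bad i1 R l N \<omega> y} = {\<omega> \<in> space \<P>. restrict \<omega> ?D \<in> E x} \<inter> H"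
    using Aeq by (auto simp: H_def)
  then have "measure \<P> {\<omega> \<in> space \<P>. \<forall>y\<in>insert x S. block_bad i1 R l N \<omega> y} \<le>
      mixing_constant CARD('d) C g N * measure \<P> {\<omega> \<in> space \<P>. restrict \<omega> ?D \<in> E x} * measure \<P> H"
    using SMG_decoupling[OF re smg finV DV rd E(1) H \<Gamma>] by simp
  also have "\<dots> = (mixing_constant CARD('d) C g N * bad_prob) * measure \<P> H"
    unfolding Aeq[symmetric] block_bad_stationary ..
  also have "\<dots> \<le> (mixing_constant CARD('d) C g N * bad_prob) * (mixing_constant CARD('d) C g N * bad_prob) ^ card S"
  proof (rule mult_left_mono)
    show "measure \<P> H \<le> (mixing_constant CARD('d) C g N * bad_prob) ^ card S"
      unfolding H_def using insert.IH insert.prems by (simp add: pairwise_insert)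
  qed (simp add: mixing_constant_def bad_prob_def)
  finally show ?case using insert.hyps by simp
qed

text \<open>A union bound over the sets of \<open>K\<close> separated sites, of which there are at most the \<open>K\<close>-th power of
  the number of sites.\<close>

lemma rich_prob:
  shows "{\<omega> \<in> space \<P>. rich i1 R l N K \<omega>} \<in> sets \<P>"
    and "measure \<P> {\<omega> \<in> space \<P>. rich i1 R l N K \<omega>} \<le>
      ((6 * real CARD('d) * N ^ 7 + 1) ^ CARD('d) * (mixing_constant CARD('d) C g N * bad_prob)) ^ K"
proof -
  interpret prob_space \<P> by (rule prob_P)
  let ?B = "big_box i1 R N" and ?S = "separated_sets i1 R N K" and ?p = "mixing_constant CARD('d) C g N * bad_prob"
  let ?A = "\<lambda>S. {\<omega> \<in> space \<P>. \<forall>x\<in>S. block_bad i1 R l N \<omega> x}"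
  have finB: "finite ?B" by (rule finite_big_box(2)[OF R N(1)])
  have sub: "?S \<subseteq> {S. S \<subseteq> ?B \<and> card S = K}" by (auto simp: separated_sets_def)
  have fin: "finite {S. S \<subseteq> ?B \<and> card S = K}" using finB by simp
  have finS: "finite ?S" using finite_subset[OF sub fin] .
  have Sfin: "finite S" if "S \<in> ?S" for S using that finB by (auto simp: separated_sets_def intro: finite_subset)
  have eq: "{\<omega> \<in> space \<P>. rich i1 R l N K \<omega>} = (\<Union>S\<in>?S. ?A S)" by (auto simp: rich_def)
  have A: "?A S \<in> sets \<P>" if "S \<in> ?S" for S
    using Sfin[OF that] sets_block_bad by (intro sets.sets_Collect_finite_All) auto
  show "{\<omega> \<in> space \<P>. rich i1 R l N K \<omega>} \<in> sets \<P>" unfolding eq using finS A by (intro sets.finite_UN) auto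
  have p0: "0 \<le> ?p" by (simp add: mixing_constant_def bad_prob_def)
  have "card ?S \<le> card ?B choose K"
    using card_mono[OF fin sub] n_subsets[OF finB, of K] by simp
  also have "\<dots> \<le> (card ?B choose K) * fact K" by simp
  also have "\<dots> \<le> card ?B ^ K" by (rule binomial_fact_pow)
  finally have cS: "real (card ?S) \<le> real (card ?B) ^ K" by (metis of_nat_le_iff of_nat_power)
  have "card ?B \<le> card (cube (3 * real CARD('d) * N ^ 7) :: (int ^ 'd) set)"
    using N by (intro card_mono cube_bound finite_big_box(1)[OF R]) auto
  then have "real (card ?B) \<le> real (card (cube (3 * real CARD('d) * N ^ 7) :: (int ^ 'd) set))" by simp
  also have "\<dots> \<le> (2 * (3 * real CARD('d) * N ^ 7) + 1) ^ CARD('d)" using N by (intro cube_bound(2)) auto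
  finally have cB: "real (card ?B) \<le> (6 * real CARD('d) * N ^ 7 + 1) ^ CARD('d)" by (simp add: mult.assoc)
  have "measure \<P> {\<omega> \<in> space \<P>. rich i1 R l N K \<omega>} \<le> (\<Sum>S\<in>?S. measure \<P> (?A S))"
    unfolding eq using finS A by (intro finite_measure_subadditive_finite) auto
  also have "\<dots> \<le> (\<Sum>S\<in>?S. ?p ^ K)"
  proof (rule sum_mono)
    fix S assume S: "S \<in> ?S"
    then show "measure \<P> (?A S) \<le> ?p ^ K"
      using separated_bad_prob[OF Sfin[OF S]] by (auto simp: separated_sets_def)
  qed
  also have "\<dots> = real (card ?S) * ?p ^ K" by simp
  also have "\<dots> \<le> real (card ?B) ^ K * ?p ^ K" using cS p0 by (intro mult_right_mono) auto
  also have "\<dots> \<le> ((6 * real CARD('d) * N ^ 7 + 1) ^ CARD('d)) ^ K * ?p ^ K"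
    using cB p0 by (intro mult_right_mono power_mono) auto
  finally show "measure \<P> {\<omega> \<in> space \<P>. rich i1 R l N K \<omega>} \<le> ((6 * real CARD('d) * N ^ 7 + 1) ^ CARD('d) * ?p) ^ K"
    by (simp add: power_mult_distrib)
qed

end

section \<open>Choice of the scale\<close>

lemma exp_minus_1_le: "exp (- 1 :: real) \<le> 1 / 2"
proof -
  have "2 \<le> exp (1 :: real)" using exp_ge_add_one_self[of 1] by simp
  then show ?thesis by (simp add: exp_minus field_simps)
qed

lemma climb_steps_le:
  assumes "0 < d" "0 \<le> x"
  shows "real (climb_steps d x) \<le> real d * x + 1"
proof -
  have "sqrt (real d) \<le> real d" using assms by (intro real_le_lsqrt) (auto simp: power2_eq_square)
  then have "sqrt (real d) * x \<le> real d * x" using assms by (intro mult_right_mono) auto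
  moreover have "0 \<le> sqrt (real d) * x" using assms by simp
  ultimately show ?thesis unfolding climb_steps_def by linarith
qed

lemma double_dim_le:
  assumes "real d \<le> N"
  shows "2 * real d * exp x \<le> exp (2 * N + x)"
proof -
  have "2 * real d \<le> exp (2 * N)" using assms exp_ge_add_one_self[of "2 * N"] by linarith
  then show ?thesis unfolding exp_add by (intro mult_right_mono) auto
qed

text \<open>The left side decays like \<open>exp (- N ^ 3 / 4)\<close>, the right side only like \<open>exp (- O(N ^ 2 ln N))\<close>.\<close>

lemma eventually_margin:
  "\<forall>\<^sub>F N in at_top. 2 * real d * exp (6 * N\<^sup>2 + 10 - N ^ 3 / 4) \<le> (2 / N) ^ nat (2 * \<lfloor>N\<^sup>2\<rfloor> + 2)"
proof -
  have 1: "\<forall>\<^sub>F N::real in at_top. 2 * N + (6 * N\<^sup>2 + 10 - N ^ 3 / 4) \<le> - (2 * N\<^sup>2 + 2) * ln N"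
    by real_asymp
  show ?thesis
    using 1 eventually_ge_at_top[of "real d"] eventually_ge_at_top[of 1]
  proof eventually_elim
    case (elim N)
    let ?k = "nat (2 * \<lfloor>N\<^sup>2\<rfloor> + 2)"
    have k: "real ?k \<le> 2 * N\<^sup>2 + 2" by (simp add: of_nat_nat)
    have "2 * real d * exp (6 * N\<^sup>2 + 10 - N ^ 3 / 4) \<le> exp (2 * N + (6 * N\<^sup>2 + 10 - N ^ 3 / 4))"
      using elim by (intro double_dim_le)
    also have "\<dots> \<le> exp (- (2 * N\<^sup>2 + 2) * ln N)" using elim by simp
    also have "\<dots> \<le> exp (real ?k * - ln N)"
    proof -
      have "real ?k * ln N \<le> (2 * N\<^sup>2 + 2) * ln N" using k elim by (intro mult_right_mono) auto
      then show ?thesis unfolding exp_le_cancel_iff by linarith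
    qed
    also have "\<dots> = (1 / N) ^ ?k"
    proof -
      have "exp (- ln N) = 1 / N" using elim by (simp add: exp_minus inverse_eq_divide)
      then show ?thesis unfolding exp_of_nat_mult by simp
    qed
    also have "\<dots> \<le> (2 / N) ^ ?k" using elim by (intro power_mono divide_right_mono) auto
    finally show ?case .
  qed
qed

text \<open>The exponents are \<open>- N ^ 2 ln N\<close> for the slabs without bad sites and \<open>O(N ^ 2)\<close> for the others; half of the
  former is given away to absorb the latter.\<close>

lemma eventually_q_small:
  assumes d: "0 < d" and \<kappa>: "0 < \<kappa>" "2 * \<kappa> \<le> 1"
  shows "\<forall>\<^sub>F N in at_top. (real_of_int \<lfloor>N\<^sup>2\<rfloor> + 3) *
      ((2 / N) ^ (nat \<lfloor>N\<^sup>2\<rfloor> - 4 * nat \<lceil>N\<rceil>) * (2 / (2 * \<kappa>) ^ climb_steps d N) ^ (4 * nat \<lceil>N\<rceil>))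
      + 2 * real d * exp (6 * N\<^sup>2 + 10 - N ^ 3 / 4) \<le> exp (- (N\<^sup>2 * ln N / 2))"
proof -
  define lam where "lam = - ln (2 * \<kappa>)"
  have lam: "0 \<le> lam" "2 * \<kappa> = exp (- lam)" using \<kappa> by (auto simp: lam_def)
  have 1: "\<forall>\<^sub>F N::real in at_top. N\<^sup>2 + 3 + 4 * (N + 2) * (1 + (real d * N + 1) * lam) + N\<^sup>2 * ln N / 2
        \<le> (N\<^sup>2 - 4 * N - 9) * (ln N - 1)"
    by real_asymp
  have 2: "\<forall>\<^sub>F N::real in at_top. 2 * N + (6 * N\<^sup>2 + 10 - N ^ 3 / 4) \<le> - 1 - N\<^sup>2 * ln N / 2"
    by real_asymp
  show ?thesis
    using 1 2 eventually_ge_at_top[of "real d"] eventually_ge_at_top[of 3]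
  proof eventually_elim
    case (elim N)
    let ?K = "nat \<lceil>N\<rceil>" and ?m = "nat \<lfloor>N\<^sup>2\<rfloor> - 4 * nat \<lceil>N\<rceil>"
    have K: "real ?K \<le> N + 1" using elim by (simp add: of_nat_nat)
    have "real_of_int \<lfloor>N\<^sup>2\<rfloor> \<le> real (nat \<lfloor>N\<^sup>2\<rfloor>)" by (simp add: of_nat_nat)
    moreover have "real (nat \<lfloor>N\<^sup>2\<rfloor>) - 4 * real ?K \<le> real ?m" by linarith
    ultimately have m: "N\<^sup>2 - 4 * N - 9 \<le> real ?m" using K by linarith
    have lnN: "1 \<le> ln N"
    proof -
      have "exp 1 \<le> N" using elim exp_le by simp
      then show ?thesis using elim by (simp add: ln_ge_iff)
    qed
    have f1: "real_of_int \<lfloor>N\<^sup>2\<rfloor> + 3 \<le> exp (N\<^sup>2 + 2)"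
      using exp_ge_add_one_self[of "N\<^sup>2 + 2"] by linarith
    have ln2: "ln (2::real) \<le> 1" using ln_le_minus_one[of 2] by simp
    have f2: "(2 / N) ^ ?m \<le> exp (- ((N\<^sup>2 - 4 * N - 9) * (ln N - 1)))"
    proof -
      have "2 / N = exp (ln 2 - ln N)" using elim by (simp add: exp_diff)
      also have "\<dots> \<le> exp (- (ln N - 1))" using ln2 by simp
      finally have "(2 / N) ^ ?m \<le> exp (- (ln N - 1)) ^ ?m" using elim by (intro power_mono) auto
      also have "\<dots> = exp (- (real ?m * (ln N - 1)))"
        by (simp only: exp_of_nat_mult[symmetric] mult_minus_right)
      also have "\<dots> \<le> exp (- ((N\<^sup>2 - 4 * N - 9) * (ln N - 1)))"
        using mult_right_mono[OF m, of "ln N - 1"] lnN by simp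
      finally show ?thesis .
    qed
    have f3: "(2 / (2 * \<kappa>) ^ climb_steps d N) ^ (4 * ?K) \<le> exp (4 * (N + 2) * (1 + (real d * N + 1) * lam))"
    proof -
      have "(2 * \<kappa>) ^ climb_steps d N = exp (- (real (climb_steps d N) * lam))"
        unfolding lam(2) by (simp add: exp_of_nat_mult[symmetric])
      then have eq: "2 / (2 * \<kappa>) ^ climb_steps d N = 2 / exp (- (real (climb_steps d N) * lam))"
        by (rule arg_cong)
      also have "\<dots> = exp (ln 2 + real (climb_steps d N) * lam)"
        by (simp add: exp_add exp_minus divide_inverse)
      also have "\<dots> \<le> exp (1 + (real d * N + 1) * lam)"
        using ln2 climb_steps_le[OF d, of N] elim lam(1) by (simp add: add_mono mult_right_mono)
      finally have "(2 / (2 * \<kappa>) ^ climb_steps d N) ^ (4 * ?K) \<le> exp (1 + (real d * N + 1) * lam) ^ (4 * ?K)"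
        using \<kappa> by (intro power_mono) auto
      also have "\<dots> = exp (4 * real ?K * (1 + (real d * N + 1) * lam))" by (simp add: exp_of_nat_mult[symmetric])
      also have "\<dots> \<le> exp (4 * (N + 2) * (1 + (real d * N + 1) * lam))"
        unfolding exp_le_cancel_iff
      proof (rule mult_right_mono)
        show "4 * real ?K \<le> 4 * (N + 2)"
          by (intro mult_left_mono order_trans[OF K]) auto
      qed (use elim lam(1) in auto)
      finally show ?thesis .
    qed
    have "(real_of_int \<lfloor>N\<^sup>2\<rfloor> + 3) * ((2 / N) ^ ?m * (2 / (2 * \<kappa>) ^ climb_steps d N) ^ (4 * ?K)) \<le>
       exp (N\<^sup>2 + 2) * (exp (- ((N\<^sup>2 - 4 * N - 9) * (ln N - 1))) * exp (4 * (N + 2) * (1 + (real d * N + 1) * lam)))"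
      using f1 f2 f3 elim \<kappa> by (intro mult_mono) auto
    also have "\<dots> = exp (N\<^sup>2 + 2 + (- ((N\<^sup>2 - 4 * N - 9) * (ln N - 1)) + 4 * (N + 2) * (1 + (real d * N + 1) * lam)))"
      unfolding exp_add ..
    also have "\<dots> \<le> exp (- 1 - N\<^sup>2 * ln N / 2)" using elim(1) by simp
    finally have A: "(real_of_int \<lfloor>N\<^sup>2\<rfloor> + 3) * ((2 / N) ^ ?m * (2 / (2 * \<kappa>) ^ climb_steps d N) ^ (4 * ?K)) \<le>
       exp (- 1 - N\<^sup>2 * ln N / 2)" .
    have "2 * real d * exp (6 * N\<^sup>2 + 10 - N ^ 3 / 4) \<le> exp (2 * N + (6 * N\<^sup>2 + 10 - N ^ 3 / 4))"
      using elim by (intro double_dim_le)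
    also have "\<dots> \<le> exp (- 1 - N\<^sup>2 * ln N / 2)" using elim(2) by simp
    finally have B: "2 * real d * exp (6 * N\<^sup>2 + 10 - N ^ 3 / 4) \<le> exp (- 1 - N\<^sup>2 * ln N / 2)" .
    have "exp (- 1 - N\<^sup>2 * ln N / 2) = exp (- 1) * exp (- (N\<^sup>2 * ln N / 2))" by (simp flip: exp_add)
    also have "\<dots> \<le> 1 / 2 * exp (- (N\<^sup>2 * ln N / 2))" by (intro mult_right_mono exp_minus_1_le) auto
    finally show ?case using A B by simp
  qed
qed

lemma eventually_mixing:
  assumes "0 < g"
  shows "\<forall>\<^sub>F N in at_top. mixing_constant d C g N \<le> 3"
proof -
  define M where "M = \<bar>C * (4 * real d + 1) ^ d * lattice_sum_bound d (g / 2)\<bar>"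
  have 1: "\<forall>\<^sub>F N::real in at_top. M * (N ^ (3 * d) * exp (- (g / 2) * N)) \<le> 1"
    using assms by real_asymp
  show ?thesis
    using 1 eventually_ge_at_top[of 1]
  proof eventually_elim
    case (elim N)
    have "(4 * real d * N ^ 3 + 1) ^ d \<le> ((4 * real d + 1) * N ^ 3) ^ d"
      using elim by (intro power_mono) (auto simp: algebra_simps)
    also have "\<dots> = (4 * real d + 1) ^ d * N ^ (3 * d)" by (simp add: power_mult_distrib power_mult)
    finally have p: "(4 * real d * N ^ 3 + 1) ^ d \<le> (4 * real d + 1) ^ d * N ^ (3 * d)" .
    have "C * ((4 * real d * N ^ 3 + 1) ^ d * (exp (- (g / 2) * N) * lattice_sum_bound d (g / 2))) \<le>
        \<bar>C * lattice_sum_bound d (g / 2)\<bar> * ((4 * real d * N ^ 3 + 1) ^ d * exp (- (g / 2) * N))"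
    proof -
      have "C * ((4 * real d * N ^ 3 + 1) ^ d * (exp (- (g / 2) * N) * lattice_sum_bound d (g / 2))) =
          (C * lattice_sum_bound d (g / 2)) * ((4 * real d * N ^ 3 + 1) ^ d * exp (- (g / 2) * N))" by simp
      also have "\<dots> \<le> \<bar>C * lattice_sum_bound d (g / 2)\<bar> * ((4 * real d * N ^ 3 + 1) ^ d * exp (- (g / 2) * N))"
        using elim by (intro mult_right_mono) auto
      finally show ?thesis .
    qed
    also have "\<dots> \<le> \<bar>C * lattice_sum_bound d (g / 2)\<bar> * ((4 * real d + 1) ^ d * N ^ (3 * d) * exp (- (g / 2) * N))"
      using p by (intro mult_left_mono mult_right_mono) auto
    also have "\<dots> = M * (N ^ (3 * d) * exp (- (g / 2) * N))" by (simp add: M_def abs_mult)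
    also have "\<dots> \<le> 1" by fact
    finally have "mixing_constant d C g N \<le> exp 1" unfolding mixing_constant_def by simp
    also have "\<dots> \<le> 3" using exp_le by simp
    finally show ?case .
  qed
qed

text \<open>The exponent \<open>40 d / N ^ 2\<close> turns \<open>exp (- N ^ 2 ln N / 2)\<close> into \<open>N ^ (- 20 d)\<close> and the trivial bound
  \<open>exp (O(N ^ 3))\<close> for \<open>\<rho>\<close> into \<open>exp (O(N))\<close>, which the probability \<open>N ^ (- 2 N)\<close> of the rare event compensates.\<close>

lemma moment_bound:
  fixes \<P> :: "'d::finite env measure" and \<kappa> C g r J N :: real
  defines "d \<equiv> CARD('d)" and "lam \<equiv> - ln (2 * \<kappa>)"
  assumes re: "random_environment \<kappa> \<P>" and smg: "SMG \<kappa> r C g \<P>" and \<kappa>: "0 < \<kappa>" "2 * \<kappa> \<le> 1"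
    and R: "rotation_to i1 R l" and Cg: "0 < C" "0 < g" and J: "9 * real d < J" and d: "2 \<le> d"
    and pc: "polynomial_condition \<P> i1 R l J N"
    and N: "40 \<le> N" "real d \<le> N" "r \<le> N" "3 * (7 * real d) ^ d \<le> N"
    and margin: "2 * real d * exp (6 * N\<^sup>2 + 10 - N ^ 3 / 4) \<le> (2 / N) ^ nat (2 * \<lfloor>N\<^sup>2\<rfloor> + 2)"
    and q_small: "(real_of_int \<lfloor>N\<^sup>2\<rfloor> + 3) *
      ((2 / N) ^ (nat \<lfloor>N\<^sup>2\<rfloor> - 4 * nat \<lceil>N\<rceil>) * (2 / (2 * \<kappa>) ^ climb_steps d N) ^ (4 * nat \<lceil>N\<rceil>))
      + 2 * real d * exp (6 * N\<^sup>2 + 10 - N ^ 3 / 4) \<le> exp (- (N\<^sup>2 * ln N / 2))"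
    and mix: "mixing_constant d C g N \<le> 3"
  shows "(\<integral>\<^sup>+\<omega>. ennreal (\<rho>_box \<omega> i1 l R (N ^ 3 - 2) (N ^ 3 + 2) (N ^ 7) powr (40 * real d / N\<^sup>2)) \<partial>\<P>) \<le>
    ennreal (2 * exp (- (20 * real d * ln N)) + exp (120 * (real d)\<^sup>2 * lam * N - 2 * N * ln N))"
proof -
  have P: "prob_space \<P>" and sP: "sets \<P> = sets (conf_space \<kappa> UNIV)" using re by (auto simp: random_environment_def)
  interpret prob_space \<P> by (rule P)
  have spP: "space \<P> = space (conf_space \<kappa> UNIV)" using sets_eq_imp_space_eq[OF sP] .
  have N0: "0 < N" "1 \<le> N" "16 \<le> N" using N by auto
  have lam: "0 \<le> lam" "2 * \<kappa> = exp (- lam)" using \<kappa> by (auto simp: lam_def)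
  define K where "K = nat \<lceil>N\<rceil>"
  have K: "0 < K" "real K \<le> N + 1" "N \<le> real K" using N0 by (auto simp: K_def of_nat_nat)
  define a where "a = 40 * real d / N\<^sup>2"
  have a: "0 < a" "a \<le> 1"
  proof -
    show "0 < a" using d N0 by (simp add: a_def)
    have "40 * real d \<le> N * N" using N by (intro mult_mono) auto
    then show "a \<le> 1" using N0 by (simp add: a_def power2_eq_square)
  qed
  let ?rich = "{\<omega> \<in> space \<P>. rich i1 R l N K \<omega>}"
  let ?\<rho> = "\<lambda>\<omega>. \<rho>_box \<omega> i1 l R (N ^ 3 - 2) (N ^ 3 + 2) (N ^ 7)"
  let ?q = "\<lambda>\<omega>. q_box \<omega> i1 l R (N ^ 3 - 2) (N ^ 3 + 2) (N ^ 7)"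
  let ?p = "\<lambda>\<omega>. p_box \<omega> i1 l R (N ^ 3 - 2) (N ^ 3 + 2) (N ^ 7)"
  have pq: "?p \<omega> = 1 - ?q \<omega>" for \<omega>
    using fail_prob_compl[of \<omega> 0 "big_box i1 R N" "big_front i1 R l N"] by (simp only: p_box_def q_box_def fail_prob_def)
  have q01: "0 \<le> ?q \<omega>" "?q \<omega> \<le> 1" for \<omega>
    using fail_prob_nonneg[of \<omega> "big_box i1 R N" "big_front i1 R l N" 0]
      fail_prob_le_1[of \<omega> "big_box i1 R N" "big_front i1 R l N" 0] by (simp_all only: q_box_def fail_prob_def)
  have rich_bound: "measure \<P> ?rich \<le> exp (- (2 * N * ln N))"
  proof -
    let ?b = "bad_prob \<P> N i1 R l" and ?c = "mixing_constant d C g N"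
    have b0: "0 \<le> ?b" by (simp add: bad_prob_def[OF re smg \<kappa>(1) R N0(2) N(3) Cg])
    have "(6 * real d * N ^ 7 + 1) ^ d \<le> (7 * real d * N ^ 7) ^ d"
    proof (rule power_mono)
      have "1 * 1 \<le> real d * N ^ 7" using d N0 by (intro mult_mono) auto
      then show "6 * real d * N ^ 7 + 1 \<le> 7 * real d * N ^ 7" by simp
    qed (use N0 in auto)
    also have "\<dots> = (7 * real d) ^ d * N ^ (7 * d)" by (simp add: power_mult_distrib power_mult)
    finally have c1: "(6 * real d * N ^ 7 + 1) ^ d \<le> (7 * real d) ^ d * N ^ (7 * d)" .
    have b: "?b \<le> N * N powr (- J)" by (rule bad_prob_le[OF re smg \<kappa>(1) R N0(2) N(3) Cg pc])
    \<comment> \<open>one factor N absorbs the constant 3 (7 d)^d, and 2 + 7 d - J is below -2 because J > 9 d and d is at least 2\<close>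
    have "(6 * real d * N ^ 7 + 1) ^ d * (?c * ?b) \<le> ((7 * real d) ^ d * N ^ (7 * d)) * (3 * (N * N powr (- J)))"
      using c1 mix b b0 N0 by (intro mult_mono) (auto simp: mixing_constant_def)
    also have "\<dots> = (3 * (7 * real d) ^ d) * (N ^ (7 * d) * N * N powr (- J))" by simp
    also have "\<dots> \<le> N * (N ^ (7 * d) * N * N powr (- J))" using N N0 by (intro mult_right_mono) auto
    also have "\<dots> = N powr (2 + 7 * real d - J)"
    proof -
      have "N ^ (7 * d) = N powr (7 * real d)" using N0 by (simp add: powr_realpow[symmetric])
      then show ?thesis using N0 by (simp add: powr_add powr_diff powr_minus field_simps power2_eq_square powr_numeral)
    qed
    also have "\<dots> \<le> N powr (- 2)" using J d N0 by (intro powr_mono) auto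
    finally have base: "(6 * real d * N ^ 7 + 1) ^ d * (?c * ?b) \<le> N powr (- 2)" .
    have "measure \<P> ?rich \<le> ((6 * real d * N ^ 7 + 1) ^ d * (?c * ?b)) ^ K"
      unfolding d_def by (rule rich_prob(2)[OF re smg \<kappa>(1) R N0(2) N(3) Cg])
    also have "\<dots> \<le> (N powr (- 2)) ^ K"
      using base b0 N0 by (intro power_mono) (auto simp: mixing_constant_def)
    also have "\<dots> = exp (- (2 * real K * ln N))"
      using N0 by (simp add: powr_def exp_of_nat_mult[symmetric])
    also have "\<dots> \<le> exp (- (2 * N * ln N))" using K(3) N0 by (simp add: mult_right_mono)
    finally show ?thesis .
  qed
  have good: "?\<rho> \<omega> powr a \<le> 2 * exp (- (20 * real d * ln N))" if \<omega>: "\<omega> \<in> space \<P>" "\<not> rich i1 R l N K \<omega>" for \<omega>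
  proof -
    let ?e = "exp (- (N\<^sup>2 * ln N / 2))"
    have el: "elliptic \<kappa> \<omega>" using \<omega>(1) elliptic_conf unfolding spP by blast
    have "?q \<omega> \<le> ?e"
      using q_box_bound[OF el \<kappa> R N0(3) _ K(1,2) \<omega>(2)] margin q_small N(2) unfolding d_def K_def by linarith
    moreover have "?e \<le> 1 / 2"
    proof -
      have "ln 2 \<le> ln N" using N0 by simp
      moreover have "1 / 2 \<le> ln (2::real)" using ln2_ge_two_thirds by simp
      ultimately have "1 / 2 \<le> ln N" by linarith
      then have "16 * (1 / 2) \<le> N * ln N" using N0 by (intro mult_mono) auto
      moreover have "N * ln N \<le> N\<^sup>2 * ln N" using \<open>1 / 2 \<le> ln N\<close> N0 by (intro mult_right_mono) (auto simp: power2_eq_square)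
      ultimately have "?e \<le> exp (- 1)" by simp
      then show ?thesis using exp_minus_1_le by linarith
    qed
    ultimately have q: "?q \<omega> \<le> ?e" "1 / 2 \<le> ?p \<omega>" using pq[of \<omega>] by auto
    have "?\<rho> \<omega> \<le> ?e / (1 / 2)" unfolding \<rho>_box_def using q q01 by (intro frac_le) auto
    then have "?\<rho> \<omega> powr a \<le> (2 * ?e) powr a"
      using q01[of \<omega>] q(2) a by (intro powr_mono2) (auto simp: \<rho>_box_def)
    also have "\<dots> = 2 powr a * ?e powr a" by (simp add: powr_mult)
    also have "\<dots> \<le> 2 * exp (- (20 * real d * ln N))"
    proof (rule mult_mono)
      show "2 powr a \<le> 2" using powr_mono[OF a(2), of 2] by simp
      have "?e powr a = exp (- (20 * real d * ln N))" using N0 by (simp add: powr_def a_def field_simps)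
      then show "?e powr a \<le> exp (- (20 * real d * ln N))" by simp
    qed auto
    finally show ?thesis .
  qed
  have all: "?\<rho> \<omega> powr a \<le> exp (120 * (real d)\<^sup>2 * lam * N)" if \<omega>: "\<omega> \<in> space \<P>" for \<omega>
  proof -
    have el: "elliptic \<kappa> \<omega>" using \<omega>(1) elliptic_conf unfolding spP by blast
    let ?n = "climb_steps d (N ^ 3 + 2)"
    have n: "real ?n \<le> 3 * real d * N ^ 3"
    proof -
      have "real ?n \<le> real d * (N ^ 3 + 2) + 1" using d N0 by (intro climb_steps_le) auto
      also have "\<dots> \<le> real d * (N ^ 3 + 2) + real d * 1" using d by simp
      also have "\<dots> = real d * (N ^ 3 + 3)" by (simp add: algebra_simps)
      also have "\<dots> \<le> real d * (3 * N ^ 3)"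
      proof (rule mult_left_mono)
        have "16 ^ 3 \<le> N ^ 3" using N0 by (intro power_mono) auto
        then show "N ^ 3 + 3 \<le> 3 * N ^ 3" by simp
      qed simp
      finally show ?thesis by simp
    qed
    have "exp (- (3 * real d * N ^ 3 * lam)) \<le> exp (- (real ?n * lam))"
      using n lam(1) by (simp add: mult_right_mono)
    also have "\<dots> = (2 * \<kappa>) ^ ?n" unfolding lam(2) by (simp add: exp_of_nat_mult[symmetric])
    also have "\<dots> \<le> ?p \<omega>" using p_box_lower[OF el \<kappa> R N0(3)] N(2) by (simp add: d_def)
    finally have p: "exp (- (3 * real d * N ^ 3 * lam)) \<le> ?p \<omega>" .
    have "?\<rho> \<omega> \<le> 1 / exp (- (3 * real d * N ^ 3 * lam))"
      unfolding \<rho>_box_def using p q01 by (intro frac_le) auto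
    then have "?\<rho> \<omega> \<le> exp (3 * real d * N ^ 3 * lam)" by (simp add: exp_minus field_simps)
    moreover have "0 \<le> ?\<rho> \<omega>" unfolding \<rho>_box_def using q01 pq by (intro divide_nonneg_nonneg) auto
    ultimately have "?\<rho> \<omega> powr a \<le> exp (3 * real d * N ^ 3 * lam) powr a" using a by (intro powr_mono2) auto
    also have "\<dots> = exp (120 * (real d)\<^sup>2 * lam * N)"
      using N0 by (simp add: powr_def a_def field_simps power2_eq_square power3_eq_cube)
    finally show ?thesis .
  qed
  have rs: "?rich \<in> sets \<P>" by (rule rich_prob(1)[OF re smg \<kappa>(1) R N0(2) N(3) Cg])
  have "(\<integral>\<^sup>+\<omega>. ennreal (?\<rho> \<omega> powr a) \<partial>\<P>) \<le>
     (\<integral>\<^sup>+\<omega>. ennreal (2 * exp (- (20 * real d * ln N))) + ennreal (exp (120 * (real d)\<^sup>2 * lam * N)) * indicator ?rich \<omega> \<partial>\<P>)"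
  proof (rule nn_integral_mono)
    fix \<omega> assume \<omega>: "\<omega> \<in> space \<P>"
    show "ennreal (?\<rho> \<omega> powr a) \<le>
      ennreal (2 * exp (- (20 * real d * ln N))) + ennreal (exp (120 * (real d)\<^sup>2 * lam * N)) * indicator ?rich \<omega>"
    proof (cases "rich i1 R l N K \<omega>")
      case True
      then show ?thesis using all[OF \<omega>] \<omega> by (auto intro!: add_increasing ennreal_leI)
    next
      case False
      then show ?thesis using good[OF \<omega>] by (auto intro!: ennreal_leI)
    qed
  qed
  also have "\<dots> = ennreal (2 * exp (- (20 * real d * ln N))) + ennreal (exp (120 * (real d)\<^sup>2 * lam * N)) * emeasure \<P> ?rich"
    using rs by (subst nn_integral_add) (auto simp: nn_integral_cmult_indicator emeasure_space_1)
  also have "\<dots> = ennreal (2 * exp (- (20 * real d * ln N)) + exp (120 * (real d)\<^sup>2 * lam * N) * measure \<P> ?rich)"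
    by (simp add: emeasure_eq_measure ennreal_mult ennreal_plus)
  also have "\<dots> \<le> ennreal (2 * exp (- (20 * real d * ln N)) + exp (120 * (real d)\<^sup>2 * lam * N) * exp (- (2 * N * ln N)))"
    using rich_bound by (intro ennreal_leI add_left_mono mult_left_mono) auto
  also have "exp (120 * (real d)\<^sup>2 * lam * N) * exp (- (2 * N * ln N)) = exp (120 * (real d)\<^sup>2 * lam * N - 2 * N * ln N)"
    by (simp flip: exp_add)
  finally show ?thesis by (simp add: a_def)
qed

theorem theorem4p1:
  fixes \<kappa> C g r J C' C'' :: real
  assumes "CARD('d::finite) \<ge> 2"
    and "0 < \<kappa>" and "\<kappa> < 1 / (4 * real CARD('d))"
    and "C > 0" and "g > 0" and "r \<ge> 1"
    and "J > 9 * real CARD('d)"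
    and "C' > 3 * sqrt CARD('d)" and "C'' > 3 * sqrt CARD('d)"
  shows "\<exists>Nbar::real. \<forall>(\<P>::'d env measure) (i1::'d) (l::real ^ 'd) (R::real ^ 'd ^ 'd) (N0::real).
           random_environment \<kappa> \<P> \<longrightarrow> SMG \<kappa> r C g \<P> \<longrightarrow>
           l \<in> sphere 0 1 \<longrightarrow> rotation_to i1 R l \<longrightarrow>
           admissible CARD('d) \<kappa> N0 \<longrightarrow> N0 \<ge> Nbar \<longrightarrow>
           polynomial_condition \<P> i1 R l J N0 \<longrightarrow>
           effective_criterion C' C'' \<P> i1 l"
proof -
  define d where "d = CARD('d)"
  define lam where "lam = - ln (2 * \<kappa>)"
  have d: "2 \<le> d" using assms(1) by (simp add: d_def)
  have C'0: "0 < C'" using assms(8) by (rule order_le_less_trans[rotated]) simp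
  have \<kappa>: "2 * \<kappa> \<le> 1"
  proof -
    have "1 / (4 * real CARD('d)) \<le> 1 / 2" using assms(1) by (intro frac_le) auto
    then show ?thesis using assms(3) by linarith
  qed
  have "\<forall>\<^sub>F N in at_top. C' + 1 + 19 * real d * ln N + 120 * (real d)\<^sup>2 * lam * N < 2 * N * ln N"
    by real_asymp
  moreover have "\<forall>\<^sub>F N::real in at_top. C'' < N ^ 3" by real_asymp
  ultimately have "\<forall>\<^sub>F N in at_top. 40 \<le> N \<and> real d \<le> N \<and> r \<le> N \<and> 3 * (7 * real d) ^ d \<le> N \<and> 4 * C' < N \<and> C'' < N ^ 3 \<and>
      2 * real d * exp (6 * N\<^sup>2 + 10 - N ^ 3 / 4) \<le> (2 / N) ^ nat (2 * \<lfloor>N\<^sup>2\<rfloor> + 2) \<and>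
      (real_of_int \<lfloor>N\<^sup>2\<rfloor> + 3) *
      ((2 / N) ^ (nat \<lfloor>N\<^sup>2\<rfloor> - 4 * nat \<lceil>N\<rceil>) * (2 / (2 * \<kappa>) ^ climb_steps d N) ^ (4 * nat \<lceil>N\<rceil>))
      + 2 * real d * exp (6 * N\<^sup>2 + 10 - N ^ 3 / 4) \<le> exp (- (N\<^sup>2 * ln N / 2)) \<and>
      mixing_constant d C g N \<le> 3 \<and>
      C' + 1 + 19 * real d * ln N + 120 * (real d)\<^sup>2 * lam * N < 2 * N * ln N"
    (is "eventually ?large _")
    using eventually_margin[of d] eventually_q_small[of d \<kappa>] eventually_mixing[OF assms(5), of d C] d assms(2) \<kappa>
    by (intro eventually_conj eventually_ge_at_top eventually_gt_at_top) auto
  then obtain Nbar where Nbar: "\<And>N. Nbar \<le> N \<Longrightarrow> ?large N"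
    unfolding eventually_at_top_linorder by blast
  show ?thesis
  proof (intro exI[of _ Nbar] allI impI)
    fix \<P> :: "'d env measure" and i1 :: 'd and l :: "real ^ 'd" and R :: "real ^ 'd ^ 'd" and N :: real
    assume re: "random_environment \<kappa> \<P>" and smg: "SMG \<kappa> r C g \<P>" and R: "rotation_to i1 R l"
      and N: "Nbar \<le> N" and pc: "polynomial_condition \<P> i1 R l J N"
    note large = Nbar[OF N]
    have N0: "0 < N" "1 < N" "40 \<le> N" using large by auto
    define a where "a = 40 * real d / N\<^sup>2"
    have a: "0 < a" "a \<le> 1"
    proof -
      show "0 < a" using d N0 by (simp add: a_def)
      have "40 * real d \<le> N * N" using large by (intro mult_mono) auto
      then show "a \<le> 1" using N0 by (simp add: a_def power2_eq_square)
    qed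
    let ?I = "\<integral>\<^sup>+\<omega>. ennreal (\<rho>_box \<omega> i1 l R (N ^ 3 - 2) (N ^ 3 + 2) (N ^ 7) powr a) \<partial>\<P>"
    have I: "?I \<le> ennreal (2 * exp (- (20 * real d * ln N)) + exp (120 * (real d)\<^sup>2 * lam * N - 2 * N * ln N))"
      unfolding a_def d_def lam_def
      by (rule moment_bound[OF re smg assms(2) \<kappa> R assms(4,5,7) assms(1) pc])
        (use large in \<open>simp_all only: d_def\<close>)
    define w where "w = C' * (N ^ 7) ^ (d - 1) * (N ^ 3) ^ (4 * (d - 1) + 1)"
    have w0: "0 \<le> w" using C'0 N0 by (simp add: w_def)
    have w: "w \<le> C' * exp (19 * real d * ln N)"
    proof -
      have "(N ^ 7) ^ (d - 1) * (N ^ 3) ^ (4 * (d - 1) + 1) = N ^ (7 * (d - 1) + 3 * (4 * (d - 1) + 1))"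
        by (simp only: power_mult power_add)
      also have "\<dots> \<le> N ^ (19 * d)" using d N0 by (intro power_increasing) auto
      also have "\<dots> = exp (19 * real d * ln N)"
        using N0 by (simp add: powr_realpow[symmetric] powr_def)
      finally show ?thesis unfolding w_def mult.assoc using C'0 by (intro mult_left_mono) auto
    qed
    have "w * (2 * exp (- (20 * real d * ln N)) + exp (120 * (real d)\<^sup>2 * lam * N - 2 * N * ln N)) \<le>
       C' * exp (19 * real d * ln N) * (2 * exp (- (20 * real d * ln N)) + exp (120 * (real d)\<^sup>2 * lam * N - 2 * N * ln N))"
      by (intro mult_right_mono w add_nonneg_nonneg) auto
    also have "\<dots> = 2 * C' * exp (- (real d * ln N)) + C' * exp (19 * real d * ln N + 120 * (real d)\<^sup>2 * lam * N - 2 * N * ln N)"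
    proof -
      have "exp (19 * real d * ln N) * exp (- (20 * real d * ln N)) = exp (- (real d * ln N))"
        by (simp flip: exp_add)
      moreover have "exp (19 * real d * ln N) * exp (120 * (real d)\<^sup>2 * lam * N - 2 * N * ln N) =
          exp (19 * real d * ln N + 120 * (real d)\<^sup>2 * lam * N - 2 * N * ln N)" by (simp flip: exp_add)
      ultimately show ?thesis by (simp add: algebra_simps)
    qed
    also have "\<dots> < 1 / 2 + 1 / 2"
    proof (rule add_less_le_mono)
      have "exp (- (real d * ln N)) \<le> exp (- ln N)"
        using d N0 mult_right_mono[of 1 "real d" "ln N"] by simp
      also have "\<dots> = 1 / N" using N0 by (simp add: exp_minus inverse_eq_divide)
      finally have "2 * C' * exp (- (real d * ln N)) \<le> 2 * C' * (1 / N)" using C'0 by (intro mult_left_mono) auto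
      also have "\<dots> < 1 / 2" using large N0 by (simp add: field_simps)
      finally show "2 * C' * exp (- (real d * ln N)) < 1 / 2" .
      have "C' * exp (19 * real d * ln N + 120 * (real d)\<^sup>2 * lam * N - 2 * N * ln N) \<le>
          exp C' * exp (19 * real d * ln N + 120 * (real d)\<^sup>2 * lam * N - 2 * N * ln N)"
      proof (rule mult_right_mono)
        show "C' \<le> exp C'" using exp_ge_add_one_self[of C'] by linarith
      qed simp
      also have "\<dots> = exp (C' + (19 * real d * ln N + 120 * (real d)\<^sup>2 * lam * N - 2 * N * ln N))" by (simp add: exp_add)
      also have "\<dots> \<le> exp (- 1)" using large by simp
      also have "\<dots> \<le> 1 / 2" by (rule exp_minus_1_le)
      finally show "C' * exp (19 * real d * ln N + 120 * (real d)\<^sup>2 * lam * N - 2 * N * ln N) \<le> 1 / 2" .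
    qed
    finally have lt: "w * (2 * exp (- (20 * real d * ln N)) + exp (120 * (real d)\<^sup>2 * lam * N - 2 * N * ln N)) < 1" by simp
    have "ennreal w * ?I \<le> ennreal w * ennreal (2 * exp (- (20 * real d * ln N)) + exp (120 * (real d)\<^sup>2 * lam * N - 2 * N * ln N))"
      by (intro mult_left_mono I) simp
    also have "\<dots> = ennreal (w * (2 * exp (- (20 * real d * ln N)) + exp (120 * (real d)\<^sup>2 * lam * N - 2 * N * ln N)))"
      using w0 by (subst ennreal_mult) auto
    also have "\<dots> < 1" using lt by (simp add: ennreal_less_one_iff)
    finally have less: "ennreal w * ?I < 1" .
    have adm: "box_specification i1 l R (N ^ 3 - 2) (N ^ 3 + 2) (N ^ 7)" "N ^ 7 < (N ^ 3) ^ 4" "N ^ 3 < N ^ 7" "C'' < N ^ 3"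
    proof -
      have sq: "sqrt (real d) \<le> N"
      proof -
        have "real d \<le> N * 1" using large by simp
        also have "\<dots> \<le> N * N" using N0 by (intro mult_left_mono) auto
        finally show ?thesis using N0 by (intro real_le_lsqrt) (auto simp: power2_eq_square)
      qed
      have "40 * 1 \<le> N * N" using N0 by (intro mult_mono) auto
      then have "40 * N \<le> N * N * N" using N0 by (intro mult_right_mono) auto
      then have n3: "3 * sqrt (real d) < N ^ 3 - 2" using sq N0 unfolding power3_eq_cube by linarith
      show p37: "N ^ 3 < N ^ 7" using N0 by (intro power_strict_increasing) auto
      show "box_specification i1 l R (N ^ 3 - 2) (N ^ 3 + 2) (N ^ 7)"
        using R n3 p37 unfolding box_specification_def d_def by auto
      have "N ^ 7 < N ^ 12" using N0 by (intro power_strict_increasing) auto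
      then show "N ^ 7 < (N ^ 3) ^ 4" by (simp flip: power_mult)
      show "C'' < N ^ 3" using large by blast
    qed
    show "effective_criterion C' C'' \<P> i1 l"
      unfolding effective_criterion_def INF_less_iff
    proof (rule bexI[of _ "(R, N ^ 3, N ^ 7, a)"])
      show "(case (R, N ^ 3, N ^ 7, a) of (R, L, Lt, a) \<Rightarrow>
          ennreal (C' * Lt ^ (CARD('d) - 1) * L ^ (4 * (CARD('d) - 1) + 1)) *
          (\<integral>\<^sup>+\<omega>. ennreal (\<rho>_box \<omega> i1 l R (L - 2) (L + 2) Lt powr a) \<partial>\<P>)) < 1"
        using less unfolding w_def d_def prod.case .
      show "(R, N ^ 3, N ^ 7, a) \<in> {(R, L, Lt, a). box_specification i1 l R (L - 2) (L + 2) Lt \<and>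
          L ^ 4 > Lt \<and> Lt > L \<and> L > C'' \<and> 0 < a \<and> a \<le> 1}"
        using adm a by simp
    qed
  qed
qed

end
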